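(* Let $G=\mathrm{GIRG}(n,\beta,w_0,d)$ be a standard GIRG with $d=o(\log n)$, and let $K_k$ be the number of $k$-cliques in $G$. Then $$\mathbb{E}[K_k]=\begin{cases} n\exp(-\Theta(1)dk)\,\Theta(k)^{-k}+o(1) & \text{if } k<\frac{2}{3-\beta}\text{ or }\beta\ge 3,\\ n^{\frac k2(3-\beta)}\,\Theta(k)^{-k} & \text{otherwise},\end{cases}$$ where the statement holds for all (possibly superconstant) $k\ge3$ if $\beta\ne3$, and for $k=o(\log n/d)$ if $\beta=3$.
   Context: Fix constants $\lambda>0$, $w_0>0$, $\beta>2$. A standard GIRG $\mathrm{GIRG}(n,\beta,w_0,d)$ has $n$ vertices; each vertex $v$ independently receives a weight $w_v$ with $\Pr[w_v\le x]=1-(x/w_0)^{1-\beta}$ for $x\ge w_0$, and independently a position $\mathbf{x}_v$ uniform on the torus $\mathbb{T}^d=[0,1)^d$. The distance is $d(\mathbf{x}_u,\mathbf{x}_v)=\max_{1\le i\le d}|x_{ui}-x_{vi}|_C$ with $|a-b|_C=\min\{|a-b|,1-|a-b|\}$. Distinct $u,v$ are adjacent iff $d(\mathbf{x}_u,\mathbf{x}_v)\le t_{uv}=\frac12\big(\frac{\lambda w_uw_v}{n}\big)^{1/d}$. The dimension $d=d(n)$ may depend on $n$; asymptotics are as $n\to\infty$. A $k$-clique is a set of $k$ pairwise adjacent vertices. Notation: $\Theta(k)^{-k}$ denotes a quantity between $(c_1k)^{-k}$ and $(c_2k)^{-k}$, and $\exp(-\Theta(1)dk)$ a quantity between $\exp(-c_3dk)$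 and $\exp(-c_4dk)$, for positive constants $c_i$ independent of $n$, $k$, $d$.
   Formalization: In the "otherwise" case the lower bound is claimed only for k ≤ n (for k > n there are no k-cliques), and the upper bound only for k ≠ 2/(3-β), since at k = 2/(3-β) it fails (β=7/3, k=3, d=1 gives E[K_3]=Ω(n log n), not O(n)). *)

theory Defs
  imports "HOL-Probability.Probability" "HOL-Library.Landau_Symbols"
begin

definition weight_cdf :: "real \<Rightarrow> real \<Rightarrow> real \<Rightarrow> real" where
  "weight_cdf w0 \<beta> x = (if x \<ge> w0 then 1 - (x / w0) powr (1 - \<beta>) else 0)"

definition weight_measure :: "real \<Rightarrow> real \<Rightarrow> real measure" where
  "weight_measure w0 \<beta> = interval_measure (weight_cdf w0 \<beta>)"

text \<open>Points of the torus are functions on the coordinate set \<open>{..<d}\<close>, since the dimension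
  varies with the number of vertices.\<close>

definition torus_measure :: "nat \<Rightarrow> (nat \<Rightarrow> real) measure" where
  "torus_measure d = Pi\<^sub>M {..<d} (\<lambda>_. uniform_measure lborel {0..<1})"

definition circle_dist :: "real \<Rightarrow> real \<Rightarrow> real" where
  "circle_dist a b = min \<bar>a - b\<bar> (1 - \<bar>a - b\<bar>)"

text \<open>Only meaningful for \<open>d \<ge> 1\<close>.\<close>

definition torus_dist :: "nat \<Rightarrow> (nat \<Rightarrow> real) \<Rightarrow> (nat \<Rightarrow> real) \<Rightarrow> real" where
  "torus_dist d x y = Max ((\<lambda>i. circle_dist (x i) (y i)) ` {..<d})"

text \<open>The vertices are \<open>{..<n}\<close>; an outcome assigns to every vertex its weight and its position.
  The product measure makes all weights and positions independent.\<close>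

definition girg_measure :: "real \<Rightarrow> real \<Rightarrow> nat \<Rightarrow> nat \<Rightarrow> (nat \<Rightarrow> real \<times> (nat \<Rightarrow> real)) measure" where
  "girg_measure w0 \<beta> n d = Pi\<^sub>M {..<n} (\<lambda>_. weight_measure w0 \<beta> \<Otimes>\<^sub>M torus_measure d)"

definition girg_threshold :: "real \<Rightarrow> nat \<Rightarrow> nat \<Rightarrow> real \<Rightarrow> real \<Rightarrow> real" where
  "girg_threshold lam n d a b = 1 / 2 * (lam * a * b / real n) powr (1 / real d)"

definition girg_adj ::
    "real \<Rightarrow> nat \<Rightarrow> nat \<Rightarrow> (nat \<Rightarrow> real \<times> (nat \<Rightarrow> real)) \<Rightarrow> nat \<Rightarrow> nat \<Rightarrow> bool" where
  "girg_adj lam n d \<omega> u v \<longleftrightarrow> u \<noteq> v \<and>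
     torus_dist d (snd (\<omega> u)) (snd (\<omega> v)) \<le> girg_threshold lam n d (fst (\<omega> u)) (fst (\<omega> v))"

definition girg_cliques ::
    "real \<Rightarrow> nat \<Rightarrow> nat \<Rightarrow> nat \<Rightarrow> (nat \<Rightarrow> real \<times> (nat \<Rightarrow> real)) \<Rightarrow> nat set set" where
  "girg_cliques lam n d k \<omega> =
     {S. S \<subseteq> {..<n} \<and> card S = k \<and> (\<forall>u\<in>S. \<forall>v\<in>S. u \<noteq> v \<longrightarrow> girg_adj lam n d \<omega> u v)}"

definition expected_cliques :: "real \<Rightarrow> real \<Rightarrow> real \<Rightarrow> nat \<Rightarrow> nat \<Rightarrow> nat \<Rightarrow> real" where
  "expected_cliques lam w0 \<beta> n d k =
     (\<integral>\<omega>. real (card (girg_cliques lam n d k \<omega>)) \<partial>girg_measure w0 \<beta> n d)"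

lemma weight_cdf_alt:
  assumes "w0 > 0"
  shows "weight_cdf w0 \<beta> = (\<lambda>x. 1 - (max x w0 / w0) powr (1 - \<beta>))"
  using assms by (auto simp: weight_cdf_def fun_eq_iff max_def)

context
  fixes w0 \<beta> :: real
  assumes w0: "w0 > 0" and \<beta>: "\<beta> > 2"
begin

lemma weight_cdf_mono:
  assumes "x \<le> y"
  shows "weight_cdf w0 \<beta> x \<le> weight_cdf w0 \<beta> y"
proof -
  have "(max y w0 / w0) powr (1 - \<beta>) \<le> (max x w0 / w0) powr (1 - \<beta>)"
  proof (rule powr_mono2')
    show "1 - \<beta> \<le> 0" using \<beta> by simp
    show "0 < max x w0 / w0" using w0 by (intro divide_pos_pos) linarith+
    show "max x w0 / w0 \<le> max y w0 / w0"
      using w0 assms by (intro divide_right_mono max.mono) simp_all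
  qed
  then show ?thesis
    by (simp add: weight_cdf_alt[OF w0])
qed

lemma weight_cdf_continuous: "continuous (at_right a) (weight_cdf w0 \<beta>)"
proof -
  have "max a w0 / w0 \<noteq> 0"
    using w0 by (simp add: max_def)
  then have "((\<lambda>x. 1 - (max x w0 / w0) powr (1 - \<beta>)) \<longlongrightarrow>
      1 - (max a w0 / w0) powr (1 - \<beta>)) (at_right a)"
    using w0 by (intro tendsto_intros) simp_all
  then show ?thesis
    by (simp add: continuous_within weight_cdf_alt[OF w0])
qed

lemma weight_cdf_at_bot: "(weight_cdf w0 \<beta> \<longlongrightarrow> 0) at_bot"
  by (rule tendsto_eventually, rule eventually_mono[OF eventually_gt_at_bot[of w0]])
     (simp add: weight_cdf_def)

lemma weight_cdf_at_top: "(weight_cdf w0 \<beta> \<longlongrightarrow> 1) at_top"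
proof -
  have "filterlim (\<lambda>x. inverse w0 * x) at_top at_top"
    using w0 by (intro filterlim_tendsto_pos_mult_at_top[OF tendsto_const _ filterlim_ident]) simp
  then have "filterlim (\<lambda>x. x / w0) at_top at_top"
    by (simp only: divide_inverse mult.commute)
  then have "((\<lambda>x. (x / w0) powr (1 - \<beta>)) \<longlongrightarrow> 0) at_top"
    using \<beta> by (intro tendsto_neg_powr) simp_all
  then have "((\<lambda>x. 1 - (x / w0) powr (1 - \<beta>)) \<longlongrightarrow> 1 - 0) at_top"
    by (intro tendsto_diff tendsto_const)
  then have "((\<lambda>x. 1 - (x / w0) powr (1 - \<beta>)) \<longlongrightarrow> 1) at_top"
    by simp
  moreover have "\<forall>\<^sub>F x in at_top. 1 - (x / w0) powr (1 - \<beta>) = weight_cdf w0 \<beta> x"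
    by (rule eventually_mono[OF eventually_ge_at_top[of w0]]) (simp add: weight_cdf_def)
  ultimately show ?thesis
    by (rule Lim_transform_eventually)
qed

lemma real_distribution_weight_measure: "real_distribution (weight_measure w0 \<beta>)"
  unfolding weight_measure_def
  by (intro real_distribution_interval_measure weight_cdf_mono weight_cdf_continuous
      weight_cdf_at_bot weight_cdf_at_top)

lemma cdf_weight_measure: "cdf (weight_measure w0 \<beta>) = weight_cdf w0 \<beta>"
  unfolding weight_measure_def
  by (intro cdf_interval_measure weight_cdf_mono weight_cdf_continuous weight_cdf_at_bot)

lemma prob_space_torus_measure: "prob_space (torus_measure d)"
  unfolding torus_measure_def
  by (intro prob_space_PiM prob_space_uniform_measure) auto

lemma prob_space_girg_measure: "prob_space (girg_measure w0 \<beta> n d)"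
  unfolding girg_measure_def
  by (intro prob_space_PiM prob_space_pair prob_space_torus_measure
      real_distribution.axioms(1)[OF real_distribution_weight_measure])

lemma borel_measurable_weight:
  assumes "u < n"
  shows "(\<lambda>\<omega>. fst (\<omega> u)) \<in> borel_measurable (girg_measure w0 \<beta> n d)"
proof -
  have "(\<lambda>\<omega>. \<omega> u) \<in> girg_measure w0 \<beta> n d \<rightarrow>\<^sub>M weight_measure w0 \<beta> \<Otimes>\<^sub>M torus_measure d"
    unfolding girg_measure_def using assms by (intro measurable_component_singleton) simp
  then have "(\<lambda>\<omega>. fst (\<omega> u)) \<in> girg_measure w0 \<beta> n d \<rightarrow>\<^sub>M weight_measure w0 \<beta>"
    by (rule measurable_compose) (rule measurable_fst)
  also have "\<dots> = borel_measurable (girg_measure w0 \<beta> n d)"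
    by (rule measurable_cong_sets) (simp_all add: weight_measure_def)
  finally show ?thesis .
qed

lemma borel_measurable_position:
  assumes "u < n" "i < d"
  shows "(\<lambda>\<omega>. snd (\<omega> u) i) \<in> borel_measurable (girg_measure w0 \<beta> n d)"
proof -
  have "(\<lambda>\<omega>. \<omega> u) \<in> girg_measure w0 \<beta> n d \<rightarrow>\<^sub>M weight_measure w0 \<beta> \<Otimes>\<^sub>M torus_measure d"
    unfolding girg_measure_def using assms by (intro measurable_component_singleton) simp
  then have "(\<lambda>\<omega>. snd (\<omega> u)) \<in> girg_measure w0 \<beta> n d \<rightarrow>\<^sub>M torus_measure d"
    by (rule measurable_compose) (rule measurable_snd)
  moreover have "(\<lambda>x. x i) \<in> torus_measure d \<rightarrow>\<^sub>M uniform_measure lborel {0..<1}"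
    unfolding torus_measure_def using assms by (intro measurable_component_singleton) simp
  ultimately have "(\<lambda>\<omega>. snd (\<omega> u) i) \<in> girg_measure w0 \<beta> n d \<rightarrow>\<^sub>M uniform_measure lborel {0..<1}"
    by (rule measurable_compose)
  also have "\<dots> = borel_measurable (girg_measure w0 \<beta> n d)"
    by (rule measurable_cong_sets) simp_all
  finally show ?thesis .
qed

lemma pred_girg_adj:
  assumes "u < n" "v < n"
  shows "Measurable.pred (girg_measure w0 \<beta> n d) (\<lambda>\<omega>. girg_adj lam n d \<omega> u v)"
proof -
  have dist: "(\<lambda>\<omega>. torus_dist d (snd (\<omega> u)) (snd (\<omega> v)))
      \<in> borel_measurable (girg_measure w0 \<beta> n d)"
    unfolding torus_dist_def circle_dist_def
    by (intro borel_measurable_Max borel_measurable_min borel_measurable_diff borel_measurable_abs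
        borel_measurable_const borel_measurable_position assms) simp_all
  have thr: "(\<lambda>\<omega>. girg_threshold lam n d (fst (\<omega> u)) (fst (\<omega> v)))
      \<in> borel_measurable (girg_measure w0 \<beta> n d)"
    unfolding girg_threshold_def
    by (intro borel_measurable_times borel_measurable_divide borel_measurable_const
        powr_real_measurable borel_measurable_weight assms)
  show ?thesis
    unfolding girg_adj_def
    by (rule pred_intros_logic(3)[OF measurable_const])
       (simp_all only: pred_def borel_measurable_le[OF dist thr] space_count_space UNIV_I)
qed

lemma card_girg_cliques:
  "real (card (girg_cliques lam n d k \<omega>)) =
     (\<Sum>S | S \<subseteq> {..<n} \<and> card S = k.
        of_bool (\<forall>u\<in>S. \<forall>v\<in>S. u \<noteq> v \<longrightarrow> girg_adj lam n d \<omega> u v))"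
proof -
  have "finite {S. S \<subseteq> {..<n} \<and> card S = k}"
    by simp
  then show ?thesis
    by (simp add: girg_cliques_def of_bool_def sum.If_cases Int_def conj_assoc)
qed

lemma integrable_card_girg_cliques:
  "integrable (girg_measure w0 \<beta> n d) (\<lambda>\<omega>. real (card (girg_cliques lam n d k \<omega>)))"
proof -
  interpret prob_space "girg_measure w0 \<beta> n d"
    by (rule prob_space_girg_measure)
  have "integrable (girg_measure w0 \<beta> n d)
      (\<lambda>\<omega>. of_bool (\<forall>u\<in>S. \<forall>v\<in>S. u \<noteq> v \<longrightarrow> girg_adj lam n d \<omega> u v) :: real)"
    if S: "S \<subseteq> {..<n}" for S
  proof (rule integrable_const_bound[where B = 1])
    have fin: "finite S"
      using S finite_subset by blast
    have pred: "Measurable.pred (girg_measure w0 \<beta> n d)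
        (\<lambda>\<omega>. \<forall>u\<in>S. \<forall>v\<in>S. u \<noteq> v \<longrightarrow> girg_adj lam n d \<omega> u v)"
      using S by (intro pred_intros_finite fin pred_intros_logic pred_girg_adj) auto
    show "(\<lambda>\<omega>. of_bool (\<forall>u\<in>S. \<forall>v\<in>S. u \<noteq> v \<longrightarrow> girg_adj lam n d \<omega> u v) :: real)
        \<in> borel_measurable (girg_measure w0 \<beta> n d)"
      unfolding of_bool_def
      by (rule measurable_If[OF borel_measurable_const borel_measurable_const pred[unfolded pred_def]])
  qed (intro AE_I2, simp only: of_bool_def split: if_split, simp)
  then show ?thesis
    unfolding card_girg_cliques by (intro Bochner_Integration.integrable_sum) simp
qed

end

end

theory Submission
  imports Defs
begin

text \<open>Lower bounds: either all vertices fall into a ball around one of them, or all weights are at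
  least \<open>sqrt (n / lam)\<close>, in which case every threshold is at least \<open>1/2\<close>.

  Upper bounds: condition on the vertex \<open>z\<close> of minimal weight \<open>a\<close>. The other vertices are heavier
  neighbours of \<open>z\<close>, and such a neighbour has probability \<open>O(a powr (3 - \<beta>) / n)\<close>; integrating over
  \<open>a \<le> sqrt (n / lam)\<close> gives the dense case. In the sparse case the factor \<open>exp (- c * d * k)\<close> is
  gained by grouping the remaining \<open>k - 1\<close> vertices into pairs: given \<open>z\<close>, the pairs are independent,
  and each must form a triangle with \<open>z\<close>. If both weights of a pair are below \<open>(3/2)^d * a\<close>, then in
  each of the \<open>d\<close> coordinates the triangle condition cuts off a fixed proportion of the rectangle of
  admissible positions; otherwise the tail of the weight distribution supplies a factor
  \<open>(3/2) powr ((2 - \<beta>) * d)\<close>. This needs \<open>lam * a * a / n \<le> 3 powr (- d)\<close>, since otherwise the balls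
  wrap around the torus; cliques in which all weights exceed this bound are negligible because \<open>d\<close>
  (and \<open>d * k\<close> if \<open>\<beta> = 3\<close>) is \<open>o(ln n)\<close>.\<close>

section \<open>Measure of balls and triangles on the circle\<close>

text \<open>Factors \<open>C ^ k\<close> are free: they disappear into the constants of
  \<open>(c * k) powr (- k)\<close>, whose \<open>k powr (- k)\<close> comes from the binomial
  coefficient. Factors exponential in \<open>d * k\<close> are not. Lowering the cutoff on the
  minimal weight from \<open>sqrt (n / lam)\<close> to \<open>sqrt (n / (lam * 3 ^ d))\<close>
  inflates the term in which all weights exceed it by just such a factor; the growth conditions on
  \<open>d\<close> and \<open>k\<close> absorb it into the gap between
  \<open>n powr (k / 2 * (3 - \<beta>))\<close> and \<open>n\<close>. The border between the regimes
  comes from one integral: the minimal weight \<open>a\<close> contributes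
  \<open>a powr ((3 - \<beta>) * (k - 1))\<close> against a density of order
  \<open>a powr (- \<beta>)\<close>. The lower end dominates if
  \<open>(3 - \<beta>) * k < 2\<close>, the cutoff dominates if it is \<open>> 2\<close>, and
  equality gives a logarithm. Away from equality the resulting factor
  \<open>1 / \<bar>(3 - \<beta>) * k - 2\<bar>\<close> is bounded uniformly in \<open>k\<close>,
  because \<open>k\<close> is an integer. Pairing weakens only the constant in the exponent: at
  least \<open>k / 4\<close> disjoint pairs are available.\<close>

lemma nn_integral_periodic_shift:
  fixes f :: "real \<Rightarrow> ennreal"
  assumes [measurable]: "f \<in> borel_measurable borel" and per: "\<And>x. f (x + 1) = f x"
    and h: "0 \<le> h" "h \<le> 1"
  shows "(\<integral>\<^sup>+x\<in>{a..<a+1}. f x \<partial>lborel) = (\<integral>\<^sup>+x\<in>{a+h..<a+h+1}. f x \<partial>lborel)"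
proof -
  have "(\<integral>\<^sup>+x\<in>{a..<a+1}. f x \<partial>lborel)
      = (\<integral>\<^sup>+x. f x * indicator {a..<a+h} x + f x * indicator {a+h..<a+1} x \<partial>lborel)"
    using h by (intro nn_integral_cong) (auto simp: indicator_def)
  also have "\<dots> = (\<integral>\<^sup>+x\<in>{a..<a+h}. f x \<partial>lborel) + (\<integral>\<^sup>+x\<in>{a+h..<a+1}. f x \<partial>lborel)"
    by (intro nn_integral_add) auto
  also have "(\<integral>\<^sup>+x\<in>{a..<a+h}. f x \<partial>lborel) = (\<integral>\<^sup>+x\<in>{a+1..<a+h+1}. f x \<partial>lborel)"
    by (subst (2) nn_integral_real_affine[where c = 1 and t = 1])
       (auto simp: per add.commute[of 1] indicator_def intro!: nn_integral_cong)
  also have "\<dots> + (\<integral>\<^sup>+x\<in>{a+h..<a+1}. f x \<partial>lborel)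
      = (\<integral>\<^sup>+x. f x * indicator {a+1..<a+h+1} x + f x * indicator {a+h..<a+1} x \<partial>lborel)"
    by (intro nn_integral_add[symmetric]) auto
  also have "\<dots> = (\<integral>\<^sup>+x\<in>{a+h..<a+h+1}. f x \<partial>lborel)"
    using h by (intro nn_integral_cong) (auto simp: indicator_def)
  finally show ?thesis .
qed

lemma nn_integral_uniform_unit:
  assumes [measurable]: "f \<in> borel_measurable borel"
  shows "(\<integral>\<^sup>+x. f x \<partial>uniform_measure lborel {0..<1::real}) = (\<integral>\<^sup>+x\<in>{0..<1}. f x \<partial>lborel)"
  by (subst nn_integral_uniform_measure) (auto simp: divide_ennreal_def)

text \<open>The integrand lives on the circle, so the period may be cut anywhere. Cutting opposite
  \<open>z\<close> gives a window symmetric around \<open>0\<close>, on which the circle distance to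
  the centre is the absolute value, and circle integrals become integrals over the line.\<close>

lemma nn_integral_circle_centre:
  fixes f :: "real \<Rightarrow> ennreal"
  assumes [measurable]: "f \<in> borel_measurable borel" and per: "\<And>x. f (x + 1) = f x"
    and z: "z \<in> {0..<1}"
  shows "(\<integral>\<^sup>+x. f (x - z) \<partial>uniform_measure lborel {0..<1}) =
    (\<integral>\<^sup>+x\<in>{-1/2..<1/2}. f x \<partial>lborel)"
proof -
  have "(\<integral>\<^sup>+x. f (x - z) \<partial>uniform_measure lborel {0..<1}) = (\<integral>\<^sup>+x\<in>{0..<1}. f (x - z) \<partial>lborel)"
    by (rule nn_integral_uniform_unit) measurable
  also have "\<dots> = (\<integral>\<^sup>+x\<in>{-z..<-z+1}. f x \<partial>lborel)"
    by (subst nn_integral_real_affine[where c = 1 and t = z])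
       (auto simp: indicator_def intro!: nn_integral_cong)
  also have "\<dots> = (\<integral>\<^sup>+x\<in>{-1/2..<-1/2+1}. f x \<partial>lborel)"
  proof (cases "z \<le> 1/2")
    case True
    with z show ?thesis
      using nn_integral_periodic_shift[of f "1/2 - z" "-1/2"] per by (simp add: algebra_simps)
  next
    case False
    with z show ?thesis
      using nn_integral_periodic_shift[of f "z - 1/2" "-z"] per by (simp add: algebra_simps)
  qed
  finally show ?thesis by simp
qed

text \<open>The 1-periodic extension of \<open>circle_dist\<close>, as a function of the difference.\<close>

definition int_dist :: "real \<Rightarrow> real" where
  "int_dist u = min (frac u) (1 - frac u)"

lemma int_dist_measurable [measurable]: "int_dist \<in> borel_measurable borel"
  unfolding int_dist_def frac_def by measurable

lemma int_dist_add_1 [simp]: "int_dist (u + 1) = int_dist u"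
  by (simp add: int_dist_def frac_1_eq)

lemma int_dist_eq:
  assumes "\<bar>u\<bar> < 1"
  shows "int_dist u = min \<bar>u\<bar> (1 - \<bar>u\<bar>)"
proof (cases "u \<ge> 0")
  case True
  then have "frac u = u" using assms by (simp add: frac_eq)
  then show ?thesis using True by (simp add: int_dist_def)
next
  case False
  then have "frac (u + 1) = u + 1" using assms by (subst frac_eq) auto
  then have "frac u = u + 1" by (simp add: frac_1_eq)
  then show ?thesis using False by (simp add: int_dist_def min.commute)
qed

lemma circle_dist_eq_int_dist:
  assumes "x \<in> {0..<1}" "y \<in> {0..<1}"
  shows "circle_dist x y = int_dist (x - y)"
  using assms by (subst int_dist_eq) (auto simp: circle_dist_def)

lemma AE_uniform_unit: "AE x in uniform_measure lborel {0..<1::real}. x \<in> {0..<1}"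
  by (intro AE_uniform_measureI) auto

text \<open>For \<open>r < 1/2\<close> the arc is the interval \<open>{-r..r}\<close> of the centred
  window and does not meet itself.\<close>

lemma nn_integral_circle_ball:
  assumes z: "z \<in> {0..<1}" and r: "0 \<le> r" "r < 1/2"
  shows "(\<integral>\<^sup>+x. indicator {x. circle_dist z x \<le> r} x \<partial>uniform_measure lborel {0..<1}) = ennreal (2 * r)"
proof -
  have "(\<integral>\<^sup>+x. indicator {x. circle_dist z x \<le> r} x \<partial>uniform_measure lborel {0..<1})
      = (\<integral>\<^sup>+x. indicator {u. int_dist u \<le> r} (x - z) \<partial>uniform_measure lborel {0..<1})"
  proof (intro nn_integral_cong_AE, use AE_uniform_unit in eventually_elim)
    fix x :: real assume "x \<in> {0..<1}"
    moreover have "circle_dist z x = circle_dist x z"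
      by (simp add: circle_dist_def abs_minus_commute)
    ultimately show "indicator {x. circle_dist z x \<le> r} x = (indicator {u. int_dist u \<le> r} (x - z) :: ennreal)"
      using z by (simp add: circle_dist_eq_int_dist indicator_def)
  qed
  also have "\<dots> = (\<integral>\<^sup>+x\<in>{-1/2..<1/2}. indicator {u. int_dist u \<le> r} x \<partial>lborel)"
    using z by (intro nn_integral_circle_centre) (auto simp: indicator_def)
  also have "\<dots> = (\<integral>\<^sup>+x. indicator {-r..r} x \<partial>lborel)"
    using r by (intro nn_integral_cong) (auto simp: indicator_def int_dist_eq)
  also have "\<dots> = ennreal (2 * r)"
    using r by simp
  finally show ?thesis .
qed

text \<open>For \<open>r \<ge> 1/2\<close> the right-hand side is at least the total mass
  \<open>1\<close>, so later upper bounds need no case distinction for balls that wrap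
  around.\<close>

lemma nn_integral_circle_ball_le:
  assumes z: "z \<in> {0..<1}" and r: "0 \<le> r"
  shows "(\<integral>\<^sup>+x. indicator {x. circle_dist z x \<le> r} x \<partial>uniform_measure lborel {0..<1}) \<le> ennreal (2 * r)"
proof (cases "r < 1/2")
  case True
  then show ?thesis using nn_integral_circle_ball[OF z r] by simp
next
  case False
  interpret prob_space "uniform_measure lborel {0..<1::real}"
    by (rule prob_space_uniform_measure) auto
  have "(\<integral>\<^sup>+x. indicator {x. circle_dist z x \<le> r} x \<partial>uniform_measure lborel {0..<1})
    \<le> (\<integral>\<^sup>+x. 1 \<partial>uniform_measure lborel {0..<1::real})"
    by (intro nn_integral_mono) (auto simp: indicator_def)
  also have "\<dots> = 1" using emeasure_space_1 by simp
  also have "1 \<le> ennreal (2 * r)" using False by simp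
  finally show ?thesis .
qed

text \<open>Two points in the balls of radii \<open>r\<close> and \<open>s\<close> around \<open>z\<close> that lie more than \<open>t/2\<close> to the
  right and to the left of \<open>z\<close>, respectively, are too far apart; this corner of the rectangle is
  what is subtracted.\<close>

lemma nn_integral_circle_triangle_le:
  assumes z: "z \<in> {0..<1}" and pos: "0 < r" "0 < s" "0 < t" and le: "t \<le> 2 * r" "t \<le> 2 * s"
    and small: "r + s + t < 1" "r < 1/2" "s < 1/2"
  shows "(\<integral>\<^sup>+x. \<integral>\<^sup>+y. indicator {(x, y). circle_dist z x \<le> r \<and> circle_dist z y \<le> s \<and> circle_dist x y \<le> t} (x, y)
      \<partial>uniform_measure lborel {0..<1} \<partial>uniform_measure lborel {0..<1})
    \<le> ennreal (4 * r * s - (r - t / 2) * (s - t / 2))"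
proof -
  let ?U = "uniform_measure lborel {0..<1::real}"
  define g :: "real \<Rightarrow> ennreal" where "g u =
    (\<integral>\<^sup>+v\<in>{-1/2..<1/2}. indicator {v. int_dist u \<le> r \<and> int_dist v \<le> s \<and> int_dist (u - v) \<le> t} v \<partial>lborel)" for u
  have [measurable]: "g \<in> borel_measurable borel"
    unfolding g_def by measurable
  have inner: "(\<integral>\<^sup>+y. indicator {(x, y). circle_dist z x \<le> r \<and> circle_dist z y \<le> s \<and> circle_dist x y \<le> t} (x, y) \<partial>?U)
      = g (x - z)" if x: "x \<in> {0..<1}" for x
  proof -
    have sym: "circle_dist z x = circle_dist x z" for x
      by (simp add: circle_dist_def abs_minus_commute)
    have "(\<integral>\<^sup>+y. indicator {(x, y). circle_dist z x \<le> r \<and> circle_dist z y \<le> s \<and> circle_dist x y \<le> t} (x, y) \<partial>?U)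
      = (\<integral>\<^sup>+y. indicator {v. int_dist (x - z) \<le> r \<and> int_dist v \<le> s \<and> int_dist ((x - z) - v) \<le> t} (y - z) \<partial>?U)"
      by (intro nn_integral_cong_AE, use AE_uniform_unit in eventually_elim)
         (use z x in \<open>simp add: indicator_def circle_dist_eq_int_dist sym[of x] sym[of "_::real"]\<close>)
    also have "\<dots> = g (x - z)"
      unfolding g_def
    proof (rule nn_integral_circle_centre[OF _ _ z])
      have "int_dist (x - z - (v + 1)) = int_dist (x - z - v)" for v
        using int_dist_add_1[of "x - z - (v + 1)"] by (simp add: algebra_simps)
      then show "indicator {v. int_dist (x - z) \<le> r \<and> int_dist v \<le> s \<and> int_dist (x - z - v) \<le> t} (v + 1)
          = (indicator {v. int_dist (x - z) \<le> r \<and> int_dist v \<le> s \<and> int_dist (x - z - v) \<le> t} v :: ennreal)" for v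
        by (simp add: indicator_def)
    qed measurable
    finally show ?thesis .
  qed
  have "(\<integral>\<^sup>+x. \<integral>\<^sup>+y. indicator {(x, y). circle_dist z x \<le> r \<and> circle_dist z y \<le> s \<and> circle_dist x y \<le> t} (x, y)
      \<partial>?U \<partial>?U) = (\<integral>\<^sup>+x. g (x - z) \<partial>?U)"
    by (intro nn_integral_cong_AE, use AE_uniform_unit in eventually_elim) (rule inner)
  also have "\<dots> = (\<integral>\<^sup>+u\<in>{-1/2..<1/2}. g u \<partial>lborel)"
  proof (rule nn_integral_circle_centre[OF _ _ z])
    have "int_dist (u + 1 - v) = int_dist (u - v)" for u v
      using int_dist_add_1[of "u - v"] by (simp add: algebra_simps)
    then show "g (u + 1) = g u" for u
      unfolding g_def by simp
  qed measurable
  \<comment> \<open>For \<open>u \<le> t/2\<close> the whole interval of length \<open>2 * s\<close>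
    is granted to \<open>v\<close>. For \<open>u > t/2\<close> every \<open>v < -t/2\<close> is too
    far away, which leaves length \<open>s + t/2\<close>. The opposite corner could be removed as
    well; one suffices.\<close>
  also have "\<dots> \<le> (\<integral>\<^sup>+u. ennreal (2 * s) * indicator {-r..t/2} u
      + ennreal (s + t / 2) * indicator {t/2<..r} u \<partial>lborel)"
  proof (rule nn_integral_mono)
    fix u :: real
    have len: "emeasure lborel {-s..s} = ennreal (2 * s)" "emeasure lborel {-t/2..s} = ennreal (s + t / 2)"
      using pos le by (simp_all add: algebra_simps)
    show "g u * indicator {-1/2..<1/2} u \<le>
        ennreal (2 * s) * indicator {-r..t/2} u + ennreal (s + t / 2) * indicator {t/2<..r} u"
    proof (cases "u \<in> {-1/2..<1/2} \<and> \<bar>u\<bar> \<le> r")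
      case True
      then have u: "-r \<le> u" "u \<le> r" by auto
      show ?thesis
      proof (cases "u \<le> t / 2")
        case True
        have "g u \<le> (\<integral>\<^sup>+v. indicator {-s..s} v \<partial>lborel)"
          unfolding g_def using small
          by (intro nn_integral_mono) (auto simp: indicator_def int_dist_eq)
        also have "\<dots> = ennreal (2 * s)" using len by simp
        finally show ?thesis using True u by (auto simp: indicator_def)
      next
        case False
        have "g u \<le> (\<integral>\<^sup>+v. indicator {-t/2..s} v \<partial>lborel)"
          unfolding g_def
        proof (intro nn_integral_mono)
          fix v :: real
          show "indicator {v. int_dist u \<le> r \<and> int_dist v \<le> s \<and> int_dist (u - v) \<le> t} v * indicator {-1/2..<1/2} v
            \<le> (indicator {-t/2..s} v :: ennreal)"
          proof (cases "v \<in> {-1/2..<1/2} \<and> int_dist v \<le> s \<and> int_dist (u - v) \<le> t")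
            case True
            then have v: "\<bar>v\<bar> \<le> s" by (auto simp: int_dist_eq)
            then have "int_dist (u - v) = min \<bar>u - v\<bar> (1 - \<bar>u - v\<bar>)"
              using u small pos by (intro int_dist_eq) linarith
            \<comment> \<open>The second alternative is the route around the circle. It is
              impossible, since \<open>\<bar>u - v\<bar> \<le> r + s < 1 - t\<close>.\<close>
            then have "\<bar>u - v\<bar> \<le> t \<or> 1 - \<bar>u - v\<bar> \<le> t" using True by auto
            then have "u - v \<le> t" using u v small pos by linarith
            then have "v \<in> {-t/2..s}" using v False by auto
            then show ?thesis by (auto simp: indicator_def)
          qed (auto simp: indicator_def)
        qed
        also have "\<dots> = ennreal (s + t / 2)" using len by simp
        finally show ?thesis using False u by (auto simp: indicator_def)
      qed
    next
      case False
      then have "g u * indicator {-1/2..<1/2} u = 0"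
        unfolding g_def by (auto simp: indicator_def int_dist_eq)
      then show ?thesis by (simp only: zero_le)
    qed
  qed
  also have "\<dots> = ennreal (2 * s) * ennreal (r + t / 2) + ennreal (s + t / 2) * ennreal (r - t / 2)"
  proof -
    have "emeasure lborel {-r..t/2} = ennreal (r + t / 2)" "emeasure lborel {t/2<..r} = ennreal (r - t / 2)"
      using pos le by (simp_all add: add.commute)
    then show ?thesis
      by (subst nn_integral_add) (auto simp: nn_integral_cmult)
  qed
  also have "\<dots> = ennreal (4 * r * s - (r - t / 2) * (s - t / 2))"
    using pos le by (subst ennreal_mult[symmetric] ennreal_plus[symmetric], simp, simp)+
      (simp add: algebra_simps)
  finally show ?thesis .
qed

section \<open>The weight distribution\<close>

text \<open>Pareto density without its cutoff at \<open>w0\<close>. The cutoff is supplied by an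
  indicator, so that the antiderivatives are plain powers on all positive reals.\<close>

definition weight_density :: "real \<Rightarrow> real \<Rightarrow> real \<Rightarrow> real" where
  "weight_density w0 \<beta> x = (\<beta> - 1) * w0 powr (\<beta> - 1) * x powr (-\<beta>)"

lemma weight_density_measurable [measurable]: "weight_density w0 \<beta> \<in> borel_measurable borel"
  unfolding weight_density_def by measurable

context
  fixes w0 \<beta> :: real
  assumes w0: "w0 > 0" and \<beta>: "\<beta> > 2"
begin

lemma weight_tail_powr:
  assumes "x > 0"
  shows "w0 powr (\<beta> - 1) * x powr (1 - \<beta>) = (x / w0) powr (1 - \<beta>)"
proof -
  have "(x / w0) powr (1 - \<beta>) = x powr (1 - \<beta>) / w0 powr (1 - \<beta>)"
    using w0 assms by (intro powr_divide)
  also have "w0 powr (1 - \<beta>) = inverse (w0 powr (\<beta> - 1))"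
    by (simp add: powr_minus[symmetric])
  finally show ?thesis by (simp only: divide_inverse inverse_inverse_eq mult.commute)
qed

text \<open>At \<open>s = \<beta> - 1\<close> the antiderivative would be a logarithm. With
  \<open>s = (3 - \<beta>) * (k - 1)\<close> this is the critical clique size
  \<open>k = 2 / (3 - \<beta>)\<close>.\<close>

lemma weight_moment_DERIV:
  assumes "x > 0" "s \<noteq> \<beta> - 1"
  shows "DERIV (\<lambda>x. (\<beta> - 1) / (s + 1 - \<beta>) * w0 powr (\<beta> - 1) * x powr (s + 1 - \<beta>)) x
    :> x powr s * weight_density w0 \<beta> x"
proof -
  let ?C = "(\<beta> - 1) / (s + 1 - \<beta>) * w0 powr (\<beta> - 1)"
  have "DERIV (\<lambda>x. ?C * x powr (s + 1 - \<beta>)) x :> ?C * ((s + 1 - \<beta>) * x powr (s + 1 - \<beta> - 1))"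
    using assms by (intro DERIV_cmult has_real_derivative_powr)
  also have "x powr (s + 1 - \<beta> - 1) = x powr s * x powr (-\<beta>)"
    by (simp add: powr_add[symmetric])
  finally show ?thesis
    using assms by (simp add: weight_density_def mult_ac)
qed

lemma weight_density_nonneg: "0 \<le> weight_density w0 \<beta> x"
  using \<beta> by (simp add: weight_density_def)

lemma weight_density_moment_tail:
  assumes "b > 0" "s < \<beta> - 1"
  shows "(\<integral>\<^sup>+x\<in>{b..}. ennreal (x powr s * weight_density w0 \<beta> x) \<partial>lborel) =
    ennreal ((\<beta> - 1) / (\<beta> - 1 - s) * w0 powr (\<beta> - 1) * b powr (s + 1 - \<beta>))"
proof -
  let ?F = "\<lambda>x. (\<beta> - 1) / (s + 1 - \<beta>) * w0 powr (\<beta> - 1) * x powr (s + 1 - \<beta>)"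
  have "(?F \<longlongrightarrow> (\<beta> - 1) / (s + 1 - \<beta>) * w0 powr (\<beta> - 1) * 0) at_top"
    using assms by (intro tendsto_mult tendsto_const tendsto_neg_powr filterlim_ident) simp_all
  then have lim: "(?F \<longlongrightarrow> 0) at_top" by simp
  have "(\<integral>\<^sup>+x\<in>{b..}. ennreal (x powr s * weight_density w0 \<beta> x) \<partial>lborel) = ennreal (0 - ?F b)"
    using assms weight_density_nonneg
    by (intro nn_integral_FTC_atLeast lim weight_moment_DERIV) auto
  also have "0 - ?F b = (\<beta> - 1) / (\<beta> - 1 - s) * w0 powr (\<beta> - 1) * b powr (s + 1 - \<beta>)"
    using assms by (simp add: divide_simps) (simp add: algebra_simps)
  finally show ?thesis .
qed

text \<open>A real distribution is determined by its distribution function; comparing these turns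
  moments of the Stieltjes measure into Lebesgue integrals.\<close>

lemma weight_measure_eq_density:
  "weight_measure w0 \<beta> = density lborel (\<lambda>x. ennreal (weight_density w0 \<beta> x) * indicator {w0..} x)"
    (is "_ = ?D")
proof (rule cdf_unique)
  show "real_distribution (weight_measure w0 \<beta>)"
    by (rule real_distribution_weight_measure[OF w0 \<beta>])
  have sp: "emeasure ?D UNIV = 1"
  proof -
    have "emeasure ?D UNIV = (\<integral>\<^sup>+x\<in>{w0..}. ennreal (x powr 0 * weight_density w0 \<beta> x) \<partial>lborel)"
      using w0 by (subst emeasure_density) (auto intro!: nn_integral_cong simp: indicator_def)
    also have "\<dots> = ennreal (w0 powr (\<beta> - 1) * w0 powr (1 - \<beta>))"
      using w0 \<beta> by (subst weight_density_moment_tail) auto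
    also have "w0 powr (\<beta> - 1) * w0 powr (1 - \<beta>) = 1"
      using w0 by (simp add: powr_add[symmetric])
    finally show ?thesis by simp
  qed
  then interpret prob_space ?D
    by (intro prob_spaceI) (simp)
  show "real_distribution ?D"
    by (intro real_distribution.intro real_distribution_axioms.intro)
       (auto intro: prob_space_axioms)
  show "cdf (weight_measure w0 \<beta>) = cdf ?D"
  proof
    fix x :: real
    show "cdf (weight_measure w0 \<beta>) x = cdf ?D x"
    proof (cases "x \<ge> w0")
      case False
      then have "emeasure ?D {..x} = (\<integral>\<^sup>+y. 0 \<partial>(lborel :: real measure))"
        by (subst emeasure_density, simp, simp, intro nn_integral_cong) (auto simp: indicator_def)
      then show ?thesis using False
        unfolding cdf_weight_measure[OF w0 \<beta>] by (simp add: weight_cdf_def cdf_def measure_def)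
    next
      case True
      let ?F = "\<lambda>x. (\<beta> - 1) / (0 + 1 - \<beta>) * w0 powr (\<beta> - 1) * x powr (0 + 1 - \<beta>)"
      have "emeasure ?D {..x} = (\<integral>\<^sup>+y. ennreal (y powr 0 * weight_density w0 \<beta> y) * indicator {w0..x} y \<partial>lborel)"
        using w0 by (subst emeasure_density) (auto intro!: nn_integral_cong simp: indicator_def)
      also have "\<dots> = ennreal (?F x - ?F w0)"
        using w0 True \<beta> weight_density_nonneg
        by (intro nn_integral_FTC_Icc has_real_derivative_iff_has_vector_derivative[THEN iffD1]
              DERIV_subset[OF weight_moment_DERIV]) auto
      also have "?F x - ?F w0 = w0 powr (\<beta> - 1) * w0 powr (1 - \<beta>) - w0 powr (\<beta> - 1) * x powr (1 - \<beta>)"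
        using \<beta> by (simp add: divide_simps) (simp add: algebra_simps)
      also have "\<dots> = 1 - (x / w0) powr (1 - \<beta>)"
        using w0 True weight_tail_powr[of w0] weight_tail_powr[of x] by simp
      finally have "emeasure ?D {..x} = ennreal (1 - (x / w0) powr (1 - \<beta>))" .
      moreover have "(x / w0) powr (1 - \<beta>) \<le> 1 powr (1 - \<beta>)"
        using w0 True \<beta> by (intro powr_mono2') auto
      ultimately show ?thesis using True
        unfolding cdf_weight_measure[OF w0 \<beta>] by (simp add: weight_cdf_def cdf_def measure_def)
    qed
  qed
qed

lemma sets_weight_measure [measurable_cong, simp]: "sets (weight_measure w0 \<beta>) = sets borel"
  by (simp add: weight_measure_def)

lemma nn_integral_weight_measure:
  assumes [measurable]: "f \<in> borel_measurable borel"
  shows "(\<integral>\<^sup>+x. f x \<partial>weight_measure w0 \<beta>) = (\<integral>\<^sup>+x\<in>{w0..}. f x * ennreal (weight_density w0 \<beta> x) \<partial>lborel)"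
  unfolding weight_measure_eq_density
  by (subst nn_integral_density) (auto intro!: nn_integral_cong simp: mult_ac)

lemma weight_moment_tail:
  assumes "b \<ge> w0" "s < \<beta> - 1"
  shows "(\<integral>\<^sup>+x\<in>{b..}. ennreal (x powr s) \<partial>weight_measure w0 \<beta>) =
    ennreal ((\<beta> - 1) / (\<beta> - 1 - s) * w0 powr (\<beta> - 1) * b powr (s + 1 - \<beta>))"
proof -
  have "(\<integral>\<^sup>+x\<in>{b..}. ennreal (x powr s) \<partial>weight_measure w0 \<beta>) =
      (\<integral>\<^sup>+x\<in>{b..}. ennreal (x powr s * weight_density w0 \<beta> x) \<partial>lborel)"
    using assms weight_density_nonneg
    by (subst nn_integral_weight_measure)
       (auto intro!: nn_integral_cong simp: indicator_def ennreal_mult')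
  then show ?thesis
    using assms w0 by (simp add: weight_density_moment_tail)
qed

text \<open>For \<open>s > \<beta> - 1\<close> the full moment is infinite and the truncated one is
  governed by its upper end. The boundary term at \<open>w0\<close> enters with a negative sign and
  is dropped.\<close>

lemma weight_moment_truncated:
  assumes "A \<ge> w0" "s > \<beta> - 1"
  shows "(\<integral>\<^sup>+x\<in>{..A}. ennreal (x powr s) \<partial>weight_measure w0 \<beta>) \<le>
    ennreal ((\<beta> - 1) / (s - (\<beta> - 1)) * w0 powr (\<beta> - 1) * A powr (s + 1 - \<beta>))"
proof -
  let ?F = "\<lambda>x. (\<beta> - 1) / (s + 1 - \<beta>) * w0 powr (\<beta> - 1) * x powr (s + 1 - \<beta>)"
  have "(\<integral>\<^sup>+x\<in>{..A}. ennreal (x powr s) \<partial>weight_measure w0 \<beta>) =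
      (\<integral>\<^sup>+x. ennreal (x powr s * weight_density w0 \<beta> x) * indicator {w0..A} x \<partial>lborel)"
    using assms weight_density_nonneg
    by (subst nn_integral_weight_measure)
       (auto intro!: nn_integral_cong simp: indicator_def ennreal_mult')
  also have "\<dots> = ennreal (?F A - ?F w0)"
    using w0 assms weight_density_nonneg
    by (intro nn_integral_FTC_Icc has_real_derivative_iff_has_vector_derivative[THEN iffD1]
          DERIV_subset[OF weight_moment_DERIV]) auto
  also have "\<dots> \<le> ennreal (?F A)"
    using assms \<beta> by (intro ennreal_leI) auto
  also have "?F A = (\<beta> - 1) / (s - (\<beta> - 1)) * w0 powr (\<beta> - 1) * A powr (s + 1 - \<beta>)"
    by (simp add: algebra_simps)
  finally show ?thesis .
qed

lemma AE_weight_ge: "AE x in weight_measure w0 \<beta>. x \<ge> w0"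
  unfolding weight_measure_eq_density
  by (subst AE_density) (auto simp: indicator_def)

lemma emeasure_weight_ge:
  assumes "A \<ge> w0"
  shows "emeasure (weight_measure w0 \<beta>) {A..} = ennreal ((A / w0) powr (1 - \<beta>))"
proof -
  have "emeasure (weight_measure w0 \<beta>) {A..} = (\<integral>\<^sup>+x\<in>{A..}. ennreal (x powr 0) \<partial>weight_measure w0 \<beta>)"
    using assms w0
    by (subst nn_integral_indicator[symmetric], simp, intro nn_integral_cong) (auto simp: indicator_def)
  also have "\<dots> = ennreal (w0 powr (\<beta> - 1) * A powr (1 - \<beta>))"
    using assms \<beta> by (subst weight_moment_tail) auto
  also have "w0 powr (\<beta> - 1) * A powr (1 - \<beta>) = (A / w0) powr (1 - \<beta>)"
    using w0 assms by (intro weight_tail_powr) simp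
  finally show ?thesis .
qed

text \<open>For \<open>A < w0\<close> the power is at least \<open>1\<close>. This case occurs
  because the sparse bound does not compare its cutoff \<open>sqrt (n / (lam * 3 ^ d))\<close> with
  \<open>w0\<close>.\<close>

lemma emeasure_weight_ge_le:
  assumes "A > 0"
  shows "emeasure (weight_measure w0 \<beta>) {A..} \<le> ennreal ((A / w0) powr (1 - \<beta>))"
proof (cases "A \<ge> w0")
  case True
  then show ?thesis by (simp add: emeasure_weight_ge)
next
  case False
  interpret real_distribution "weight_measure w0 \<beta>"
    by (rule real_distribution_weight_measure[OF w0 \<beta>])
  have "1 powr (1 - \<beta>) \<le> (A / w0) powr (1 - \<beta>)"
    using assms False w0 \<beta> by (intro powr_mono2') auto
  then have "1 \<le> ennreal ((A / w0) powr (1 - \<beta>))" by simp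
  then show ?thesis
    using emeasure_le_1 order_trans by blast
qed

end

section \<open>Balls and triangles on the torus\<close>

lemma prod_mono_ennreal:
  fixes f g :: "'a \<Rightarrow> ennreal"
  assumes "\<And>i. i \<in> I \<Longrightarrow> f i \<le> g i"
  shows "prod f I \<le> prod g I"
  using assms by (induction I rule: infinite_finite_induct) (auto intro!: mult_mono)

lemma torus_dist_le_iff:
  assumes "d \<ge> 1"
  shows "torus_dist d x y \<le> r \<longleftrightarrow> (\<forall>i<d. circle_dist (x i) (y i) \<le> r)"
  using assms unfolding torus_dist_def by (subst Max_le_iff) (auto simp: lessThan_empty_iff)

lemma circle_dist_measurable [measurable]:
  assumes [measurable]: "f \<in> borel_measurable M" "g \<in> borel_measurable M"
  shows "(\<lambda>x. circle_dist (f x) (g x)) \<in> borel_measurable M"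
  unfolding circle_dist_def by measurable

lemma sets_torus_measure [measurable_cong]: "sets (torus_measure d) = sets (Pi\<^sub>M {..<d} (\<lambda>_. borel))"
  unfolding torus_measure_def by (intro sets_PiM_cong) auto

lemma torus_component_measurable:
  assumes "i < d"
  shows "(\<lambda>x. x i) \<in> borel_measurable (torus_measure d)"
proof -
  have "(\<lambda>x. x i) \<in> borel_measurable (Pi\<^sub>M {..<d} (\<lambda>_. borel :: real measure))"
    using assms by (intro measurable_component_singleton) simp
  then show ?thesis
    using measurable_cong_sets[OF sets_torus_measure refl] by blast
qed

lemma torus_dist_measurable [measurable]:
  assumes "f \<in> M \<rightarrow>\<^sub>M torus_measure d" "g \<in> M \<rightarrow>\<^sub>M torus_measure d"
  shows "(\<lambda>x. torus_dist d (f x) (g x)) \<in> borel_measurable M"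
  using assms unfolding torus_dist_def
  by (intro borel_measurable_Max circle_dist_measurable measurable_compose[OF _ torus_component_measurable]) auto

lemma AE_torus_unit: "AE x in torus_measure d. \<forall>i<d. x i \<in> {0..<1}"
proof -
  have "AE x in torus_measure d. x i \<in> {0..<1}" if "i < d" for i
    unfolding torus_measure_def using that
    by (intro AE_PiM_component prob_space_uniform_measure AE_uniform_unit) auto
  then have "\<forall>i\<in>{..<d}. AE x in torus_measure d. x i \<in> {0..<1}" by blast
  then have "AE x in torus_measure d. \<forall>i\<in>{..<d}. x i \<in> {0..<1}"
    by (intro AE_finite_allI) auto
  then show ?thesis by (rule eventually_mono) auto
qed

interpretation unit_product: product_sigma_finite "\<lambda>_::nat. uniform_measure lborel {0..<1::real}"
  by (intro product_sigma_finite.intro prob_space_imp_sigma_finite prob_space_uniform_measure) auto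

text \<open>The maximum norm turns the indicator of a ball into a product over the coordinates, and
  these are independent.\<close>

lemma nn_integral_torus_ball:
  assumes d: "d \<ge> 1"
  shows "(\<integral>\<^sup>+x. indicator {x. torus_dist d z x \<le> r} x \<partial>torus_measure d) =
    (\<Prod>i<d. \<integral>\<^sup>+x. indicator {x. circle_dist (z i) x \<le> r} x \<partial>uniform_measure lborel {0..<1})"
proof -
  have "(\<integral>\<^sup>+x. indicator {x. torus_dist d z x \<le> r} x \<partial>torus_measure d) =
      (\<integral>\<^sup>+x. (\<Prod>i<d. indicator {x. circle_dist (z i) x \<le> r} (x i)) \<partial>torus_measure d)"
    using d by (intro nn_integral_cong) (auto simp: indicator_def torus_dist_le_iff)
  also have "\<dots> = (\<Prod>i<d. \<integral>\<^sup>+x. indicator {x. circle_dist (z i) x \<le> r} x \<partial>uniform_measure lborel {0..<1})"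
    unfolding torus_measure_def by (rule unit_product.product_nn_integral_prod) auto
  finally show ?thesis .
qed

lemma nn_integral_torus_ball_eq:
  assumes "d \<ge> 1" "\<forall>i<d. z i \<in> {0..<1}" "0 \<le> r" "r < 1/2"
  shows "(\<integral>\<^sup>+x. indicator {x. torus_dist d z x \<le> r} x \<partial>torus_measure d) = ennreal ((2 * r) ^ d)"
  using assms by (simp add: nn_integral_torus_ball nn_integral_circle_ball ennreal_power
      del: nn_integral_indicator nn_integral_indicator_singleton)

lemma nn_integral_torus_ball_le:
  assumes "d \<ge> 1" "\<forall>i<d. z i \<in> {0..<1}" "0 \<le> r"
  shows "(\<integral>\<^sup>+x. indicator {x. torus_dist d z x \<le> r} x \<partial>torus_measure d) \<le> ennreal ((2 * r) ^ d)"
proof -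
  have "(\<Prod>i<d. \<integral>\<^sup>+x. indicator {x. circle_dist (z i) x \<le> r} x \<partial>uniform_measure lborel {0..<1})
      \<le> (\<Prod>i<d. ennreal (2 * r))"
    using assms by (intro prod_mono_ennreal nn_integral_circle_ball_le) auto
  also have "\<dots> = ennreal ((2 * r) ^ d)"
    using assms by (simp add: ennreal_power)
  finally show ?thesis
    using assms by (simp only: nn_integral_torus_ball)
qed

text \<open>All three distance conditions split over the coordinates, so the double integral
  factorises, first over \<open>y\<close> for fixed \<open>x\<close> and then over
  \<open>x\<close>.\<close>

lemma nn_integral_torus_triangle:
  assumes d: "d \<ge> 1"
  shows "(\<integral>\<^sup>+x. \<integral>\<^sup>+y. indicator {(x, y). torus_dist d z x \<le> r \<and> torus_dist d z y \<le> s \<and> torus_dist d x y \<le> t} (x, y)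
      \<partial>torus_measure d \<partial>torus_measure d) =
    (\<Prod>i<d. \<integral>\<^sup>+x. \<integral>\<^sup>+y. indicator {(x, y). circle_dist (z i) x \<le> r \<and> circle_dist (z i) y \<le> s \<and> circle_dist x y \<le> t} (x, y)
      \<partial>uniform_measure lborel {0..<1} \<partial>uniform_measure lborel {0..<1})"
proof -
  let ?U = "uniform_measure lborel {0..<1::real}"
  let ?G = "\<lambda>i x y. indicator {(x, y). circle_dist (z i) x \<le> r \<and> circle_dist (z i) y \<le> s \<and> circle_dist x y \<le> t} (x, y) :: ennreal"
  interpret U: prob_space ?U
    by (rule prob_space_uniform_measure) auto
  have U_borel: "borel_measurable ?U = (borel_measurable borel :: (real \<Rightarrow> ennreal) set)"
    by (rule measurable_cong_sets) simp_all
  have pair: "(\<lambda>(x, y). ?G i x y) \<in> borel_measurable (borel \<Otimes>\<^sub>M borel)" for i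
  proof -
    have "Measurable.pred (borel \<Otimes>\<^sub>M borel) (\<lambda>(x, y). circle_dist (z i) x \<le> r \<and> circle_dist (z i) y \<le> s \<and> circle_dist x y \<le> t)"
      by measurable
    then show ?thesis by measurable
  qed
  have G: "?G i x \<in> borel_measurable ?U" "(\<lambda>x. \<integral>\<^sup>+y. ?G i x y \<partial>?U) \<in> borel_measurable ?U" for i x
  proof -
    have "Pair x \<in> borel \<rightarrow>\<^sub>M borel \<Otimes>\<^sub>M (borel :: real measure)"
      by (rule measurable_Pair1') simp
    from measurable_compose[OF this pair[of i]] have "(\<lambda>y. ?G i x y) \<in> borel_measurable borel"
      by (simp only: prod.case)
    then show "?G i x \<in> borel_measurable ?U" by (simp only: U_borel)
    have "(\<lambda>(x, y). ?G i x y) \<in> borel_measurable (borel \<Otimes>\<^sub>M ?U)"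
      using pair[of i] measurable_cong_sets[OF sets_pair_measure_cong[of borel borel ?U borel] refl] by simp
    then have "(\<lambda>x. \<integral>\<^sup>+y. ?G i x y \<partial>?U) \<in> borel_measurable borel"
      by (rule sigma_finite_measure.borel_measurable_nn_integral[OF prob_space_imp_sigma_finite[OF U.prob_space_axioms]])
    then show "(\<lambda>x. \<integral>\<^sup>+y. ?G i x y \<partial>?U) \<in> borel_measurable ?U"
      by (simp only: U_borel)
  qed
  have "(\<integral>\<^sup>+x. \<integral>\<^sup>+y. indicator {(x, y). torus_dist d z x \<le> r \<and> torus_dist d z y \<le> s \<and> torus_dist d x y \<le> t} (x, y)
      \<partial>torus_measure d \<partial>torus_measure d) =
      (\<integral>\<^sup>+x. \<integral>\<^sup>+y. (\<Prod>i<d. ?G i (x i) (y i)) \<partial>torus_measure d \<partial>torus_measure d)"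
    using d by (intro nn_integral_cong) (auto simp: indicator_def torus_dist_le_iff)
  also have "\<dots> = (\<integral>\<^sup>+x. (\<Prod>i<d. \<integral>\<^sup>+y. ?G i (x i) y \<partial>?U) \<partial>torus_measure d)"
    unfolding torus_measure_def
    by (intro nn_integral_cong unit_product.product_nn_integral_prod G finite_lessThan)
  also have "\<dots> = (\<Prod>i<d. \<integral>\<^sup>+x. \<integral>\<^sup>+y. ?G i x y \<partial>?U \<partial>?U)"
    unfolding torus_measure_def
    by (intro unit_product.product_nn_integral_prod G finite_lessThan)
  finally show ?thesis .
qed

lemma nn_integral_torus_triangle_le:
  assumes d: "d \<ge> 1" and z: "\<forall>i<d. z i \<in> {0..<1}"
    and pos: "0 < r" "0 < s" "0 < t" and le: "t \<le> 2 * r" "t \<le> 2 * s"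
    and small: "r + s + t < 1" "r < 1/2" "s < 1/2"
  shows "(\<integral>\<^sup>+x. \<integral>\<^sup>+y. indicator {(x, y). torus_dist d z x \<le> r \<and> torus_dist d z y \<le> s \<and> torus_dist d x y \<le> t} (x, y)
      \<partial>torus_measure d \<partial>torus_measure d) \<le> ennreal ((4 * r * s - (r - t / 2) * (s - t / 2)) ^ d)"
proof -
  have "(r - t / 2) * (s - t / 2) \<le> r * s"
    using pos le by (intro mult_mono) auto
  then have nonneg: "0 \<le> 4 * r * s - (r - t / 2) * (s - t / 2)"
    using pos mult_pos_pos[of r s] by linarith
  have "(\<Prod>i<d. \<integral>\<^sup>+x. \<integral>\<^sup>+y. indicator {(x, y). circle_dist (z i) x \<le> r \<and> circle_dist (z i) y \<le> s \<and> circle_dist x y \<le> t} (x, y)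
      \<partial>uniform_measure lborel {0..<1} \<partial>uniform_measure lborel {0..<1})
      \<le> (\<Prod>i<d. ennreal (4 * r * s - (r - t / 2) * (s - t / 2)))"
    using assms by (intro prod_mono_ennreal nn_integral_circle_triangle_le) auto
  also have "\<dots> = ennreal ((4 * r * s - (r - t / 2) * (s - t / 2)) ^ d)"
    using nonneg by (simp add: ennreal_power)
  finally show ?thesis
    using d by (simp only: nn_integral_torus_triangle)
qed

text \<open>The condition between \<open>x\<close> and \<open>y\<close> is discarded, leaving two
  independent balls. This serves pairs with a heavy vertex, whose saving comes from the weights
  instead.\<close>

lemma nn_integral_torus_star_le:
  assumes d: "d \<ge> 1" and z: "\<forall>i<d. z i \<in> {0..<1}" and pos: "0 \<le> r" "0 \<le> s"
  shows "(\<integral>\<^sup>+x. \<integral>\<^sup>+y. indicator {(x, y). torus_dist d z x \<le> r \<and> torus_dist d z y \<le> s \<and> torus_dist d x y \<le> t} (x, y)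
      \<partial>torus_measure d \<partial>torus_measure d) \<le> ennreal ((2 * r) ^ d * (2 * s) ^ d)"
proof -
  \<comment> \<open>\<open>1\<close> and \<open>3\<close> merely instantiate the \<open>w0\<close>
    and \<beta> of the context in which the fact was proved; any admissible values would do.\<close>
  interpret T: prob_space "torus_measure d" by (rule prob_space_torus_measure[of 1 3]) simp_all
  have meas: "(\<lambda>x. indicator {x. torus_dist d z x \<le> q} x :: ennreal) \<in> borel_measurable (torus_measure d)" for q
  proof -
    have "(\<lambda>x. \<Prod>i<d. indicator {x. circle_dist (z i) x \<le> q} (x i) :: ennreal) \<in> borel_measurable (torus_measure d)"
      by measurable
    also have "(\<lambda>x. \<Prod>i<d. indicator {x. circle_dist (z i) x \<le> q} (x i)) = (\<lambda>x. indicator {x. torus_dist d z x \<le> q} x :: ennreal)"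
      using d by (auto simp: indicator_def torus_dist_le_iff fun_eq_iff)
    finally show ?thesis .
  qed
  have "(\<integral>\<^sup>+x. \<integral>\<^sup>+y. indicator {(x, y). torus_dist d z x \<le> r \<and> torus_dist d z y \<le> s \<and> torus_dist d x y \<le> t} (x, y)
      \<partial>torus_measure d \<partial>torus_measure d)
     \<le> (\<integral>\<^sup>+x. \<integral>\<^sup>+y. indicator {x. torus_dist d z x \<le> r} x * indicator {x. torus_dist d z x \<le> s} y
      \<partial>torus_measure d \<partial>torus_measure d)"
    by (intro nn_integral_mono) (auto simp: indicator_def)
  also have "\<dots> = (\<integral>\<^sup>+x. indicator {x. torus_dist d z x \<le> r} x * (\<integral>\<^sup>+y. indicator {x. torus_dist d z x \<le> s} y
      \<partial>torus_measure d) \<partial>torus_measure d)"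
    by (intro nn_integral_cong nn_integral_cmult meas)
  also have "\<dots> = (\<integral>\<^sup>+x. indicator {x. torus_dist d z x \<le> r} x \<partial>torus_measure d) *
     (\<integral>\<^sup>+y. indicator {x. torus_dist d z x \<le> s} y \<partial>torus_measure d)"
    by (intro nn_integral_multc meas)
  also have "\<dots> \<le> ennreal ((2 * r) ^ d) * ennreal ((2 * s) ^ d)"
    by (intro mult_mono nn_integral_torus_ball_le d z pos zero_le)
  also have "\<dots> = ennreal ((2 * r) ^ d * (2 * s) ^ d)"
    using pos by (intro ennreal_mult[symmetric]) auto
  finally show ?thesis .
qed

section \<open>Neighbours and triangles above a given vertex\<close>

definition vertex_measure :: "real \<Rightarrow> real \<Rightarrow> nat \<Rightarrow> (real \<times> (nat \<Rightarrow> real)) measure" where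
  "vertex_measure w0 \<beta> d = weight_measure w0 \<beta> \<Otimes>\<^sub>M torus_measure d"

definition vertex_adj :: "real \<Rightarrow> nat \<Rightarrow> nat \<Rightarrow> real \<times> (nat \<Rightarrow> real) \<Rightarrow> real \<times> (nat \<Rightarrow> real) \<Rightarrow> bool" where
  "vertex_adj lam n d p q \<longleftrightarrow> torus_dist d (snd p) (snd q) \<le> girg_threshold lam n d (fst p) (fst q)"

text \<open>Ties in weight are included, so a vertex of minimal weight in a clique has all other
  members as heavier neighbours.\<close>

definition heavier_nbr :: "real \<Rightarrow> nat \<Rightarrow> nat \<Rightarrow> real \<times> (nat \<Rightarrow> real) \<Rightarrow> real \<times> (nat \<Rightarrow> real) \<Rightarrow> bool" where
  "heavier_nbr lam n d p q \<longleftrightarrow> fst p \<le> fst q \<and> vertex_adj lam n d p q"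

text \<open>\<open>lam\<close> times the constant in the truncated first moment: weights of at least
  \<open>a\<close> contribute \<open>(\<beta> - 1) / (\<beta> - 2) * w0 powr (\<beta> - 1) * a powr
  (2 - \<beta>)\<close> to the mean.\<close>

definition nbr_const :: "real \<Rightarrow> real \<Rightarrow> real \<Rightarrow> real" where
  "nbr_const lam w0 \<beta> = lam * ((\<beta> - 1) / (\<beta> - 2) * w0 powr (\<beta> - 1))"

lemma girg_threshold_nonneg: "0 \<le> girg_threshold lam n d a b"
  by (simp add: girg_threshold_def)

text \<open>Twice the threshold is the side length of a ball in the maximum norm. Its volume is free
  of \<open>d\<close>, so the bounds on single neighbours are as well.\<close>

lemma girg_threshold_power:
  assumes "d \<ge> 1" "lam > 0" "n > 0" "a > 0" "b > 0"
  shows "(2 * girg_threshold lam n d a b) ^ d = lam * a * b / real n"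
  using assms by (simp add: girg_threshold_def powr_realpow[symmetric] powr_powr)

context
  fixes w0 \<beta> lam :: real and n d :: nat
  assumes w0: "w0 > 0" and \<beta>: "\<beta> > 2" and lam: "lam > 0" and n: "n > 0" and d: "d \<ge> 1"
begin

interpretation W: real_distribution "weight_measure w0 \<beta>"
  by (rule real_distribution_weight_measure[OF w0 \<beta>])

interpretation T: prob_space "torus_measure d"
  by (rule prob_space_torus_measure[OF w0 \<beta>])

interpretation WT: pair_prob_space "weight_measure w0 \<beta>" "torus_measure d" ..

lemma prob_space_vertex_measure: "prob_space (vertex_measure w0 \<beta> d)"
  unfolding vertex_measure_def by (rule WT.prob_space_axioms)

lemma fst_vertex_measurable: "fst \<in> borel_measurable (vertex_measure w0 \<beta> d)"
  unfolding vertex_measure_def by measurable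

lemma snd_vertex_measurable: "snd \<in> vertex_measure w0 \<beta> d \<rightarrow>\<^sub>M torus_measure d"
  unfolding vertex_measure_def by simp

lemma vertex_adj_measurable:
  "Measurable.pred (vertex_measure w0 \<beta> d \<Otimes>\<^sub>M vertex_measure w0 \<beta> d) (\<lambda>(p, q). vertex_adj lam n d p q)"
proof -
  let ?V = "vertex_measure w0 \<beta> d"
  note f = measurable_compose[OF measurable_fst fst_vertex_measurable, of ?V]
    measurable_compose[OF measurable_snd fst_vertex_measurable, of ?V]
    measurable_compose[OF measurable_fst snd_vertex_measurable, of ?V]
    measurable_compose[OF measurable_snd snd_vertex_measurable, of ?V]
  have "(\<lambda>x. torus_dist d (snd (fst x)) (snd (snd x))) \<in> borel_measurable (?V \<Otimes>\<^sub>M ?V)"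
    by (intro torus_dist_measurable f)
  moreover have "(\<lambda>x. girg_threshold lam n d (fst (fst x)) (fst (snd x))) \<in> borel_measurable (?V \<Otimes>\<^sub>M ?V)"
    unfolding girg_threshold_def
    by (intro borel_measurable_times borel_measurable_divide borel_measurable_const powr_real_measurable f)
  ultimately show ?thesis
    unfolding vertex_adj_def pred_def case_prod_unfold by (rule borel_measurable_le)
qed

lemma heavier_nbr_measurable:
  "Measurable.pred (vertex_measure w0 \<beta> d \<Otimes>\<^sub>M vertex_measure w0 \<beta> d) (\<lambda>(p, q). heavier_nbr lam n d p q)"
proof -
  let ?V = "vertex_measure w0 \<beta> d"
  have "Measurable.pred (?V \<Otimes>\<^sub>M ?V) (\<lambda>x. fst (fst x) \<le> fst (snd x))"
    unfolding pred_def
    by (intro borel_measurable_le measurable_compose[OF measurable_fst fst_vertex_measurable]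
        measurable_compose[OF measurable_snd fst_vertex_measurable])
  then show ?thesis
    using vertex_adj_measurable unfolding heavier_nbr_def case_prod_unfold by (rule pred_intros_logic)
qed

lemma nn_integral_vertex_measure:
  assumes "f \<in> borel_measurable (vertex_measure w0 \<beta> d)"
  shows "(\<integral>\<^sup>+p. f p \<partial>vertex_measure w0 \<beta> d) = (\<integral>\<^sup>+b. \<integral>\<^sup>+x. f (b, x) \<partial>torus_measure d \<partial>weight_measure w0 \<beta>)"
  using assms unfolding vertex_measure_def by (simp add: T.nn_integral_fst)

lemma nn_integral_vertex_weight:
  assumes [measurable]: "f \<in> borel_measurable borel"
  shows "(\<integral>\<^sup>+p. f (fst p) \<partial>vertex_measure w0 \<beta> d) = (\<integral>\<^sup>+b. f b \<partial>weight_measure w0 \<beta>)"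
proof -
  have "(\<lambda>p. f (fst p)) \<in> borel_measurable (vertex_measure w0 \<beta> d)"
    using fst_vertex_measurable by measurable
  then show ?thesis
    by (simp add: nn_integral_vertex_measure T.emeasure_space_1)
qed

lemma AE_vertex: "AE p in vertex_measure w0 \<beta> d. w0 \<le> fst p \<and> (\<forall>i<d. snd p i \<in> {0..<1})"
proof -
  have "AE p in distr (vertex_measure w0 \<beta> d) (weight_measure w0 \<beta>) fst. w0 \<le> p"
    unfolding vertex_measure_def T.distr_pair_fst by (rule AE_weight_ge[OF w0 \<beta>])
  then have 1: "AE p in vertex_measure w0 \<beta> d. w0 \<le> fst p"
    unfolding vertex_measure_def by (rule AE_distrD[OF measurable_fst])
  have "Measurable.pred (torus_measure d) (\<lambda>x. \<forall>i\<in>{..<d}. x i \<in> {0..<1})"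
    by (intro pred_intros_finite measurable_compose[OF torus_component_measurable]) auto
  then have "Measurable.pred (weight_measure w0 \<beta> \<Otimes>\<^sub>M torus_measure d) (\<lambda>p. \<forall>i\<in>{..<d}. snd p i \<in> {0..<1})"
    by (rule measurable_compose[OF measurable_snd])
  then have sets: "{p \<in> space (weight_measure w0 \<beta> \<Otimes>\<^sub>M torus_measure d). \<forall>i\<in>{..<d}. snd p i \<in> {0..<1}}
      \<in> sets (weight_measure w0 \<beta> \<Otimes>\<^sub>M torus_measure d)"
    unfolding pred_def .
  have "AE x in torus_measure d. \<forall>i\<in>{..<d}. x i \<in> {0..<1}"
    using AE_torus_unit[of d] by (rule eventually_mono) simp
  then have "AE b in weight_measure w0 \<beta>. AE x in torus_measure d. \<forall>i\<in>{..<d}. snd (b, x) i \<in> {0..<1}"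
    unfolding snd_conv by (rule AE_I2)
  then have 2: "AE p in vertex_measure w0 \<beta> d. \<forall>i\<in>{..<d}. snd p i \<in> {0..<1}"
    unfolding vertex_measure_def by (rule WT.AE_pair_measure[OF sets])
  show ?thesis using 1 2 by eventually_elim auto
qed

text \<open>With \<open>a = fst z\<close>, the ball for a neighbour of weight \<open>b\<close> has
  volume at most \<open>lam * a * b / n\<close>. Integrating over \<open>b \<ge> a\<close> gives
  \<open>a powr (2 - \<beta>)\<close>, and the factor \<open>a\<close> raises the exponent to
  \<open>3 - \<beta>\<close>.\<close>

lemma nbr_integral_le:
  assumes a: "w0 \<le> fst z" and z: "\<forall>i<d. snd z i \<in> {0..<1}" and sp: "z \<in> space (vertex_measure w0 \<beta> d)"
  shows "(\<integral>\<^sup>+p. indicator {p. heavier_nbr lam n d z p} p \<partial>vertex_measure w0 \<beta> d)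
    \<le> ennreal (nbr_const lam w0 \<beta> * fst z powr (3 - \<beta>) / real n)"
proof -
  let ?a = "fst z"
  have apos: "?a > 0" using a w0 by simp
  have [measurable]: "Measurable.pred (vertex_measure w0 \<beta> d) (\<lambda>p. heavier_nbr lam n d z p)"
    using measurable_compose[OF measurable_Pair1'[OF sp] heavier_nbr_measurable] by (simp only: prod.case)
  have "(\<integral>\<^sup>+p. indicator {p. heavier_nbr lam n d z p} p \<partial>vertex_measure w0 \<beta> d) =
      (\<integral>\<^sup>+b. \<integral>\<^sup>+x. indicator {p. heavier_nbr lam n d z p} (b, x) \<partial>torus_measure d \<partial>weight_measure w0 \<beta>)"
    by (rule nn_integral_vertex_measure) measurable
  also have "\<dots> \<le> (\<integral>\<^sup>+b. ennreal (lam * ?a / real n) * (ennreal (b powr 1) * indicator {?a..} b) \<partial>weight_measure w0 \<beta>)"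
  proof (rule nn_integral_mono)
    fix b :: real
    show "(\<integral>\<^sup>+x. indicator {p. heavier_nbr lam n d z p} (b, x) \<partial>torus_measure d)
      \<le> ennreal (lam * ?a / real n) * (ennreal (b powr 1) * indicator {?a..} b)"
    proof (cases "b \<ge> ?a")
      case True
      let ?r = "girg_threshold lam n d ?a b"
      have "(\<integral>\<^sup>+x. indicator {p. heavier_nbr lam n d z p} (b, x) \<partial>torus_measure d)
          = (\<integral>\<^sup>+x. indicator {x. torus_dist d (snd z) x \<le> ?r} x \<partial>torus_measure d)"
        using True by (intro nn_integral_cong) (auto simp: heavier_nbr_def vertex_adj_def indicator_def)
      also have "\<dots> \<le> ennreal ((2 * ?r) ^ d)"
        by (intro nn_integral_torus_ball_le d z girg_threshold_nonneg)
      also have "(2 * ?r) ^ d = (lam * ?a / real n) * b powr 1"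
        using True apos d lam n by (subst girg_threshold_power) auto
      also have "ennreal \<dots> = ennreal (lam * ?a / real n) * ennreal (b powr 1)"
        using apos lam by (intro ennreal_mult) auto
      finally show ?thesis using True by simp
    next
      case False
      then show ?thesis by (simp add: heavier_nbr_def)
    qed
  qed
  also have "\<dots> = ennreal (lam * ?a / real n) * (\<integral>\<^sup>+b\<in>{?a..}. ennreal (b powr 1) \<partial>weight_measure w0 \<beta>)"
    by (intro nn_integral_cmult) measurable
  also have "\<dots> = ennreal (lam * ?a / real n) * ennreal ((\<beta> - 1) / (\<beta> - 1 - 1) * w0 powr (\<beta> - 1) * ?a powr (1 + 1 - \<beta>))"
    using \<beta> a by (subst weight_moment_tail[OF w0 \<beta>]) auto
  also have "\<dots> = ennreal (lam * ?a / real n * ((\<beta> - 1) / (\<beta> - 1 - 1) * w0 powr (\<beta> - 1) * ?a powr (1 + 1 - \<beta>)))"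
    using apos lam \<beta> by (intro ennreal_mult[symmetric]) auto
  also have "lam * ?a / real n * ((\<beta> - 1) / (\<beta> - 1 - 1) * w0 powr (\<beta> - 1) * ?a powr (1 + 1 - \<beta>))
     = nbr_const lam w0 \<beta> * (?a powr 1 * ?a powr (2 - \<beta>)) / real n"
    using apos by (simp add: nbr_const_def mult_ac)
  also have "?a powr 1 * ?a powr (2 - \<beta>) = ?a powr (3 - \<beta>)"
    unfolding powr_add[symmetric] by simp
  finally show ?thesis .
qed

text \<open>The \<open>d\<close>-th roots \<open>\<rho>\<close>, \<open>\<kappa>\<close> of the
  weight ratios lie between \<open>1\<close> and \<open>3/2\<close>, and the thresholds are
  \<open>\<sigma> * \<rho> / 2\<close>, \<open>\<sigma> * \<kappa> / 2\<close>,
  \<open>\<sigma> * \<rho> * \<kappa> / 2\<close>. The corner removed in each coordinate then has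
  sides at least \<open>r / 4\<close> and \<open>s / 4\<close>, which is \<open>1/64\<close> of the
  rectangle of area \<open>4 * r * s\<close>.\<close>

lemma triangle_positions_le:
  assumes z: "\<forall>i<d. z i \<in> {0..<1}" and a: "0 < a" and b: "a \<le> b" "b \<le> (3/2) ^ d * a"
    and c: "a \<le> c" "c \<le> (3/2) ^ d * a" and small: "lam * a * a / real n \<le> (1/3) ^ d"
  shows "(\<integral>\<^sup>+x. \<integral>\<^sup>+y. indicator {(x, y). torus_dist d z x \<le> girg_threshold lam n d a b \<and>
        torus_dist d z y \<le> girg_threshold lam n d a c \<and> torus_dist d x y \<le> girg_threshold lam n d b c} (x, y)
      \<partial>torus_measure d \<partial>torus_measure d) \<le> ennreal ((63/64) ^ d * ((lam * a * b / real n) * (lam * a * c / real n)))"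
proof -
  define \<sigma> where "\<sigma> = (lam * a * a / real n) powr (1 / real d)"
  define \<rho> where "\<rho> = (b / a) powr (1 / real d)"
  define \<kappa> where "\<kappa> = (c / a) powr (1 / real d)"
  define r where "r = girg_threshold lam n d a b"
  define s where "s = girg_threshold lam n d a c"
  define t where "t = girg_threshold lam n d b c"
  have root: "x powr (1 / real d) \<le> y" if "0 \<le> x" "x \<le> y ^ d" "0 < y" for x y :: real
  proof -
    have "x powr (1 / real d) \<le> (y ^ d) powr (1 / real d)"
      using that by (intro powr_mono2) auto
    also have "\<dots> = y"
      using that d by (simp add: powr_realpow[symmetric] powr_powr)
    finally show ?thesis .
  qed
  have \<sigma>: "0 < \<sigma>" "\<sigma> \<le> 1/3"
    using small lam a n by (simp add: \<sigma>_def) (unfold \<sigma>_def, rule root, use small lam a in simp_all)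
  have \<rho>: "1 \<le> \<rho>" "\<rho> \<le> 3/2"
    unfolding \<rho>_def using a b by (intro root ge_one_powr_ge_zero; simp add: field_simps)+
  have \<kappa>: "1 \<le> \<kappa>" "\<kappa> \<le> 3/2"
    unfolding \<kappa>_def using a c by (intro root ge_one_powr_ge_zero; simp add: field_simps)+
  have r: "r = \<sigma> * \<rho> / 2"
    unfolding r_def girg_threshold_def \<sigma>_def \<rho>_def using a b lam n
    by (simp add: powr_mult[symmetric] field_simps)
  have s: "s = \<sigma> * \<kappa> / 2"
    unfolding s_def girg_threshold_def \<sigma>_def \<kappa>_def using a c lam n
    by (simp add: powr_mult[symmetric] field_simps)
  have t: "t = \<sigma> * \<rho> * \<kappa> / 2"
    unfolding t_def girg_threshold_def \<sigma>_def \<rho>_def \<kappa>_def using a b c lam n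
    by (simp add: powr_mult[symmetric] field_simps)
  have \<rho>\<kappa>: "\<rho> * \<kappa> \<le> 3/2 * (3/2)" using \<rho> \<kappa> by (intro mult_mono) auto
  have pos: "0 < r" "0 < s" "0 < t" unfolding r s t using \<sigma> \<rho> \<kappa> by auto
  \<comment> \<open>With \<open>\<sigma> \<le> 1/3\<close> the radii are at most \<open>1/4\<close>,
    \<open>1/4\<close> and \<open>3/8\<close>, so their sum is at most \<open>7/8\<close>. This is
    what the bound \<open>(1/3) ^ d\<close> is chosen for.\<close>
  have "r \<le> (1/3) * (3/2) / 2" unfolding r using \<sigma> \<rho> by (intro divide_right_mono mult_mono) auto
  moreover have "s \<le> (1/3) * (3/2) / 2" unfolding s using \<sigma> \<kappa> by (intro divide_right_mono mult_mono) auto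
  moreover have "t \<le> (1/3) * (3/2 * (3/2)) / 2"
    unfolding t mult.assoc using \<sigma> \<rho> \<kappa> \<rho>\<kappa> by (intro divide_right_mono mult_mono) auto
  ultimately have sm: "r + s + t < 1" "r < 1/2" "s < 1/2" by auto
  \<comment> \<open>The corner has sides \<open>r * (1 - \<kappa> / 2)\<close> and
    \<open>s * (1 - \<rho> / 2)\<close>: any bound below \<open>2\<close> on the ratios would leave
    a fixed proportion, and \<open>3/2\<close> is a convenient choice.\<close>
  have tr: "t / 2 = r * (\<kappa> / 2)" and ts: "t / 2 = s * (\<rho> / 2)"
    using r s t by auto
  have "t / 2 \<le> r" "t / 2 \<le> s"
    unfolding tr using pos \<kappa> by (intro mult_left_le; simp) (unfold tr[symmetric] ts, use pos \<rho> in \<open>intro mult_left_le; simp\<close>)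
  then have tle: "t \<le> 2 * r" "t \<le> 2 * s" by simp_all
  have "r * (1/4) * (s * (1/4)) \<le> (r - t / 2) * (s - t / 2)"
  proof (rule mult_mono)
    have "r * (1/4) \<le> r * (1 - \<kappa> / 2)" using pos \<kappa> by (intro mult_left_mono) auto
    then show "r * (1/4) \<le> r - t / 2" unfolding tr by (simp add: algebra_simps)
    have "s * (1/4) \<le> s * (1 - \<rho> / 2)" using pos \<rho> by (intro mult_left_mono) auto
    then show "s * (1/4) \<le> s - t / 2" unfolding ts by (simp add: algebra_simps)
  qed (use pos tle in auto)
  then have q: "4 * r * s - (r - t / 2) * (s - t / 2) \<le> 63/64 * ((2 * r) * (2 * s))"
    by (simp add: algebra_simps)
  have "(r - t / 2) * (s - t / 2) \<le> r * s"
    using pos tle by (intro mult_mono) auto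
  then have nonneg: "0 \<le> 4 * r * s - (r - t / 2) * (s - t / 2)"
    using pos mult_pos_pos[of r s] by linarith
  have "(\<integral>\<^sup>+x. \<integral>\<^sup>+y. indicator {(x, y). torus_dist d z x \<le> r \<and>
        torus_dist d z y \<le> s \<and> torus_dist d x y \<le> t} (x, y) \<partial>torus_measure d \<partial>torus_measure d)
     \<le> ennreal ((4 * r * s - (r - t / 2) * (s - t / 2)) ^ d)"
    by (intro nn_integral_torus_triangle_le d z pos tle sm)
  also have "\<dots> \<le> ennreal ((63/64 * ((2 * r) * (2 * s))) ^ d)"
    by (intro ennreal_leI power_mono q nonneg)
  also have "(63/64 * ((2 * r) * (2 * s))) ^ d = (63/64) ^ d * ((2 * r) ^ d * (2 * s) ^ d)"
    by (simp only: power_mult_distrib)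
  also have "(2 * r) ^ d = lam * a * b / real n"
    unfolding r_def using d lam n a b by (intro girg_threshold_power) auto
  also have "(2 * s) ^ d = lam * a * c / real n"
    unfolding s_def using d lam n a c by (intro girg_threshold_power) auto
  finally show ?thesis unfolding r_def s_def t_def .
qed

text \<open>One summand for each source of the saving: both weights light, \<open>b\<close> heavy,
  or \<open>c\<close> heavy. Each is a function of \<open>b\<close> times a function of
  \<open>c\<close>, so it can be integrated over independent weights.\<close>

lemma triangle_weights_le:
  assumes z: "\<forall>i<d. z i \<in> {0..<1}" and a: "0 < a" and b: "a \<le> b" and c: "a \<le> c"
    and small: "lam * a * a / real n \<le> (1/3) ^ d"
  shows "(\<integral>\<^sup>+x. \<integral>\<^sup>+y. indicator {(x, y). torus_dist d z x \<le> girg_threshold lam n d a b \<and>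
        torus_dist d z y \<le> girg_threshold lam n d a c \<and> torus_dist d x y \<le> girg_threshold lam n d b c} (x, y)
      \<partial>torus_measure d \<partial>torus_measure d) \<le>
      ennreal ((lam * a / real n)\<^sup>2) * (ennreal ((63/64) ^ d) * (ennreal b * ennreal c)
      + ennreal b * indicator {(3/2) ^ d * a..} b * ennreal c + ennreal b * (ennreal c * indicator {(3/2) ^ d * a..} c))"
    (is "?L \<le> ?K * (?q * (?b * ?c) + ?b * ?B * ?c + ?b * (?c * ?C))")
proof (cases "b \<le> (3/2) ^ d * a \<and> c \<le> (3/2) ^ d * a")
  case True
  then have "?L \<le> ennreal ((63/64) ^ d * ((lam * a * b / real n) * (lam * a * c / real n)))"
    using assms by (intro triangle_positions_le) auto
  also have "(63/64) ^ d * ((lam * a * b / real n) * (lam * a * c / real n))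
      = (lam * a / real n)\<^sup>2 * ((63/64) ^ d * (b * c))"
    by (simp add: power2_eq_square)
  also have "ennreal \<dots> = ?K * (?q * (?b * ?c))"
    using a b c by (simp add: ennreal_mult)
  also have "\<dots> \<le> ?K * (?q * (?b * ?c) + ?b * ?B * ?c + ?b * (?c * ?C))"
    by (intro mult_left_mono) (auto simp: add.assoc)
  finally show ?thesis .
next
  case False
  have "?L \<le> ennreal ((2 * girg_threshold lam n d a b) ^ d * (2 * girg_threshold lam n d a c) ^ d)"
    by (intro nn_integral_torus_star_le d z girg_threshold_nonneg)
  also have "(2 * girg_threshold lam n d a b) ^ d * (2 * girg_threshold lam n d a c) ^ d
      = (lam * a * b / real n) * (lam * a * c / real n)"
    using a b c d lam n by (simp only: girg_threshold_power)
  also have "\<dots> = (lam * a / real n)\<^sup>2 * (b * c)"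
    by (simp add: power2_eq_square)
  also have "ennreal \<dots> = ?K * (?b * ?c)"
    using a b c by (simp add: ennreal_mult)
  also have "\<dots> \<le> ?K * (?q * (?b * ?c) + ?b * ?B * ?c + ?b * (?c * ?C))"
  proof (intro mult_left_mono)
    have "?b * ?c \<le> ?b * ?B * ?c + ?b * (?c * ?C)"
      using False by (auto simp: indicator_def)
    also have "\<dots> \<le> ?q * (?b * ?c) + (?b * ?B * ?c + ?b * (?c * ?C))"
      by simp
    finally show "?b * ?c \<le> ?q * (?b * ?c) + ?b * ?B * ?c + ?b * (?c * ?C)"
      by (simp add: add.assoc)
  qed simp
  finally show ?thesis .
qed

text \<open>Fubini moves both weights outside both positions, so that all three radii are fixed
  while the positions are integrated.\<close>

lemma nn_integral_vertex_pair:
  assumes f: "(\<lambda>(p, q). f p q) \<in> borel_measurable (vertex_measure w0 \<beta> d \<Otimes>\<^sub>M vertex_measure w0 \<beta> d)"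
  shows "(\<integral>\<^sup>+p. \<integral>\<^sup>+q. f p q \<partial>vertex_measure w0 \<beta> d \<partial>vertex_measure w0 \<beta> d) =
    (\<integral>\<^sup>+b. \<integral>\<^sup>+c. \<integral>\<^sup>+x. \<integral>\<^sup>+y. f (b, x) (c, y) \<partial>torus_measure d \<partial>torus_measure d
      \<partial>weight_measure w0 \<beta> \<partial>weight_measure w0 \<beta>)"
proof -
  let ?V = "vertex_measure w0 \<beta> d" and ?T = "torus_measure d" and ?W = "weight_measure w0 \<beta>"
  interpret V: prob_space ?V by (rule prob_space_vertex_measure)
  interpret TW: pair_sigma_finite ?T ?W ..
  have fp: "f p \<in> borel_measurable ?V" if "p \<in> space ?V" for p
    using measurable_compose[OF measurable_Pair1'[OF that] f] by (simp only: prod.case)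
  have "(\<lambda>p. \<integral>\<^sup>+q. f p q \<partial>?V) \<in> borel_measurable ?V"
    by (rule sigma_finite_measure.borel_measurable_nn_integral[OF prob_space_imp_sigma_finite f])
       (rule prob_space_vertex_measure)
  then have "(\<integral>\<^sup>+p. \<integral>\<^sup>+q. f p q \<partial>?V \<partial>?V) = (\<integral>\<^sup>+b. \<integral>\<^sup>+x. \<integral>\<^sup>+q. f (b, x) q \<partial>?V \<partial>?T \<partial>?W)"
    by (rule nn_integral_vertex_measure)
  also have "\<dots> = (\<integral>\<^sup>+b. \<integral>\<^sup>+x. \<integral>\<^sup>+c. \<integral>\<^sup>+y. f (b, x) (c, y) \<partial>?T \<partial>?W \<partial>?T \<partial>?W)"
    by (intro nn_integral_cong nn_integral_vertex_measure fp)
       (auto simp: vertex_measure_def space_pair_measure)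
  also have "\<dots> = (\<integral>\<^sup>+b. \<integral>\<^sup>+c. \<integral>\<^sup>+x. \<integral>\<^sup>+y. f (b, x) (c, y) \<partial>?T \<partial>?T \<partial>?W \<partial>?W)"
  proof (intro nn_integral_cong TW.Fubini'[symmetric])
    fix b assume b: "b \<in> space ?W"
    let ?h = "\<lambda>u :: ((nat \<Rightarrow> real) \<times> real) \<times> (nat \<Rightarrow> real). ((b, fst (fst u)), (snd (fst u), snd u))"
    have "?h \<in> (?T \<Otimes>\<^sub>M ?W) \<Otimes>\<^sub>M ?T \<rightarrow>\<^sub>M ?V \<Otimes>\<^sub>M ?V"
      unfolding vertex_measure_def
      by (intro measurable_Pair measurable_const b measurable_snd
          measurable_compose[OF measurable_fst measurable_fst]
          measurable_compose[OF measurable_fst measurable_snd])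
    from measurable_compose[OF this f]
    have "(\<lambda>(v, y). f (b, fst v) (snd v, y)) \<in> borel_measurable ((?T \<Otimes>\<^sub>M ?W) \<Otimes>\<^sub>M ?T)"
      by (simp only: prod.case case_prod_unfold fst_conv snd_conv)
    from sigma_finite_measure.borel_measurable_nn_integral[OF prob_space_imp_sigma_finite[OF prob_space_torus_measure[OF w0 \<beta>]] this]
    show "(\<lambda>(x, c). \<integral>\<^sup>+y. f (b, x) (c, y) \<partial>?T) \<in> borel_measurable (?T \<Otimes>\<^sub>M ?W)"
      by (simp only: case_prod_unfold)
  qed
  finally show ?thesis .
qed

text \<open>The two heavy summands each contain the first moment above
  \<open>(3/2) ^ d * fst z\<close>, which is \<open>((3/2) powr (2 - \<beta>)) ^ d\<close> times the
  one above \<open>fst z\<close>; hence the factor \<open>2\<close>.\<close>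

lemma triangle_integral_le:
  assumes a: "w0 \<le> fst z" and z: "\<forall>i<d. snd z i \<in> {0..<1}" and sp: "z \<in> space (vertex_measure w0 \<beta> d)"
    and small: "lam * fst z * fst z / real n \<le> (1/3) ^ d"
  shows "(\<integral>\<^sup>+p. \<integral>\<^sup>+q. indicator {(p, q). heavier_nbr lam n d z p \<and> heavier_nbr lam n d z q \<and> vertex_adj lam n d p q} (p, q)
      \<partial>vertex_measure w0 \<beta> d \<partial>vertex_measure w0 \<beta> d)
    \<le> ennreal ((nbr_const lam w0 \<beta> * fst z powr (3 - \<beta>) / real n)\<^sup>2 * ((63/64) ^ d + 2 * ((3/2) powr (2 - \<beta>)) ^ d))"
proof -
  let ?V = "vertex_measure w0 \<beta> d" and ?T = "torus_measure d" and ?W = "weight_measure w0 \<beta>"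
  let ?f = "\<lambda>p q. indicator {(p, q). heavier_nbr lam n d z p \<and> heavier_nbr lam n d z q \<and> vertex_adj lam n d p q} (p, q) :: ennreal"
  define A where "A = fst z"
  define D where "D = (3/2 :: real) ^ d"
  define I where "I = (\<beta> - 1) / (\<beta> - 2) * w0 powr (\<beta> - 1) * A powr (2 - \<beta>)"
  define K where "K = ennreal ((lam * A / real n)\<^sup>2)"
  define Q where "Q = ennreal ((63/64) ^ d)"
  define m where "m b = ennreal b * indicator {A..} b" for b
  define h where "h b = ennreal b * indicator {D * A..} b" for b
  have [measurable]: "m \<in> borel_measurable borel" "h \<in> borel_measurable borel"
    unfolding m_def h_def by measurable
  have Apos: "A > 0" "w0 \<le> A" using a w0 by (auto simp: A_def)
  have D1: "D \<ge> 1" by (simp add: D_def)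
  have "A \<le> D * A" using D1 Apos by simp
  then have DA: "A \<le> D * A" "w0 \<le> D * A" using Apos by linarith+
  have I0: "I \<ge> 0" using \<beta> by (simp add: I_def)
  have tail: "(\<integral>\<^sup>+b. ennreal b * indicator {B..} b \<partial>?W) =
      ennreal ((\<beta> - 1) / (\<beta> - 2) * w0 powr (\<beta> - 1) * B powr (2 - \<beta>))" if "B \<ge> w0" for B
  proof -
    have "(\<integral>\<^sup>+b. ennreal b * indicator {B..} b \<partial>?W) = (\<integral>\<^sup>+b\<in>{B..}. ennreal (b powr 1) \<partial>?W)"
      using that w0 by (intro nn_integral_cong) (auto simp: indicator_def)
    also have "\<dots> = ennreal ((\<beta> - 1) / (\<beta> - 1 - 1) * w0 powr (\<beta> - 1) * B powr (1 + 1 - \<beta>))"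
      using that \<beta> by (intro weight_moment_tail[OF w0 \<beta>]) auto
    finally show ?thesis by simp
  qed
  have m_int: "(\<integral>\<^sup>+b. m b \<partial>?W) = ennreal I"
    unfolding m_def I_def using Apos by (intro tail)
  have "(D * A) powr (2 - \<beta>) = D powr (2 - \<beta>) * A powr (2 - \<beta>)"
    using D1 Apos by (intro powr_mult)
  also have "D powr (2 - \<beta>) = ((3/2) powr (2 - \<beta>)) ^ d"
    by (simp add: D_def powr_realpow[symmetric] powr_powr mult.commute)
  finally have h_int: "(\<integral>\<^sup>+b. h b \<partial>?W) = ennreal (I * ((3/2) powr (2 - \<beta>)) ^ d)"
    unfolding h_def I_def using DA by (subst tail) (auto simp only: mult_ac)
  have hz: "Measurable.pred ?V (\<lambda>p. heavier_nbr lam n d z p)"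
    using measurable_compose[OF measurable_Pair1'[OF sp] heavier_nbr_measurable] by (simp only: prod.case)
  have "Measurable.pred (?V \<Otimes>\<^sub>M ?V) (\<lambda>x. heavier_nbr lam n d z (fst x) \<and> heavier_nbr lam n d z (snd x) \<and> vertex_adj lam n d (fst x) (snd x))"
    using vertex_adj_measurable unfolding case_prod_unfold
    by (intro pred_intros_logic measurable_compose[OF measurable_fst hz] measurable_compose[OF measurable_snd hz])
  then have f: "(\<lambda>(p, q). ?f p q) \<in> borel_measurable (?V \<Otimes>\<^sub>M ?V)"
    unfolding case_prod_unfold prod.collapse
    by (intro borel_measurable_indicator') (simp only: pred_def mem_Collect_eq)
  have "(\<integral>\<^sup>+p. \<integral>\<^sup>+q. ?f p q \<partial>?V \<partial>?V) = (\<integral>\<^sup>+b. \<integral>\<^sup>+c. \<integral>\<^sup>+x. \<integral>\<^sup>+y. ?f (b, x) (c, y) \<partial>?T \<partial>?T \<partial>?W \<partial>?W)"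
    by (rule nn_integral_vertex_pair[OF f])
  also have "\<dots> \<le> (\<integral>\<^sup>+b. \<integral>\<^sup>+c. K * (Q * (m b * m c) + h b * m c + m b * h c) \<partial>?W \<partial>?W)"
  proof (intro nn_integral_mono)
    fix b c :: real
    show "(\<integral>\<^sup>+x. \<integral>\<^sup>+y. ?f (b, x) (c, y) \<partial>?T \<partial>?T) \<le> K * (Q * (m b * m c) + h b * m c + m b * h c)"
    proof (cases "A \<le> b \<and> A \<le> c")
      case False
      then have "(\<integral>\<^sup>+x. \<integral>\<^sup>+y. ?f (b, x) (c, y) \<partial>?T \<partial>?T) = (\<integral>\<^sup>+x. \<integral>\<^sup>+y. 0 \<partial>?T \<partial>?T)"
        by (intro nn_integral_cong) (auto simp: indicator_def heavier_nbr_def A_def)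
      then show ?thesis by simp
    next
      case True
      then have "(\<integral>\<^sup>+x. \<integral>\<^sup>+y. ?f (b, x) (c, y) \<partial>?T \<partial>?T) =
        (\<integral>\<^sup>+x. \<integral>\<^sup>+y. indicator {(x, y). torus_dist d (snd z) x \<le> girg_threshold lam n d A b \<and>
        torus_dist d (snd z) y \<le> girg_threshold lam n d A c \<and> torus_dist d x y \<le> girg_threshold lam n d b c} (x, y) \<partial>?T \<partial>?T)"
        by (intro nn_integral_cong) (auto simp: indicator_def heavier_nbr_def vertex_adj_def A_def)
      also have "\<dots> \<le> ennreal ((lam * A / real n)\<^sup>2) * (ennreal ((63/64) ^ d) * (ennreal b * ennreal c)
        + ennreal b * indicator {(3/2) ^ d * A..} b * ennreal c + ennreal b * (ennreal c * indicator {(3/2) ^ d * A..} c))"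
        using True Apos z small unfolding A_def by (intro triangle_weights_le) auto
      finally show ?thesis
        using True by (simp add: K_def Q_def m_def h_def D_def)
    qed
  qed
  also have "\<dots> = (\<integral>\<^sup>+b. K * (Q * (m b * ennreal I) + h b * ennreal I + m b * ennreal (I * ((3/2) powr (2 - \<beta>)) ^ d)) \<partial>?W)"
    by (simp add: nn_integral_add nn_integral_cmult m_int h_int)
  also have "\<dots> = K * (Q * (ennreal I * ennreal I) + ennreal (I * ((3/2) powr (2 - \<beta>)) ^ d) * ennreal I
      + ennreal I * ennreal (I * ((3/2) powr (2 - \<beta>)) ^ d))"
    by (simp add: nn_integral_add nn_integral_cmult nn_integral_multc m_int h_int)
  also have "\<dots> = ennreal ((lam * A / real n)\<^sup>2 * ((63/64) ^ d * (I * I) + I * ((3/2) powr (2 - \<beta>)) ^ d * I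
      + I * (I * ((3/2) powr (2 - \<beta>)) ^ d)))"
    using I0 by (simp add: K_def Q_def ennreal_mult[symmetric] ennreal_plus[symmetric] del: ennreal_plus)
  also have "(lam * A / real n)\<^sup>2 * ((63/64) ^ d * (I * I) + I * ((3/2) powr (2 - \<beta>)) ^ d * I
      + I * (I * ((3/2) powr (2 - \<beta>)) ^ d)) = (lam * (A * I) / real n)\<^sup>2 * ((63/64) ^ d + 2 * ((3/2) powr (2 - \<beta>)) ^ d)"
    by (simp add: power2_eq_square field_simps)
  also have "lam * (A * I) = nbr_const lam w0 \<beta> * (A powr 1 * A powr (2 - \<beta>))"
    using Apos by (simp add: I_def nbr_const_def)
  also have "A powr 1 * A powr (2 - \<beta>) = A powr (3 - \<beta>)"
    unfolding powr_add[symmetric] by simp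
  finally show ?thesis unfolding A_def .
qed

end

section \<open>Cliques in independent samples\<close>

lemma pred_PiM_clique:
  fixes M :: "'a measure" and I J :: "'i set"
  assumes Q: "Measurable.pred (M \<Otimes>\<^sub>M M) (\<lambda>(x, y). Q x y)" and "finite J" "J \<subseteq> I"
  shows "Measurable.pred (Pi\<^sub>M I (\<lambda>_. M)) (\<lambda>\<omega>. \<forall>i\<in>J. \<forall>j\<in>J. i \<noteq> j \<longrightarrow> Q (\<omega> i) (\<omega> j))"
proof -
  have "Measurable.pred (Pi\<^sub>M I (\<lambda>_. M)) (\<lambda>\<omega>. Q (\<omega> i) (\<omega> j))" if "i \<in> J" "j \<in> J" for i j
  proof -
    have "(\<lambda>\<omega>. (\<omega> i, \<omega> j)) \<in> Pi\<^sub>M I (\<lambda>_. M) \<rightarrow>\<^sub>M M \<Otimes>\<^sub>M M"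
      using that assms by (intro measurable_Pair measurable_component_singleton) auto
    from measurable_compose[OF this Q] show ?thesis by (simp only: prod.case)
  qed
  then show ?thesis
    using assms(2) by (intro pred_intros_finite pred_intros_logic measurable_const) auto
qed

lemma pred_PiM_all:
  assumes g: "Measurable.pred M g" and "finite J" "J \<subseteq> I"
  shows "Measurable.pred (Pi\<^sub>M I (\<lambda>_. M)) (\<lambda>\<omega>. \<forall>j\<in>J. g (\<omega> j))"
  using assms by (intro pred_intros_finite measurable_compose[OF _ g] measurable_component_singleton) auto

lemma borel_measurable_of_pred:
  assumes "Measurable.pred M P"
  shows "(\<lambda>x. indicator {x. P x} x :: ennreal) \<in> borel_measurable M"
  using assms by (intro borel_measurable_indicator') (simp only: pred_def mem_Collect_eq)

context prob_space
begin

text \<open>The points of \<open>J\<close> are used up two at a time, so every pair contributes a full triangle with the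
  base point (which enters through \<open>g\<close>).\<close>

lemma nn_integral_clique_le:
  fixes J :: "'i set"
  assumes g: "Measurable.pred M g" and Q: "Measurable.pred (M \<Otimes>\<^sub>M M) (\<lambda>(x, y). Q x y)"
    and "finite J" "card J = 2 * p + r"
  shows "(\<integral>\<^sup>+\<omega>. indicator {\<omega>. (\<forall>j\<in>J. g (\<omega> j)) \<and> (\<forall>i\<in>J. \<forall>j\<in>J. i \<noteq> j \<longrightarrow> Q (\<omega> i) (\<omega> j))} \<omega> \<partial>Pi\<^sub>M J (\<lambda>_. M))
    \<le> (\<integral>\<^sup>+x. \<integral>\<^sup>+y. indicator {(x, y). g x \<and> g y \<and> Q x y} (x, y) \<partial>M \<partial>M) ^ p * (\<integral>\<^sup>+x. indicator {x. g x} x \<partial>M) ^ r"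
  using assms(3,4)
proof (induction p arbitrary: J)
  case 0
  interpret P: product_sigma_finite "\<lambda>_::'i. M"
    by (intro product_sigma_finite.intro prob_space_imp_sigma_finite prob_space_axioms)
  have "(\<integral>\<^sup>+\<omega>. indicator {\<omega>. (\<forall>j\<in>J. g (\<omega> j)) \<and> (\<forall>i\<in>J. \<forall>j\<in>J. i \<noteq> j \<longrightarrow> Q (\<omega> i) (\<omega> j))} \<omega> \<partial>Pi\<^sub>M J (\<lambda>_. M))
      \<le> (\<integral>\<^sup>+\<omega>. (\<Prod>j\<in>J. indicator {x. g x} (\<omega> j)) \<partial>Pi\<^sub>M J (\<lambda>_. M))"
    using 0 by (intro nn_integral_mono) (auto simp: indicator_def)
  also have "\<dots> = (\<Prod>j\<in>J. \<integral>\<^sup>+x. indicator {x. g x} x \<partial>M)"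
    using 0 by (intro P.product_nn_integral_prod borel_measurable_of_pred g)
  finally show ?case using 0 by simp
next
  case (Suc p)
  interpret P: product_sigma_finite "\<lambda>_::'i. M"
    by (intro product_sigma_finite.intro prob_space_imp_sigma_finite prob_space_axioms)
  let ?F = "\<lambda>J :: 'i set. \<lambda>\<omega>. indicator {\<omega>. (\<forall>j\<in>J. g (\<omega> j)) \<and> (\<forall>i\<in>J. \<forall>j\<in>J. i \<noteq> j \<longrightarrow> Q (\<omega> i) (\<omega> j))} \<omega> :: ennreal"
  let ?t = "\<lambda>x y. indicator {(x, y). g x \<and> g y \<and> Q x y} (x, y) :: ennreal"
  have "card J = Suc (Suc (2 * p + r))" using Suc.prems by simp
  then obtain i j J' where J: "J = insert i (insert j J')" "i \<notin> insert j J'" "j \<notin> J'" "card J' = 2 * p + r"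
    by (metis card_Suc_eq)
  then have iJ: "i \<notin> J'" "j \<noteq> i" by auto
  have fin: "finite J'" using J Suc.prems by simp
  have t: "(\<lambda>x. ?t (fst x) (snd x)) \<in> borel_measurable (M \<Otimes>\<^sub>M M)"
  proof -
    have "Measurable.pred (M \<Otimes>\<^sub>M M) (\<lambda>x. g (fst x) \<and> g (snd x) \<and> Q (fst x) (snd x))"
      using Q unfolding case_prod_unfold
      by (intro pred_intros_logic measurable_compose[OF measurable_fst g] measurable_compose[OF measurable_snd g])
    from borel_measurable_of_pred[OF this] show ?thesis
      by (simp add: indicator_def case_prod_unfold)
  qed
  have F: "?F J' \<in> borel_measurable (Pi\<^sub>M I (\<lambda>_. M))" if "J' \<subseteq> I" for I
    using that fin by (intro borel_measurable_of_pred pred_intros_logic pred_PiM_all pred_PiM_clique g Q)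
  have Fupd: "?F J' (\<omega> (l := x)) = ?F J' \<omega>" if "l \<notin> J'" for l \<omega> x
    using that by (auto simp: indicator_def)
  \<comment> \<open>All conditions linking the pair \<open>i\<close>, \<open>j\<close> to the
    remaining points are discarded; what is left factorises.\<close>
  have "(\<integral>\<^sup>+\<omega>. ?F J \<omega> \<partial>Pi\<^sub>M J (\<lambda>_. M)) \<le> (\<integral>\<^sup>+\<omega>. ?t (\<omega> i) (\<omega> j) * ?F J' \<omega> \<partial>Pi\<^sub>M J (\<lambda>_. M))"
    using J by (intro nn_integral_mono) (auto simp: indicator_def)
  also have "\<dots> = (\<integral>\<^sup>+x. \<integral>\<^sup>+\<omega>. ?t x (\<omega> j) * ?F J' \<omega> \<partial>Pi\<^sub>M (insert j J') (\<lambda>_. M) \<partial>M)"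
    unfolding J(1)
  proof (subst P.product_nn_integral_insert_rev)
    have "(\<lambda>\<omega>. (\<omega> i, \<omega> j)) \<in> Pi\<^sub>M (insert i (insert j J')) (\<lambda>_. M) \<rightarrow>\<^sub>M M \<Otimes>\<^sub>M M"
      by (intro measurable_Pair measurable_component_singleton) auto
    from measurable_compose[OF this t]
    show "(\<lambda>\<omega>. ?t (\<omega> i) (\<omega> j) * ?F J' \<omega>) \<in> borel_measurable (Pi\<^sub>M (insert i (insert j J')) (\<lambda>_. M))"
      by (intro borel_measurable_times_ennreal F) (simp only: fst_conv snd_conv, blast)
    show "(\<integral>\<^sup>+x. \<integral>\<^sup>+\<omega>. ?t ((\<omega> (i := x)) i) ((\<omega> (i := x)) j) * ?F J' (\<omega> (i := x)) \<partial>Pi\<^sub>M (insert j J') (\<lambda>_. M) \<partial>M)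
        = (\<integral>\<^sup>+x. \<integral>\<^sup>+\<omega>. ?t x (\<omega> j) * ?F J' \<omega> \<partial>Pi\<^sub>M (insert j J') (\<lambda>_. M) \<partial>M)"
      by (simp only: Fupd[OF iJ(1)] fun_upd_same fun_upd_other[OF iJ(2)])
  qed (use J fin in auto)
  also have "\<dots> = (\<integral>\<^sup>+x. \<integral>\<^sup>+y. \<integral>\<^sup>+\<omega>. ?t x y * ?F J' \<omega> \<partial>Pi\<^sub>M J' (\<lambda>_. M) \<partial>M \<partial>M)"
  proof (rule nn_integral_cong)
    fix x assume x: "x \<in> space M"
    show "(\<integral>\<^sup>+\<omega>. ?t x (\<omega> j) * ?F J' \<omega> \<partial>Pi\<^sub>M (insert j J') (\<lambda>_. M)) = (\<integral>\<^sup>+y. \<integral>\<^sup>+\<omega>. ?t x y * ?F J' \<omega> \<partial>Pi\<^sub>M J' (\<lambda>_. M) \<partial>M)"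
    proof (subst P.product_nn_integral_insert_rev)
      have "(\<lambda>\<omega>. (x, \<omega> j)) \<in> Pi\<^sub>M (insert j J') (\<lambda>_. M) \<rightarrow>\<^sub>M M \<Otimes>\<^sub>M M"
        using x by (intro measurable_Pair measurable_component_singleton measurable_const) auto
      from measurable_compose[OF this t]
      show "(\<lambda>\<omega>. ?t x (\<omega> j) * ?F J' \<omega>) \<in> borel_measurable (Pi\<^sub>M (insert j J') (\<lambda>_. M))"
        by (intro borel_measurable_times_ennreal F) (simp only: fst_conv snd_conv, blast)
      show "(\<integral>\<^sup>+y. \<integral>\<^sup>+\<omega>. ?t x ((\<omega> (j := y)) j) * ?F J' (\<omega> (j := y)) \<partial>Pi\<^sub>M J' (\<lambda>_. M) \<partial>M)
          = (\<integral>\<^sup>+y. \<integral>\<^sup>+\<omega>. ?t x y * ?F J' \<omega> \<partial>Pi\<^sub>M J' (\<lambda>_. M) \<partial>M)"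
        by (simp only: Fupd[OF J(3)] fun_upd_same)
    qed (use J fin in auto)
  qed
  also have "\<dots> = (\<integral>\<^sup>+x. \<integral>\<^sup>+y. ?t x y * (\<integral>\<^sup>+\<omega>. ?F J' \<omega> \<partial>Pi\<^sub>M J' (\<lambda>_. M)) \<partial>M \<partial>M)"
    by (intro nn_integral_cong nn_integral_cmult F) simp
  also have "\<dots> = (\<integral>\<^sup>+x. (\<integral>\<^sup>+y. ?t x y \<partial>M) * (\<integral>\<^sup>+\<omega>. ?F J' \<omega> \<partial>Pi\<^sub>M J' (\<lambda>_. M)) \<partial>M)"
    using measurable_compose[OF measurable_Pair1' t]
    by (intro nn_integral_cong nn_integral_multc) (simp only: fst_conv snd_conv)
  also have "\<dots> = (\<integral>\<^sup>+x. \<integral>\<^sup>+y. ?t x y \<partial>M \<partial>M) * (\<integral>\<^sup>+\<omega>. ?F J' \<omega> \<partial>Pi\<^sub>M J' (\<lambda>_. M))"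
    using t by (intro nn_integral_multc borel_measurable_nn_integral) (simp only: case_prod_unfold)
  also have "\<dots> \<le> (\<integral>\<^sup>+x. \<integral>\<^sup>+y. ?t x y \<partial>M \<partial>M) * ((\<integral>\<^sup>+x. \<integral>\<^sup>+y. ?t x y \<partial>M \<partial>M) ^ p * (\<integral>\<^sup>+x. indicator {x. g x} x \<partial>M) ^ r)"
    by (intro mult_left_mono Suc.IH fin J) simp
  finally show ?case by (simp only: power_Suc mult.assoc)
qed

text \<open>Either all values of \<open>w\<close> are at least \<open>A\<close>, a product event, or
  a point of minimal value lies below \<open>A\<close> and is related by \<open>R\<close> to all
  others. The factor \<open>card S\<close> is the union bound over which point is minimal.\<close>

lemma nn_integral_clique_by_minimum_le:
  fixes S :: "'i set" and w :: "'a \<Rightarrow> real"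
  assumes w: "w \<in> borel_measurable M" and Q: "Measurable.pred (M \<Otimes>\<^sub>M M) (\<lambda>(x, y). Q x y)"
    and R: "Measurable.pred (M \<Otimes>\<^sub>M M) (\<lambda>(x, y). R x y)"
    and RQ: "\<And>x y. Q x y \<Longrightarrow> w x \<le> w y \<Longrightarrow> R x y"
    and S: "finite S" "card S = Suc (2 * p + r)"
  shows "(\<integral>\<^sup>+\<omega>. indicator {\<omega>. \<forall>i\<in>S. \<forall>j\<in>S. i \<noteq> j \<longrightarrow> Q (\<omega> i) (\<omega> j)} \<omega> \<partial>Pi\<^sub>M S (\<lambda>_. M))
    \<le> emeasure M {x \<in> space M. A \<le> w x} ^ card S +
      of_nat (card S) * (\<integral>\<^sup>+z. indicator {z. w z \<le> A} z *
        ((\<integral>\<^sup>+x. \<integral>\<^sup>+y. indicator {(x, y). R z x \<and> R z y \<and> Q x y} (x, y) \<partial>M \<partial>M) ^ p *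
         (\<integral>\<^sup>+x. indicator {x. R z x} x \<partial>M) ^ r) \<partial>M)"
proof -
  interpret P: product_sigma_finite "\<lambda>_::'i. M"
    by (intro product_sigma_finite.intro prob_space_imp_sigma_finite prob_space_axioms)
  let ?B = "\<lambda>z. (\<integral>\<^sup>+x. \<integral>\<^sup>+y. indicator {(x, y). R z x \<and> R z y \<and> Q x y} (x, y) \<partial>M \<partial>M) ^ p *
         (\<integral>\<^sup>+x. indicator {x. R z x} x \<partial>M) ^ r"
  let ?C = "\<lambda>J :: 'i set. \<lambda>z \<omega>. indicator {\<omega>. (\<forall>j\<in>J. R z (\<omega> j)) \<and> (\<forall>i\<in>J. \<forall>j\<in>J. i \<noteq> j \<longrightarrow> Q (\<omega> i) (\<omega> j))} \<omega> :: ennreal"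
  have lw: "Measurable.pred M (\<lambda>z. w z \<le> A)" "Measurable.pred M (\<lambda>z. A \<le> w z)"
    using w unfolding pred_def by (intro borel_measurable_le borel_measurable_const; simp)+
  have meas: "(\<lambda>\<omega>. indicator {z. w z \<le> A} (\<omega> v) * ?C (S - {v}) (\<omega> v) \<omega>) \<in> borel_measurable (Pi\<^sub>M S (\<lambda>_. M))"
    if v: "v \<in> S" for v
  proof -
    define J where "J = S - {v}"
    have J: "S = insert v J" "v \<notin> J" "finite J" "card J = 2 * p + r"
      using v S by (auto simp: J_def card_Diff_singleton)
    have "Measurable.pred (Pi\<^sub>M S (\<lambda>_. M)) (\<lambda>\<omega>. R (\<omega> v) (\<omega> j))" if "j \<in> J" for j
    proof -
      have "(\<lambda>\<omega>. (\<omega> v, \<omega> j)) \<in> Pi\<^sub>M S (\<lambda>_. M) \<rightarrow>\<^sub>M M \<Otimes>\<^sub>M M"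
        using that J by (intro measurable_Pair measurable_component_singleton) auto
      from measurable_compose[OF this R] show ?thesis by (simp only: prod.case)
    qed
    then have "Measurable.pred (Pi\<^sub>M S (\<lambda>_. M)) (\<lambda>\<omega>. (\<forall>j\<in>J. R (\<omega> v) (\<omega> j)) \<and> (\<forall>i\<in>J. \<forall>j\<in>J. i \<noteq> j \<longrightarrow> Q (\<omega> i) (\<omega> j)))"
      using J by (intro pred_intros_logic pred_intros_finite[where I = J] pred_PiM_clique Q) auto
    from borel_measurable_of_pred[OF this] have "(\<lambda>\<omega>. ?C J (\<omega> v) \<omega>) \<in> borel_measurable (Pi\<^sub>M S (\<lambda>_. M))"
      by (simp add: indicator_def)
    moreover have "(\<lambda>\<omega>. indicator {z. w z \<le> A} (\<omega> v) :: ennreal) \<in> borel_measurable (Pi\<^sub>M S (\<lambda>_. M))"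
      using v by (intro measurable_compose[OF _ borel_measurable_of_pred[OF lw(1)]] measurable_component_singleton)
    ultimately show ?thesis
      unfolding J_def[symmetric] by (intro borel_measurable_times_ennreal)
  qed
  have step: "(\<integral>\<^sup>+\<omega>. indicator {z. w z \<le> A} (\<omega> v) * ?C (S - {v}) (\<omega> v) \<omega> \<partial>Pi\<^sub>M S (\<lambda>_. M))
      \<le> (\<integral>\<^sup>+z. indicator {z. w z \<le> A} z * ?B z \<partial>M)" if v: "v \<in> S" for v
  proof -
    define J where "J = S - {v}"
    have J: "S = insert v J" "v \<notin> J" "finite J" "card J = 2 * p + r"
      using v S by (auto simp: J_def card_Diff_singleton)
    have "(\<integral>\<^sup>+\<omega>. indicator {z. w z \<le> A} (\<omega> v) * ?C J (\<omega> v) \<omega> \<partial>Pi\<^sub>M S (\<lambda>_. M))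
      = (\<integral>\<^sup>+z. \<integral>\<^sup>+\<omega>. indicator {z. w z \<le> A} ((\<omega> (v := z)) v) * ?C J ((\<omega> (v := z)) v) (\<omega> (v := z)) \<partial>Pi\<^sub>M J (\<lambda>_. M) \<partial>M)"
      unfolding J(1) using meas[OF v, unfolded J_def[symmetric], unfolded J(1)]
      by (intro P.product_nn_integral_insert_rev J)
    also have "\<dots> = (\<integral>\<^sup>+z. \<integral>\<^sup>+\<omega>. indicator {z. w z \<le> A} z * ?C J z \<omega> \<partial>Pi\<^sub>M J (\<lambda>_. M) \<partial>M)"
    proof (intro nn_integral_cong arg_cong2[where f = "(*)"])
      show "?C J ((\<omega> (v := z)) v) (\<omega> (v := z)) = ?C J z \<omega>" for z \<omega>
        using J(2) by (auto simp: indicator_def)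
    qed (simp only: fun_upd_same)
    also have "\<dots> \<le> (\<integral>\<^sup>+z. indicator {z. w z \<le> A} z * ?B z \<partial>M)"
    proof (rule nn_integral_mono)
      fix z assume z: "z \<in> space M"
      have Rz: "Measurable.pred M (R z)"
        using measurable_compose[OF measurable_Pair1'[OF z] R] by (simp only: prod.case)
      have "(\<integral>\<^sup>+\<omega>. ?C J z \<omega> \<partial>Pi\<^sub>M J (\<lambda>_. M)) \<le> ?B z"
        by (rule nn_integral_clique_le[OF Rz Q J(3,4)])
      moreover have "?C J z \<in> borel_measurable (Pi\<^sub>M J (\<lambda>_. M))"
        using J by (intro borel_measurable_of_pred pred_intros_logic pred_PiM_all pred_PiM_clique Rz Q order_refl)
      ultimately show "(\<integral>\<^sup>+\<omega>. indicator {z. w z \<le> A} z * ?C J z \<omega> \<partial>Pi\<^sub>M J (\<lambda>_. M)) \<le> indicator {z. w z \<le> A} z * ?B z"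
        by (subst nn_integral_cmult) (auto intro: mult_left_mono)
    qed
    finally show ?thesis unfolding J_def .
  qed
  have "(\<integral>\<^sup>+\<omega>. indicator {\<omega>. \<forall>i\<in>S. \<forall>j\<in>S. i \<noteq> j \<longrightarrow> Q (\<omega> i) (\<omega> j)} \<omega> \<partial>Pi\<^sub>M S (\<lambda>_. M))
    \<le> (\<integral>\<^sup>+\<omega>. (\<Prod>v\<in>S. indicator {x. A \<le> w x} (\<omega> v)) + (\<Sum>v\<in>S. indicator {z. w z \<le> A} (\<omega> v) * ?C (S - {v}) (\<omega> v) \<omega>) \<partial>Pi\<^sub>M S (\<lambda>_. M))"
  proof (rule nn_integral_mono)
    fix \<omega>
    show "indicator {\<omega>. \<forall>i\<in>S. \<forall>j\<in>S. i \<noteq> j \<longrightarrow> Q (\<omega> i) (\<omega> j)} \<omega> \<le>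
      (\<Prod>v\<in>S. indicator {x. A \<le> w x} (\<omega> v)) + (\<Sum>v\<in>S. indicator {z. w z \<le> A} (\<omega> v) * ?C (S - {v}) (\<omega> v) \<omega>)"
    proof (cases "(\<forall>i\<in>S. \<forall>j\<in>S. i \<noteq> j \<longrightarrow> Q (\<omega> i) (\<omega> j)) \<and> (\<exists>v\<in>S. w (\<omega> v) < A)")
      case False
      then show ?thesis by (auto simp: indicator_def not_less)
    next
      case True
      \<comment> \<open>Ties are broken arbitrarily: the summand of this single \<open>v\<close>
        already has the value \<open>1\<close>.\<close>
      define v where "v = arg_min_on (\<lambda>v. w (\<omega> v)) S"
      have ne: "S \<noteq> {}" using S by auto
      have v: "v \<in> S" "\<And>j. j \<in> S \<Longrightarrow> w (\<omega> v) \<le> w (\<omega> j)"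
        unfolding v_def using arg_min_if_finite(1)[OF S(1) ne] arg_min_least[OF S(1) ne] by auto
      have "w (\<omega> v) \<le> A" using True v(2) by fastforce
      moreover have "\<forall>j\<in>S - {v}. R (\<omega> v) (\<omega> j)" using True v by (auto intro!: RQ)
      ultimately have "1 = indicator {z. w z \<le> A} (\<omega> v) * ?C (S - {v}) (\<omega> v) \<omega>"
        using True by (simp add: indicator_def)
      also have "\<dots> \<le> (\<Sum>v\<in>S. indicator {z. w z \<le> A} (\<omega> v) * ?C (S - {v}) (\<omega> v) \<omega>)"
        using S v by (intro member_le_sum) auto
      finally show ?thesis using True by (simp add: add_increasing)
    qed
  qed
  also have "\<dots> = (\<integral>\<^sup>+\<omega>. (\<Prod>v\<in>S. indicator {x. A \<le> w x} (\<omega> v)) \<partial>Pi\<^sub>M S (\<lambda>_. M)) +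
      (\<integral>\<^sup>+\<omega>. (\<Sum>v\<in>S. indicator {z. w z \<le> A} (\<omega> v) * ?C (S - {v}) (\<omega> v) \<omega>) \<partial>Pi\<^sub>M S (\<lambda>_. M))"
    using S by (intro nn_integral_add borel_measurable_prod_ennreal borel_measurable_sum meas
        measurable_compose[OF _ borel_measurable_of_pred[OF lw(2)]] measurable_component_singleton)
  also have "(\<integral>\<^sup>+\<omega>. (\<Prod>v\<in>S. indicator {x. A \<le> w x} (\<omega> v)) \<partial>Pi\<^sub>M S (\<lambda>_. M)) = (\<Prod>v\<in>S. \<integral>\<^sup>+x. indicator {x. A \<le> w x} x \<partial>M)"
    using S by (intro P.product_nn_integral_prod borel_measurable_of_pred lw)
  also have "(\<integral>\<^sup>+x. indicator {x. A \<le> w x} x \<partial>M) = emeasure M {x \<in> space M. A \<le> w x}"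
  proof -
    have "(\<integral>\<^sup>+x. indicator {x. A \<le> w x} x \<partial>M) = (\<integral>\<^sup>+x. indicator {x \<in> space M. A \<le> w x} x \<partial>M)"
      by (intro nn_integral_cong) (auto simp: indicator_def)
    then show ?thesis using lw(2) unfolding pred_def by (simp only: nn_integral_indicator)
  qed
  also have "(\<integral>\<^sup>+\<omega>. (\<Sum>v\<in>S. indicator {z. w z \<le> A} (\<omega> v) * ?C (S - {v}) (\<omega> v) \<omega>) \<partial>Pi\<^sub>M S (\<lambda>_. M))
    = (\<Sum>v\<in>S. \<integral>\<^sup>+\<omega>. indicator {z. w z \<le> A} (\<omega> v) * ?C (S - {v}) (\<omega> v) \<omega> \<partial>Pi\<^sub>M S (\<lambda>_. M))"
    by (intro nn_integral_sum meas)
  also have "\<dots> \<le> (\<Sum>v\<in>S. \<integral>\<^sup>+z. indicator {z. w z \<le> A} z * ?B z \<partial>M)"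
    by (intro sum_mono step)
  finally show ?thesis by (simp add: add_left_mono)
qed

end

section \<open>Expected number of cliques\<close>

lemma power_mono_ennreal:
  fixes a b :: ennreal
  assumes "a \<le> b"
  shows "a ^ m \<le> b ^ m"
  using prod_mono_ennreal[of "{..<m}" "\<lambda>_. a" "\<lambda>_. b"] assms by simp

text \<open>Given the centre \<open>z\<close>, the other \<open>m\<close> points fall into its
  \<open>R\<close>-neighbourhood independently, and \<open>RQ\<close> makes any two of them
  adjacent. The centre itself is free, hence the exponent \<open>m\<close> for \<open>Suc m\<close>
  points.\<close>

lemma (in prob_space) nn_integral_clique_ge_star:
  fixes S :: "'i set"
  assumes Q: "Measurable.pred (M \<Otimes>\<^sub>M M) (\<lambda>(x, y). Q x y)" and R: "Measurable.pred (M \<Otimes>\<^sub>M M) (\<lambda>(x, y). R x y)"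
    and good: "AE z in M. \<alpha> \<le> (\<integral>\<^sup>+x. indicator {x. R z x} x \<partial>M)"
    and RQ: "\<And>z x. R z x \<Longrightarrow> Q z x" "\<And>z x. R z x \<Longrightarrow> Q x z" "\<And>z x y. R z x \<Longrightarrow> R z y \<Longrightarrow> Q x y"
    and S: "finite S" "card S = Suc m"
  shows "\<alpha> ^ m \<le> (\<integral>\<^sup>+\<omega>. indicator {\<omega>. \<forall>i\<in>S. \<forall>j\<in>S. i \<noteq> j \<longrightarrow> Q (\<omega> i) (\<omega> j)} \<omega> \<partial>Pi\<^sub>M S (\<lambda>_. M))"
proof -
  interpret P: product_sigma_finite "\<lambda>_::'i. M"
    by (intro product_sigma_finite.intro prob_space_imp_sigma_finite prob_space_axioms)
  obtain v J where J: "S = insert v J" "v \<notin> J" "card J = m" "finite J"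
    using S by (metis card_Suc_eq finite_insert)
  let ?C = "\<lambda>\<omega>. indicator {\<omega>. \<forall>i\<in>S. \<forall>j\<in>S. i \<noteq> j \<longrightarrow> Q (\<omega> i) (\<omega> j)} \<omega> :: ennreal"
  have "\<alpha> ^ m = (\<integral>\<^sup>+z. \<alpha> ^ m \<partial>M)"
    by (simp add: emeasure_space_1)
  also have "\<dots> \<le> (\<integral>\<^sup>+z. (\<integral>\<^sup>+x. indicator {x. R z x} x \<partial>M) ^ m \<partial>M)"
    using good by (intro nn_integral_mono_AE) (auto elim!: eventually_mono intro: power_mono_ennreal)
  also have "\<dots> = (\<integral>\<^sup>+z. \<integral>\<^sup>+\<omega>. (\<Prod>j\<in>J. indicator {x. R z x} (\<omega> j)) \<partial>Pi\<^sub>M J (\<lambda>_. M) \<partial>M)"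
  proof (rule nn_integral_cong)
    fix z assume z: "z \<in> space M"
    have "Measurable.pred M (R z)"
      using measurable_compose[OF measurable_Pair1'[OF z] R] by (simp only: prod.case)
    then have "(\<integral>\<^sup>+\<omega>. (\<Prod>j\<in>J. indicator {x. R z x} (\<omega> j)) \<partial>Pi\<^sub>M J (\<lambda>_. M)) = (\<Prod>j\<in>J. \<integral>\<^sup>+x. indicator {x. R z x} x \<partial>M)"
      using J by (intro P.product_nn_integral_prod borel_measurable_of_pred)
    then show "(\<integral>\<^sup>+x. indicator {x. R z x} x \<partial>M) ^ m = (\<integral>\<^sup>+\<omega>. (\<Prod>j\<in>J. indicator {x. R z x} (\<omega> j)) \<partial>Pi\<^sub>M J (\<lambda>_. M))"
      using J by simp
  qed
  also have "\<dots> \<le> (\<integral>\<^sup>+z. \<integral>\<^sup>+\<omega>. ?C (\<omega> (v := z)) \<partial>Pi\<^sub>M J (\<lambda>_. M) \<partial>M)"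
  proof (intro nn_integral_mono)
    fix z \<omega>
    show "(\<Prod>j\<in>J. indicator {x. R z x} (\<omega> j)) \<le> ?C (\<omega> (v := z))"
    proof (cases "\<forall>j\<in>J. R z (\<omega> j)")
      case True
      then have "Q (\<omega> i) (\<omega> j)" if "i \<in> J" "j \<in> J" for i j
        using that RQ(3) by blast
      then have "?C (\<omega> (v := z)) = 1"
        using True J RQ(1,2) by (auto simp: indicator_def)
      moreover have "(\<Prod>j\<in>J. indicator {x. R z x} (\<omega> j)) = (1 :: ennreal)"
        using True by (intro prod.neutral) simp
      ultimately show ?thesis by (simp only: order_refl)
    next
      case False
      then obtain j where "j \<in> J" "indicator {x. R z x} (\<omega> j) = (0 :: ennreal)"
        by (auto simp: indicator_def)
      then have "(\<Prod>j\<in>J. indicator {x. R z x} (\<omega> j)) = (0 :: ennreal)"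
        using J(4) by (intro prod_zero) auto
      then show ?thesis by (simp only: zero_le)
    qed
  qed
  also have "\<dots> = (\<integral>\<^sup>+\<omega>. ?C \<omega> \<partial>Pi\<^sub>M S (\<lambda>_. M))"
    unfolding J(1) using J S
    by (intro P.product_nn_integral_insert_rev[symmetric] borel_measurable_of_pred pred_PiM_clique Q) auto
  finally show ?thesis .
qed

lemma circle_dist_triangle:
  assumes "a \<in> {0..<1}" "b \<in> {0..<1}" "c \<in> {0..<1}"
  shows "circle_dist a c \<le> circle_dist b a + circle_dist b c"
  using assms unfolding circle_dist_def min_def abs_if by (auto split: if_splits)

context
  fixes w0 \<beta> lam :: real and n d :: nat
  assumes w0: "w0 > 0" and \<beta>: "\<beta> > 2" and lam: "lam > 0" and n: "n > 0" and d: "d \<ge> 1"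
begin

abbreviation (input) "V \<equiv> vertex_measure w0 \<beta> d"

text \<open>The product measure ranges over \<open>S\<close> alone, so the bounds for independent
  samples apply directly; extended nonnegative values avoid integrability conditions.\<close>

definition clique_prob :: "nat set \<Rightarrow> ennreal" where
  "clique_prob S = (\<integral>\<^sup>+\<omega>. indicator {\<omega>. \<forall>i\<in>S. \<forall>j\<in>S. i \<noteq> j \<longrightarrow> vertex_adj lam n d (\<omega> i) (\<omega> j)} \<omega> \<partial>Pi\<^sub>M S (\<lambda>_. V))"

text \<open>Linearity of expectation, together with the fact that the marginal of a product measure
  on \<open>S\<close> is the product measure over \<open>S\<close>.\<close>

lemma expected_cliques_eq_sum:
  "ennreal (expected_cliques lam w0 \<beta> n d k) = (\<Sum>S | S \<subseteq> {..<n} \<and> card S = k. clique_prob S)"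
proof -
  interpret V: prob_space V by (rule prob_space_vertex_measure[OF w0 \<beta> lam n d])
  interpret P: product_prob_space "\<lambda>_::nat. V" "{..<n}" ..
  let ?G = "girg_measure w0 \<beta> n d"
  let ?I = "\<lambda>S \<omega>. indicator {\<omega>. \<forall>i\<in>S. \<forall>j\<in>S. i \<noteq> j \<longrightarrow> vertex_adj lam n d (\<omega> i) (\<omega> j)} \<omega> :: ennreal"
  have G: "?G = Pi\<^sub>M {..<n} (\<lambda>_. V)"
    by (simp add: girg_measure_def vertex_measure_def)
  have I_meas: "?I S \<in> borel_measurable (Pi\<^sub>M I (\<lambda>_. V))" if "S \<subseteq> I" "finite S" for S I
    using that by (intro borel_measurable_of_pred pred_PiM_clique vertex_adj_measurable[OF w0 \<beta> lam n d])
  have "ennreal (expected_cliques lam w0 \<beta> n d k) = (\<integral>\<^sup>+\<omega>. ennreal (real (card (girg_cliques lam n d k \<omega>))) \<partial>?G)"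
    unfolding expected_cliques_def
    by (intro nn_integral_eq_integral[symmetric] integrable_card_girg_cliques[OF w0 \<beta>]) simp
  also have "\<dots> = (\<integral>\<^sup>+\<omega>. (\<Sum>S | S \<subseteq> {..<n} \<and> card S = k. ?I S \<omega>) \<partial>?G)"
  proof (intro nn_integral_cong)
    fix \<omega>
    have "ennreal (real (card (girg_cliques lam n d k \<omega>))) =
      (\<Sum>S | S \<subseteq> {..<n} \<and> card S = k. ennreal (of_bool (\<forall>u\<in>S. \<forall>v\<in>S. u \<noteq> v \<longrightarrow> girg_adj lam n d \<omega> u v)))"
      unfolding card_girg_cliques[OF w0 \<beta>] by (intro sum_ennreal[symmetric]) simp
    also have "\<dots> = (\<Sum>S | S \<subseteq> {..<n} \<and> card S = k. ?I S \<omega>)"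
      by (intro sum.cong refl) (auto simp: indicator_def girg_adj_def vertex_adj_def)
    finally show "ennreal (real (card (girg_cliques lam n d k \<omega>))) = (\<Sum>S | S \<subseteq> {..<n} \<and> card S = k. ?I S \<omega>)" .
  qed
  also have "\<dots> = (\<Sum>S | S \<subseteq> {..<n} \<and> card S = k. \<integral>\<^sup>+\<omega>. ?I S \<omega> \<partial>?G)"
    unfolding G by (intro nn_integral_sum I_meas) (auto intro: finite_subset)
  also have "\<dots> = (\<Sum>S | S \<subseteq> {..<n} \<and> card S = k. clique_prob S)"
  proof (intro sum.cong refl)
    fix S assume "S \<in> {S. S \<subseteq> {..<n} \<and> card S = k}"
    then have S: "S \<subseteq> {..<n}" "finite S" by (auto intro: finite_subset)
    have "clique_prob S = (\<integral>\<^sup>+\<omega>. ?I S \<omega> \<partial>distr (Pi\<^sub>M {..<n} (\<lambda>_. V)) (Pi\<^sub>M S (\<lambda>_. V)) (\<lambda>x. restrict x S))"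
      unfolding P.distr_PiM_restrict_finite[OF S(2,1)] clique_prob_def ..
    also have "\<dots> = (\<integral>\<^sup>+\<omega>. ?I S (restrict \<omega> S) \<partial>Pi\<^sub>M {..<n} (\<lambda>_. V))"
      by (rule nn_integral_distr[OF measurable_restrict_subset[OF S(1)]])
         (simp only: measurable_distr_eq1, rule I_meas[OF order_refl S(2)])
    also have "\<dots> = (\<integral>\<^sup>+\<omega>. ?I S \<omega> \<partial>?G)"
      unfolding G by (intro nn_integral_cong) (simp add: indicator_def)
    finally show "(\<integral>\<^sup>+\<omega>. ?I S \<omega> \<partial>?G) = clique_prob S" ..
  qed
  finally show ?thesis .
qed

lemma card_vertex_subsets: "card {S. S \<subseteq> {..<n} \<and> card S = k} = n choose k"
  using n_subsets[of "{..<n}" k] by simp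

lemma expected_cliques_le:
  assumes "\<And>S. finite S \<Longrightarrow> card S = k \<Longrightarrow> clique_prob S \<le> ennreal u" "0 \<le> u"
  shows "expected_cliques lam w0 \<beta> n d k \<le> real (n choose k) * u"
proof -
  have "ennreal (expected_cliques lam w0 \<beta> n d k) \<le> (\<Sum>S | S \<subseteq> {..<n} \<and> card S = k. ennreal u)"
    unfolding expected_cliques_eq_sum by (intro sum_mono assms) (auto intro: finite_subset)
  also have "\<dots> = ennreal (real (n choose k) * u)"
    using assms by (simp add: card_vertex_subsets ennreal_mult ennreal_of_nat_eq_real_of_nat)
  finally show ?thesis
    using assms by (subst (asm) ennreal_le_iff) auto
qed

lemma expected_cliques_ge:
  assumes "\<And>S. finite S \<Longrightarrow> card S = k \<Longrightarrow> ennreal u \<le> clique_prob S" "0 \<le> u"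
  shows "real (n choose k) * u \<le> expected_cliques lam w0 \<beta> n d k"
proof -
  have "ennreal (real (n choose k) * u) = (\<Sum>S | S \<subseteq> {..<n} \<and> card S = k. ennreal u)"
    using assms by (simp add: card_vertex_subsets ennreal_mult ennreal_of_nat_eq_real_of_nat)
  also have "\<dots> \<le> ennreal (expected_cliques lam w0 \<beta> n d k)"
    unfolding expected_cliques_eq_sum by (intro sum_mono assms) (auto intro: finite_subset)
  finally show ?thesis
    by (subst (asm) ennreal_le_iff) (auto simp: expected_cliques_def)
qed

section \<open>Lower bounds from hubs and from balls, and a common upper bound\<close>

lemma emeasure_vertex_weight_ge:
  "emeasure V {p \<in> space V. A \<le> fst p} = emeasure (weight_measure w0 \<beta>) {A..}"
proof -
  have "{p \<in> space V. A \<le> fst p} \<in> sets V"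
    by (intro borel_measurable_le borel_measurable_const fst_vertex_measurable[OF w0 \<beta> lam n d])
  then have "emeasure V {p \<in> space V. A \<le> fst p} = (\<integral>\<^sup>+p. indicator {p \<in> space V. A \<le> fst p} p \<partial>V)"
    by simp
  also have "\<dots> = (\<integral>\<^sup>+p. indicator {A..} (fst p) \<partial>V)"
    by (intro nn_integral_cong) (auto simp: indicator_def)
  also have "\<dots> = (\<integral>\<^sup>+b. indicator {A..} b \<partial>weight_measure w0 \<beta>)"
    by (intro nn_integral_vertex_weight[OF w0 \<beta> lam n d]) measurable
  also have "\<dots> = emeasure (weight_measure w0 \<beta>) {A..}"
    using sets_weight_measure[OF w0 \<beta>] by (intro nn_integral_indicator) simp
  finally show ?thesis .
qed

lemma expected_cliques_ge_hubs:
  assumes A: "A \<ge> w0" "real n \<le> lam * A * A"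
  shows "real (n choose k) * ((A / w0) powr (1 - \<beta>)) ^ k \<le> expected_cliques lam w0 \<beta> n d k"
proof (rule expected_cliques_ge)
  interpret V: prob_space V by (rule prob_space_vertex_measure[OF w0 \<beta> lam n d])
  interpret P: product_sigma_finite "\<lambda>_::nat. V"
    by (intro product_sigma_finite.intro prob_space_imp_sigma_finite V.prob_space_axioms)
  fix S :: "nat set" assume S: "finite S" "card S = k"
  have adj: "vertex_adj lam n d p q" if "A \<le> fst p" "A \<le> fst q" for p q
  proof -
    have "A * A \<le> fst p * fst q" using that A w0 by (intro mult_mono) auto
    then have "lam * (A * A) \<le> lam * (fst p * fst q)" using lam by simp
    then have "real n \<le> lam * fst p * fst q" using A by (simp add: mult.assoc)
    then have "1 powr (1 / real d) \<le> (lam * fst p * fst q / real n) powr (1 / real d)"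
      using n by (intro powr_mono2) auto
    moreover have "circle_dist a b \<le> 1 / 2" for a b
      unfolding circle_dist_def by linarith
    ultimately show ?thesis
      unfolding vertex_adj_def torus_dist_le_iff[OF d] girg_threshold_def by (auto intro: order_trans)
  qed
  have set: "{p \<in> space V. A \<le> fst p} \<in> sets V"
    by (intro borel_measurable_le borel_measurable_const fst_vertex_measurable[OF w0 \<beta> lam n d])
  have "ennreal (((A / w0) powr (1 - \<beta>)) ^ k) = (\<Prod>j\<in>S. emeasure V {p \<in> space V. A \<le> fst p})"
    unfolding emeasure_vertex_weight_ge emeasure_weight_ge[OF w0 \<beta> A(1)] using S by (simp add: ennreal_power)
  also have "\<dots> = (\<Prod>j\<in>S. \<integral>\<^sup>+p. indicator {p \<in> space V. A \<le> fst p} p \<partial>V)"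
    using set by simp
  also have "\<dots> = (\<integral>\<^sup>+\<omega>. (\<Prod>j\<in>S. indicator {p \<in> space V. A \<le> fst p} (\<omega> j)) \<partial>Pi\<^sub>M S (\<lambda>_. V))"
    using S set by (intro P.product_nn_integral_prod[symmetric]) auto
  also have "\<dots> \<le> clique_prob S"
    unfolding clique_prob_def
  proof (rule nn_integral_mono)
    fix \<omega>
    show "(\<Prod>j\<in>S. indicator {p \<in> space V. A \<le> fst p} (\<omega> j)) \<le>
        (indicator {\<omega>. \<forall>i\<in>S. \<forall>j\<in>S. i \<noteq> j \<longrightarrow> vertex_adj lam n d (\<omega> i) (\<omega> j)} \<omega> :: ennreal)"
    proof (cases "\<forall>j\<in>S. \<omega> j \<in> space V \<and> A \<le> fst (\<omega> j)")
      case True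
      then show ?thesis using adj by (auto simp: indicator_def)
    next
      case False
      then obtain j where "j \<in> S" "indicator {p \<in> space V. A \<le> fst p} (\<omega> j) = (0 :: ennreal)"
        by (auto simp: indicator_def)
      then have "(\<Prod>j\<in>S. indicator {p \<in> space V. A \<le> fst p} (\<omega> j)) = (0 :: ennreal)"
        using S(1) by (intro prod_zero) auto
      then show ?thesis by (simp only: zero_le)
    qed
  qed
  finally show "ennreal (((A / w0) powr (1 - \<beta>)) ^ k) \<le> clique_prob S" .
qed simp

text \<open>With \<open>t\<close> the threshold of two vertices of weight \<open>w0\<close>, points
  within \<open>t / 2\<close> of a common centre are pairwise within \<open>t\<close>. Halving the
  radius costs \<open>(1/2) ^ d\<close> for each vertex other than the centre.\<close>

lemma expected_cliques_ge_ball: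
  assumes small: "lam * w0 * w0 < real n"
  shows "real (n choose Suc m) * ((1/2) ^ d * (lam * w0 * w0 / real n)) ^ m \<le> expected_cliques lam w0 \<beta> n d (Suc m)"
proof (rule expected_cliques_ge)
  interpret V: prob_space V by (rule prob_space_vertex_measure[OF w0 \<beta> lam n d])
  fix S :: "nat set" assume S: "finite S" "card S = Suc m"
  define t where "t = girg_threshold lam n d w0 w0"
  have t0: "0 \<le> t" unfolding t_def by (rule girg_threshold_nonneg)
  have "(lam * w0 * w0 / real n) powr (1 / real d) \<le> 1 powr (1 / real d)"
    using small n w0 lam by (intro powr_mono2) auto
  then have t1: "t \<le> 1/2" unfolding t_def girg_threshold_def by simp
  have "(2 * t) ^ d = lam * w0 * w0 / real n"
    unfolding t_def using d lam n w0 by (intro girg_threshold_power) auto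
  moreover have "t ^ d = (1/2) ^ d * (2 * t) ^ d"
    by (simp only: power_mult_distrib[symmetric]) simp
  ultimately have td: "t ^ d = (1/2) ^ d * (lam * w0 * w0 / real n)"
    by (simp only:)
  \<comment> \<open>Positions in the unit cube and weights of at least \<open>w0\<close> are only
    almost sure, whereas the star bound asks that \<open>R\<close> imply adjacency at all points;
    therefore they are built into \<open>R\<close>.\<close>
  define ok :: "real \<times> (nat \<Rightarrow> real) \<Rightarrow> bool" where "ok p \<longleftrightarrow> w0 \<le> fst p \<and> (\<forall>i\<in>{..<d}. snd p i \<in> {0..<1})" for p
  define R where "R p q \<longleftrightarrow> ok p \<and> ok q \<and> torus_dist d (snd p) (snd q) \<le> t / 2" for p q
  note fm = fst_vertex_measurable[OF w0 \<beta> lam n d] and sm = snd_vertex_measurable[OF w0 \<beta> lam n d]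
  have AE_ok: "AE p in V. ok p"
    using AE_vertex[OF w0 \<beta> lam n d] by (rule eventually_mono) (simp add: ok_def)
  have "Measurable.pred (torus_measure d) (\<lambda>x. \<forall>i\<in>{..<d}. x i \<in> {0..<1})"
    by (intro pred_intros_finite measurable_compose[OF torus_component_measurable]) auto
  then have ok_meas: "Measurable.pred V ok"
    unfolding ok_def
  proof (intro pred_intros_logic)
    show "Measurable.pred V (\<lambda>p. w0 \<le> fst p)"
      unfolding pred_def by (intro borel_measurable_le borel_measurable_const fm)
  qed (rule measurable_compose[OF sm])
  have R_meas: "Measurable.pred (V \<Otimes>\<^sub>M V) (\<lambda>(p, q). R p q)"
    unfolding R_def case_prod_unfold
  proof (intro pred_intros_logic measurable_compose[OF measurable_fst ok_meas] measurable_compose[OF measurable_snd ok_meas])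
    show "Measurable.pred (V \<Otimes>\<^sub>M V) (\<lambda>x. torus_dist d (snd (fst x)) (snd (snd x)) \<le> t / 2)"
      unfolding pred_def
      by (intro borel_measurable_le borel_measurable_const torus_dist_measurable
          measurable_compose[OF measurable_fst sm] measurable_compose[OF measurable_snd sm])
  qed
  have thr: "t \<le> girg_threshold lam n d (fst p) (fst q)" if "ok p" "ok q" for p q
  proof -
    have "w0 * w0 \<le> fst p * fst q" using that w0 by (intro mult_mono) (auto simp: ok_def)
    then have "lam * w0 * w0 / real n \<le> lam * fst p * fst q / real n"
      using lam n by (simp add: mult.assoc divide_right_mono)
    then show ?thesis
      unfolding t_def girg_threshold_def using lam w0 by (intro mult_left_mono powr_mono2) auto
  qed
  have sym: "torus_dist d x y = torus_dist d y x" for x y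
    unfolding torus_dist_def circle_dist_def by (simp add: abs_minus_commute)
  have ball: "ennreal (t ^ d) \<le> (\<integral>\<^sup>+q. indicator {q. R p q} q \<partial>V)" if p: "ok p" "p \<in> space V" for p
  proof -
    have tm: "(\<lambda>q. torus_dist d (snd p) (snd q)) \<in> borel_measurable V"
      using p measurable_space[OF sm] by (intro torus_dist_measurable sm measurable_const) auto
    have "ennreal (t ^ d) = (\<integral>\<^sup>+b. \<integral>\<^sup>+x. indicator {x. torus_dist d (snd p) x \<le> t / 2} x \<partial>torus_measure d \<partial>weight_measure w0 \<beta>)"
    proof -
      interpret W: real_distribution "weight_measure w0 \<beta>"
        by (rule real_distribution_weight_measure[OF w0 \<beta>])
      have "(\<integral>\<^sup>+x. indicator {x. torus_dist d (snd p) x \<le> t / 2} x \<partial>torus_measure d) = ennreal ((2 * (t / 2)) ^ d)"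
        using d p t0 t1 by (intro nn_integral_torus_ball_eq) (auto simp: ok_def)
      then show ?thesis
        using W.emeasure_space_1 by (simp only: nn_integral_const) simp
    qed
    also have "\<dots> = (\<integral>\<^sup>+q. indicator {q. torus_dist d (snd p) (snd q) \<le> t / 2} q \<partial>V)"
    proof (subst nn_integral_vertex_measure[OF w0 \<beta> lam n d])
      show "(\<lambda>q. indicator {q. torus_dist d (snd p) (snd q) \<le> t / 2} q :: ennreal) \<in> borel_measurable V"
        by (intro borel_measurable_of_pred) (unfold pred_def, intro borel_measurable_le borel_measurable_const tm)
    qed (intro nn_integral_cong, simp add: indicator_def)
    also have "\<dots> = (\<integral>\<^sup>+q. indicator {q. R p q} q \<partial>V)"
      by (intro nn_integral_cong_AE, use AE_ok in eventually_elim) (simp add: R_def p indicator_def)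
    finally show ?thesis by simp
  qed
  have good: "AE p in V. ennreal (t ^ d) \<le> (\<integral>\<^sup>+q. indicator {q. R p q} q \<partial>V)"
    using AE_ok AE_space by eventually_elim (rule ball)
  have "ennreal (t ^ d) ^ m \<le> clique_prob S"
    unfolding clique_prob_def
  proof (rule V.nn_integral_clique_ge_star[OF vertex_adj_measurable[OF w0 \<beta> lam n d] R_meas good _ _ _ S])
    fix p q assume pq: "R p q"
    then show "vertex_adj lam n d p q" "vertex_adj lam n d q p"
      using thr[of p q] thr[of q p] t0 sym[of "snd p" "snd q"] by (auto simp: R_def vertex_adj_def)
  next
    fix z p q assume *: "R z p" "R z q"
    have "torus_dist d (snd p) (snd q) \<le> t"
      unfolding torus_dist_le_iff[OF d]
    proof (intro allI impI)
      fix i assume i: "i < d"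
      have "circle_dist (snd p i) (snd q i) \<le> circle_dist (snd z i) (snd p i) + circle_dist (snd z i) (snd q i)"
        using * i by (intro circle_dist_triangle) (auto simp: R_def ok_def)
      also have "\<dots> \<le> t / 2 + t / 2"
        using * i unfolding R_def torus_dist_le_iff[OF d] by (intro add_mono) auto
      finally show "circle_dist (snd p i) (snd q i) \<le> t" by simp
    qed
    then show "vertex_adj lam n d p q"
      using thr[of p q] * by (auto simp: R_def vertex_adj_def)
  qed
  then show "ennreal (((1/2) ^ d * (lam * w0 * w0 / real n)) ^ m) \<le> clique_prob S"
    using t0 unfolding td[symmetric] by (simp add: ennreal_power)
qed (use lam w0 in simp)

text \<open>One bound for both regimes. With \<open>p = 0\<close> no triangles enter and the cutoff
  may be as large as \<open>sqrt (n / lam)\<close>, as in the dense case; with \<open>p > 0\<close>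
  the cutoff must keep the balls from wrapping around. The moment bound \<open>\<mu>\<close> is a
  parameter because the regimes estimate it at opposite ends.\<close>

lemma expected_cliques_upper:
  assumes A: "A > 0" and small: "p = 0 \<or> lam * A * A / real n \<le> (1/3) ^ d"
    and moment: "(\<integral>\<^sup>+a\<in>{..A}. ennreal (a powr ((3 - \<beta>) * real (2 * p + r))) \<partial>weight_measure w0 \<beta>) \<le> ennreal \<mu>"
    and \<mu>: "0 \<le> \<mu>"
  shows "expected_cliques lam w0 \<beta> n d (Suc (2 * p + r)) \<le> real (n choose Suc (2 * p + r)) *
    (((A / w0) powr (1 - \<beta>)) ^ Suc (2 * p + r) + real (Suc (2 * p + r)) *
      ((nbr_const lam w0 \<beta> / real n) ^ (2 * p + r) * ((63/64) ^ d + 2 * ((3/2) powr (2 - \<beta>)) ^ d) ^ p * \<mu>))"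
proof (rule expected_cliques_le)
  interpret V: prob_space V by (rule prob_space_vertex_measure[OF w0 \<beta> lam n d])
  define m where "m = 2 * p + r"
  define \<tau> :: real where "\<tau> = (63/64) ^ d + 2 * ((3/2) powr (2 - \<beta>)) ^ d"
  define C where "C = nbr_const lam w0 \<beta>"
  have C0: "C \<ge> 0" using lam \<beta> by (simp add: C_def nbr_const_def)
  have \<tau>0: "\<tau> \<ge> 0" by (simp add: \<tau>_def)
  show "0 \<le> ((A / w0) powr (1 - \<beta>)) ^ Suc (2 * p + r) + real (Suc (2 * p + r)) *
      ((nbr_const lam w0 \<beta> / real n) ^ (2 * p + r) * ((63/64) ^ d + 2 * ((3/2) powr (2 - \<beta>)) ^ d) ^ p * \<mu>)"
    unfolding C_def[symmetric] \<tau>_def[symmetric] using C0 \<tau>0 \<mu>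
    by (intro add_nonneg_nonneg mult_nonneg_nonneg zero_le_power divide_nonneg_nonneg) auto
  fix S :: "nat set" assume S: "finite S" "card S = Suc (2 * p + r)"
  let ?T = "\<lambda>z. \<integral>\<^sup>+x. \<integral>\<^sup>+y. indicator {(x, y). heavier_nbr lam n d z x \<and> heavier_nbr lam n d z y \<and> vertex_adj lam n d x y} (x, y) \<partial>V \<partial>V"
  let ?S = "\<lambda>z. \<integral>\<^sup>+x. indicator {x. heavier_nbr lam n d z x} x \<partial>V"
  have "clique_prob S \<le> emeasure V {x \<in> space V. A \<le> fst x} ^ card S +
      of_nat (card S) * (\<integral>\<^sup>+z. indicator {z. fst z \<le> A} z * (?T z ^ p * ?S z ^ r) \<partial>V)"
    unfolding clique_prob_def
    by (rule V.nn_integral_clique_by_minimum_le[OF fst_vertex_measurable[OF w0 \<beta> lam n d]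
          vertex_adj_measurable[OF w0 \<beta> lam n d] heavier_nbr_measurable[OF w0 \<beta> lam n d] _ S])
       (simp add: heavier_nbr_def)
  also have "\<dots> \<le> ennreal (((A / w0) powr (1 - \<beta>)) ^ Suc m) +
      ennreal (real (Suc m)) * ennreal ((C / real n) ^ m * \<tau> ^ p * \<mu>)"
  proof (intro add_mono mult_mono)
    have "emeasure V {x \<in> space V. A \<le> fst x} ^ card S \<le> ennreal ((A / w0) powr (1 - \<beta>)) ^ Suc m"
      unfolding emeasure_vertex_weight_ge S m_def by (intro power_mono_ennreal emeasure_weight_ge_le w0 \<beta> A)
    then show "emeasure V {x \<in> space V. A \<le> fst x} ^ card S \<le> ennreal (((A / w0) powr (1 - \<beta>)) ^ Suc m)"
      by (subst ennreal_power[symmetric]) auto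
    show "of_nat (card S) \<le> ennreal (real (Suc m))"
      unfolding S m_def by (simp only: ennreal_of_nat_eq_real_of_nat order_refl)
    have "(\<integral>\<^sup>+z. indicator {z. fst z \<le> A} z * (?T z ^ p * ?S z ^ r) \<partial>V)
      \<le> (\<integral>\<^sup>+z. ennreal ((C / real n) ^ m * \<tau> ^ p) * (ennreal (fst z powr ((3 - \<beta>) * real m)) * indicator {..A} (fst z)) \<partial>V)"
    proof (intro nn_integral_mono_AE, use AE_vertex[OF w0 \<beta> lam n d] AE_space in eventually_elim)
      fix z assume z: "w0 \<le> fst z \<and> (\<forall>i<d. snd z i \<in> {0..<1})" "z \<in> space V"
      show "indicator {z. fst z \<le> A} z * (?T z ^ p * ?S z ^ r) \<le>
        ennreal ((C / real n) ^ m * \<tau> ^ p) * (ennreal (fst z powr ((3 - \<beta>) * real m)) * indicator {..A} (fst z))"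
      proof (cases "fst z \<le> A")
        case False
        then show ?thesis by (simp add: indicator_def)
      next
        case True
        define s where "s = C * fst z powr (3 - \<beta>) / real n"
        have s0: "s \<ge> 0" using C0 by (simp add: s_def)
        have S_le: "?S z \<le> ennreal s"
          unfolding s_def C_def using z by (intro nbr_integral_le w0 \<beta> lam n d) auto
        have T_le: "?T z ^ p \<le> ennreal (s\<^sup>2 * \<tau>) ^ p"
        proof (cases "p = 0")
          case False
          have "fst z * fst z \<le> A * A" using True z w0 by (intro mult_mono) auto
          then have "lam * fst z * fst z / real n \<le> lam * A * A / real n"
            using lam n by (simp add: mult.assoc divide_right_mono)
          also have "\<dots> \<le> (1/3) ^ d" using small False by simp
          finally have "?T z \<le> ennreal (s\<^sup>2 * \<tau>)"
            unfolding s_def C_def \<tau>_def using z by (intro triangle_integral_le w0 \<beta> lam n d) auto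
          then show ?thesis by (rule power_mono_ennreal)
        qed simp
        have "?T z ^ p * ?S z ^ r \<le> ennreal (s\<^sup>2 * \<tau>) ^ p * ennreal s ^ r"
          by (intro mult_mono T_le power_mono_ennreal S_le) auto
        also have "\<dots> = ennreal ((s\<^sup>2 * \<tau>) ^ p * s ^ r)"
          using s0 \<tau>0 by (subst (1 2) ennreal_power, simp, simp, intro ennreal_mult[symmetric]) auto
        also have "(s\<^sup>2 * \<tau>) ^ p * s ^ r = \<tau> ^ p * s ^ m"
          by (simp add: m_def power_mult_distrib power_add power_mult)
        also have "s ^ m = (C / real n) ^ m * fst z powr ((3 - \<beta>) * real m)"
          using z w0 by (simp add: s_def power_mult_distrib power_divide powr_power mult.commute)
        also have "ennreal (\<tau> ^ p * ((C / real n) ^ m * fst z powr ((3 - \<beta>) * real m)))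
            = ennreal ((C / real n) ^ m * \<tau> ^ p) * ennreal (fst z powr ((3 - \<beta>) * real m))"
          using C0 \<tau>0 by (subst ennreal_mult[symmetric]) (auto simp: mult_ac)
        finally show ?thesis using True by (simp add: indicator_def)
      qed
    qed
    also have "\<dots> = (\<integral>\<^sup>+a. ennreal ((C / real n) ^ m * \<tau> ^ p) * (ennreal (a powr ((3 - \<beta>) * real m)) * indicator {..A} a) \<partial>weight_measure w0 \<beta>)"
      by (rule nn_integral_vertex_weight[OF w0 \<beta> lam n d]) measurable
    also have "\<dots> = ennreal ((C / real n) ^ m * \<tau> ^ p) * (\<integral>\<^sup>+a\<in>{..A}. ennreal (a powr ((3 - \<beta>) * real m)) \<partial>weight_measure w0 \<beta>)"
      by (intro nn_integral_cmult) (subst measurable_cong_sets[OF sets_weight_measure[OF w0 \<beta>] refl], measurable)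
    also have "\<dots> \<le> ennreal ((C / real n) ^ m * \<tau> ^ p) * ennreal \<mu>"
      using moment by (intro mult_left_mono) (auto simp: m_def)
    also have "\<dots> = ennreal ((C / real n) ^ m * \<tau> ^ p * \<mu>)"
      using C0 \<tau>0 \<mu> by (intro ennreal_mult[symmetric]) auto
    finally show "(\<integral>\<^sup>+z. indicator {z. fst z \<le> A} z * (?T z ^ p * ?S z ^ r) \<partial>V) \<le> ennreal ((C / real n) ^ m * \<tau> ^ p * \<mu>)" .
  qed auto
  also have "\<dots> = ennreal (((A / w0) powr (1 - \<beta>)) ^ Suc m + real (Suc m) * ((C / real n) ^ m * \<tau> ^ p * \<mu>))"
    using C0 \<tau>0 \<mu> by (subst ennreal_mult[symmetric], simp, simp, subst ennreal_plus[symmetric]) auto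
  finally show "clique_prob S \<le> ennreal (((A / w0) powr (1 - \<beta>)) ^ Suc (2 * p + r) + real (Suc (2 * p + r)) *
      ((nbr_const lam w0 \<beta> / real n) ^ (2 * p + r) * ((63/64) ^ d + 2 * ((3/2) powr (2 - \<beta>)) ^ d) ^ p * \<mu>))"
    unfolding m_def C_def \<tau>_def .
qed

end

section \<open>Bounds with explicit constants\<close>

lemma powr_neg_self:
  assumes "c > 0" "k \<ge> 1"
  shows "(c * real k) powr (- real k) = (1 / c) ^ k / real k ^ k"
  using assms by (simp add: powr_minus powr_realpow power_mult_distrib divide_simps)

text \<open>A single summand of the exponential series, whose terms are nonnegative.\<close>

lemma power_div_fact_le_exp:
  fixes x :: real
  assumes "0 \<le> x"
  shows "x ^ k / fact k \<le> exp x"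
proof -
  have "(\<Sum>i\<in>{k}. x ^ i /\<^sub>R fact i) \<le> (\<Sum>i. x ^ i /\<^sub>R fact i)"
    using assms by (intro sum_le_suminf summable_exp_generic) auto
  then show ?thesis by (simp add: exp_def divide_inverse mult.commute)
qed

text \<open>Amounts to \<open>fact k \<ge> (k / exp 1) ^ k\<close>; this is the source of
  \<open>k powr (- k)\<close> in the upper bounds.\<close>

lemma binomial_le_exp:
  assumes "k \<ge> 1"
  shows "real (n choose k) \<le> real n ^ k * exp 1 ^ k / real k ^ k"
proof -
  have "real k ^ k / fact k \<le> exp 1 ^ k"
    using power_div_fact_le_exp[of "real k" k] by (simp add: exp_of_nat_mult[symmetric])
  then have "real k ^ k \<le> exp 1 ^ k * fact k"
    by (simp add: field_simps)
  then have "real (n choose k) * real k ^ k \<le> real (n choose k) * (exp 1 ^ k * fact k)"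
    by (intro mult_left_mono) auto
  also have "\<dots> = real ((n choose k) * fact k) * exp 1 ^ k"
    by simp
  also have "\<dots> \<le> real (n ^ k) * exp 1 ^ k"
    using binomial_fact_pow[of n k] by (intro mult_right_mono) (simp_all only: of_nat_le_iff, simp)
  finally show ?thesis
    using assms by (simp add: field_simps)
qed

text \<open>The choice of \<open>Suc m\<close> vertices gives \<open>N ^ Suc m\<close>, but only the
  \<open>m\<close> neighbours of the minimal vertex cost \<open>1 / N\<close> each, so one factor
  \<open>N\<close> survives in the second summand.\<close>

lemma clique_bound_split:
  fixes N :: real
  assumes "N \<noteq> 0"
  shows "(N ^ Suc m * E ^ Suc m / K) * (a ^ Suc m + q * ((C / N) ^ m * X)) =
    (E * (N * a)) ^ Suc m / K + N * (E ^ Suc m * (q * (C ^ m * X))) / K"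
proof -
  have h: "N ^ Suc m * ((C / N) ^ m * X) = N * (C ^ m * X)"
    using assms by (simp add: power_divide)
  have "(N ^ Suc m * E ^ Suc m / K) * (a ^ Suc m + q * ((C / N) ^ m * X))
      = (E ^ Suc m * (N ^ Suc m * a ^ Suc m)) / K + (E ^ Suc m * (q * (N ^ Suc m * ((C / N) ^ m * X)))) / K"
    by (simp only: divide_inverse distrib_left distrib_right mult_ac)
  also have "\<dots> = (E * (N * a)) ^ Suc m / K + N * (E ^ Suc m * (q * (C ^ m * X))) / K"
    unfolding h by (simp only: power_mult_distrib mult_ac)
  finally show ?thesis .
qed

text \<open>Turns lower powers of a constant into \<open>k\<close>-th powers, whichever side of
  \<open>1\<close> the constant lies on.\<close>

lemma power_le_max_1_power:
  fixes x :: real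
  assumes "0 \<le> x" "1 \<le> j" "j \<le> k"
  shows "x ^ j \<le> (max 1 x) ^ k"
proof -
  have "x ^ j \<le> (max 1 x) ^ j" using assms by (intro power_mono) auto
  also have "\<dots> \<le> (max 1 x) ^ k" using assms by (intro power_increasing) auto
  finally show ?thesis .
qed

text \<open>Merges the hub term and the minimal-weight term into one \<open>k\<close>-th power,
  hence into one constant.\<close>

lemma power_add_le_power:
  fixes a b :: real
  assumes "0 \<le> a" "0 \<le> b" "1 \<le> k"
  shows "a ^ k + b ^ k \<le> (a + b) ^ k"
  using assms(3)
proof (induction k rule: dec_induct)
  case (step k)
  have "a ^ Suc k + b ^ Suc k \<le> (a ^ k + b ^ k) * (a + b)"
    using assms by (simp add: algebra_simps)
  also have "\<dots> \<le> (a + b) ^ k * (a + b)"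
    using assms step by (intro mult_right_mono) auto
  finally show ?case by (simp add: mult.commute)
qed simp

section \<open>Bounds with constants independent of n, d and k\<close>

context
  fixes w0 \<beta> lam :: real
  assumes w0: "w0 > 0" and \<beta>: "\<beta> > 2" and lam: "lam > 0"
begin

definition hub_const :: real where
  "hub_const = w0 powr (\<beta> - 1) * lam powr ((\<beta> - 1) / 2)"

lemma hub_const_pos: "hub_const > 0"
  using w0 lam by (simp add: hub_const_def)

text \<open>For \<open>sqrt (n / (lam * q)) \<ge> w0\<close> the left-hand side is the expected number of vertices of at
  least this weight.\<close>

lemma hub_count:
  assumes "n > 0" "q > 0"
  shows "real n * (sqrt (real n / (lam * q)) / w0) powr (1 - \<beta>) =
    hub_const * real n powr ((3 - \<beta>) / 2) * q powr ((\<beta> - 1) / 2)"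
proof -
  define A where "A = sqrt (real n / (lam * q))"
  have A: "A = (real n / (lam * q)) powr (1/2)"
    unfolding A_def using assms lam by (subst powr_half_sqrt) auto
  have "A > 0" using assms lam by (simp add: A_def)
  then have "(A / w0) powr (1 - \<beta>) = w0 powr (\<beta> - 1) * A powr (1 - \<beta>)"
    using weight_tail_powr[OF w0 \<beta>] by simp
  also have "A powr (1 - \<beta>) = (real n / (lam * q)) powr ((1 - \<beta>) / 2)"
    unfolding A by (simp add: powr_powr)
  also have "\<dots> = real n powr ((1 - \<beta>) / 2) / (lam * q) powr ((1 - \<beta>) / 2)"
    using assms lam by (intro powr_divide)
  also have "\<dots> = real n powr ((1 - \<beta>) / 2) * (lam * q) powr ((\<beta> - 1) / 2)"
  proof -
    have "(1 - \<beta>) / 2 = - ((\<beta> - 1) / 2)" by (simp add: field_simps)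
    then have "(lam * q) powr ((1 - \<beta>) / 2) = inverse ((lam * q) powr ((\<beta> - 1) / 2))"
      by (simp only: powr_minus)
    then show ?thesis by (metis divide_inverse inverse_inverse_eq)
  qed
  also have "(lam * q) powr ((\<beta> - 1) / 2) = lam powr ((\<beta> - 1) / 2) * q powr ((\<beta> - 1) / 2)"
    using assms lam by (intro powr_mult) 
  finally have "real n * (A / w0) powr (1 - \<beta>) =
      hub_const * (real n powr 1 * real n powr ((1 - \<beta>) / 2)) * q powr ((\<beta> - 1) / 2)"
    using assms by (simp add: hub_const_def mult_ac)
  also have "real n powr 1 * real n powr ((1 - \<beta>) / 2) = real n powr ((3 - \<beta>) / 2)"
    unfolding powr_add[symmetric] by (simp add: field_simps)
  finally show ?thesis unfolding A_def .
qed

text \<open>\<open>ln 2\<close> stems from the halved radius. The ball bound has exponent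
  \<open>k - 1\<close>; passing to \<open>k\<close> only lowers it, since \<open>1/2\<close> and
  \<open>1 / c\<close> are at most \<open>1\<close>.\<close>

lemma expected_cliques_lower_ball:
  assumes "lam * w0 * w0 < real n" "d \<ge> 1" "1 \<le> k" "k \<le> n" "1 \<le> c" "1 / c \<le> lam * w0 * w0"
  shows "real n * (exp (- ln 2 * real d * real k) * (c * real k) powr (- real k)) \<le> expected_cliques lam w0 \<beta> n d k"
proof -
  define L where "L = lam * w0 * w0"
  have L: "L > 0" using lam w0 by (simp add: L_def)
  have n: "n > 0" using assms by simp
  obtain m where k: "k = Suc m" using assms by (cases k) auto
  have "exp (- ln 2 * real d * real k) = (1/2) ^ (d * k)"
  proof -
    have "exp (- ln 2 * real d * real k) = exp (- ln 2) ^ (d * k)"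
      by (simp add: exp_of_nat_mult[symmetric] mult_ac)
    then show ?thesis by (simp add: exp_minus inverse_eq_divide)
  qed
  also have "\<dots> \<le> (1/2) ^ (d * m)"
    using k by (intro power_decreasing) auto
  finally have e: "exp (- ln 2 * real d * real k) \<le> ((1/2) ^ d) ^ m"
    by (simp add: power_mult)
  have "(1 / c) ^ k \<le> (1 / c) ^ m"
    using assms k by (intro power_decreasing) auto
  also have "\<dots> \<le> L ^ m" using assms by (intro power_mono) (auto simp: L_def)
  finally have c: "(1 / c) ^ k \<le> L ^ m" .
  have "real n * (exp (- ln 2 * real d * real k) * (c * real k) powr (- real k))
     = real n * (exp (- ln 2 * real d * real k) * ((1 / c) ^ k / real k ^ k))"
    using assms by (simp add: powr_neg_self)
  also have "\<dots> \<le> real n * (((1/2) ^ d) ^ m * (L ^ m / real k ^ k))"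
    using assms e c by (intro mult_left_mono mult_mono divide_right_mono) auto
  also have "\<dots> = (real n / real k) ^ k * ((1/2) ^ d * (L / real n)) ^ m"
    using n by (simp add: k power_mult_distrib power_divide)
  also have "\<dots> \<le> real (n choose k) * ((1/2) ^ d * (L / real n)) ^ m"
    using assms L by (intro mult_right_mono binomial_ge_n_over_k_pow_k) auto
  also have "\<dots> \<le> expected_cliques lam w0 \<beta> n d k"
    unfolding k L_def using assms by (intro expected_cliques_ge_ball w0 \<beta> lam n) auto
  finally show ?thesis .
qed

text \<open>By \<open>n choose k \<ge> (n / k) ^ k\<close> the hub bound is at least the
  \<open>k\<close>-th power of the expected number of hubs divided by \<open>k\<close>.\<close>

lemma expected_cliques_lower_hubs:
  assumes "n > 0" "lam * w0 * w0 \<le> real n" "d \<ge> 1" "1 \<le> k" "k \<le> n" "c > 0" "1 / c \<le> hub_const"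
  shows "real n powr (real k / 2 * (3 - \<beta>)) * (c * real k) powr (- real k) \<le> expected_cliques lam w0 \<beta> n d k"
proof -
  define A where "A = sqrt (real n / (lam * 1))"
  have "w0\<^sup>2 \<le> real n / lam" using assms lam by (simp add: field_simps power2_eq_square)
  then have A: "w0 \<le> A" unfolding A_def using w0 by (intro real_le_rsqrt) simp
  have A2: "real n \<le> lam * A * A" using assms lam by (simp add: A_def mult.assoc)
  have "real n powr (real k / 2 * (3 - \<beta>)) * (c * real k) powr (- real k)
     = (real n powr ((3 - \<beta>) / 2)) ^ k * ((1 / c) ^ k / real k ^ k)"
    using assms by (simp add: powr_neg_self powr_power field_simps)
  also have "\<dots> \<le> (real n powr ((3 - \<beta>) / 2)) ^ k * (hub_const ^ k / real k ^ k)"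
    using assms by (intro mult_left_mono divide_right_mono power_mono) auto
  also have "\<dots> = (hub_const * real n powr ((3 - \<beta>) / 2) * 1 powr ((\<beta> - 1) / 2)) ^ k / real k ^ k"
    by (simp add: power_mult_distrib)
  also have "\<dots> = (real n / real k) ^ k * ((A / w0) powr (1 - \<beta>)) ^ k"
    unfolding A_def using assms by (subst hub_count[symmetric]) (auto simp: power_mult_distrib power_divide)
  also have "\<dots> \<le> real (n choose k) * ((A / w0) powr (1 - \<beta>)) ^ k"
    using assms by (intro mult_right_mono binomial_ge_n_over_k_pow_k) auto
  also have "\<dots> \<le> expected_cliques lam w0 \<beta> n d k"
    using assms A A2 by (intro expected_cliques_ge_hubs w0 \<beta> lam)
  finally show ?thesis .
qed

text \<open>At the cutoff \<open>A = sqrt (n / lam)\<close> both contributions have the same order.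
  With \<open>e = (3 - \<beta>) * k - 2\<close> the minimal-weight term carries
  \<open>n * A powr e\<close>, which up to the contribution of \<open>lam\<close> is
  \<open>n powr (k / 2 * (3 - \<beta>))\<close>, the power in the hub term. The gap \<delta> bounds
  \<open>1 / e\<close>.\<close>

lemma expected_cliques_upper_dense:
  assumes \<delta>: "\<delta> > 0"
  shows "\<exists>c>0. \<forall>n d k. 0 < n \<and> lam * w0 * w0 \<le> real n \<and> 1 \<le> d \<and> 2 \<le> k \<and> 2 + \<delta> \<le> (3 - \<beta>) * real k \<longrightarrow>
    expected_cliques lam w0 \<beta> n d k \<le> real n powr (real k / 2 * (3 - \<beta>)) * (c * real k) powr (- real k)"
proof -
  define C where "C = nbr_const lam w0 \<beta>"
  define B where "B = (\<beta> - 1) / \<delta> * w0 powr (\<beta> - 1)"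
  \<comment> \<open>Chosen such that \<open>lam powr (- (e / 2)) = lam * l ^ k\<close>, which makes
    \<open>lam\<close> enter as a \<open>k\<close>-th power up to one factor.\<close>
  define l where "l = lam powr (- ((3 - \<beta>) / 2))"
  define H where "H = exp 1 * hub_const + exp 1 * (2 * (max 1 C * (max 1 (B * lam) * max 1 l)))"
  have C0: "C \<ge> 0" using lam \<beta> by (simp add: C_def nbr_const_def)
  have B0: "B \<ge> 0" using \<beta> \<delta> by (simp add: B_def)
  have H1: "exp 1 * hub_const > 0" using hub_const_pos by simp
  have H2: "exp 1 * (2 * (max 1 C * (max 1 (B * lam) * max 1 l))) > 0" by (simp add: less_max_iff_disj)
  have H0: "H > 0" unfolding H_def using H1 H2 by linarith
  have main: "expected_cliques lam w0 \<beta> n d k \<le> real n powr (real k / 2 * (3 - \<beta>)) * (1 / H * real k) powr (- real k)"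
    if n: "0 < n" "lam * w0 * w0 \<le> real n" and d: "1 \<le> d" and k2: "2 \<le> k" and gap: "2 + \<delta> \<le> (3 - \<beta>) * real k" for n d k
  proof -
    define A where "A = sqrt (real n / (lam * 1))"
    define N where "N = real n powr (real k / 2 * (3 - \<beta>))"
    obtain m where k: "k = Suc m" using k2 by (cases k) auto
    have m1: "1 \<le> m" using k k2 by simp
    have "w0\<^sup>2 \<le> real n / lam" using n lam by (simp add: field_simps power2_eq_square)
    then have A: "w0 \<le> A" unfolding A_def using w0 by (intro real_le_rsqrt) simp
    have A0: "A > 0" using A w0 by simp
    define e where "e = (3 - \<beta>) * real k - 2"
    have e: "e \<ge> \<delta>" using gap by (simp add: e_def)
    define \<mu> where "\<mu> = (\<beta> - 1) / e * w0 powr (\<beta> - 1) * A powr e"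
    have \<mu>0: "0 \<le> \<mu>" using \<beta> e \<delta> by (simp add: \<mu>_def)
    have eq: "(3 - \<beta>) * real m - (\<beta> - 1) = e" "(3 - \<beta>) * real m + 1 - \<beta> = e"
      by (simp_all add: e_def k algebra_simps)
    have mu: "real n * \<mu> \<le> max 1 (B * lam) ^ k * max 1 l ^ k * N"
    proof -
      have "A powr e = (real n / lam) powr (e / 2)"
        unfolding A_def using n lam by (simp add: powr_half_sqrt[symmetric] powr_powr)
      also have "\<dots> = real n powr (e / 2) * lam powr (- (e / 2))"
        using n lam by (simp only: powr_minus_divide powr_divide of_nat_0_le_iff less_imp_le) simp
      also have "real n powr (e / 2) = N / real n"
      proof -
        have e2: "e / 2 = real k / 2 * (3 - \<beta>) - 1" by (simp add: e_def field_simps)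
        show ?thesis unfolding e2 N_def powr_diff using n by simp
      qed
      also have "lam powr (- (e / 2)) = lam * l ^ k"
      proof -
        have e2: "- (e / 2) = 1 + (- ((3 - \<beta>) / 2)) * real k" by (simp add: e_def field_simps)
        show ?thesis unfolding e2 l_def powr_add using lam by (simp add: powr_power mult.commute)
      qed
      finally have "real n * \<mu> = (\<beta> - 1) / e * w0 powr (\<beta> - 1) * lam * l ^ k * N"
        using n by (simp add: \<mu>_def)
      also have "\<dots> \<le> B * lam * l ^ k * N"
        unfolding B_def using \<beta> e \<delta> lam
        by (intro mult_right_mono divide_left_mono) (auto simp: l_def N_def)
      also have "\<dots> \<le> max 1 (B * lam) ^ k * max 1 l ^ k * N"
      proof (intro mult_right_mono mult_mono)
        show "B * lam \<le> max 1 (B * lam) ^ k" using power_le_max_1_power[of "B * lam" 1 k] B0 lam k2 by simp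
        show "l ^ k \<le> max 1 l ^ k" by (intro power_mono) (auto simp: l_def)
      qed (auto simp: N_def l_def)
      finally show ?thesis .
    qed
    have "exp 1 ^ k * (real k * (C ^ m * (real n * \<mu>))) \<le> exp 1 ^ k * (2 ^ k * (max 1 C ^ k * ((max 1 (B * lam)) ^ k * max 1 l ^ k * N)))"
    proof (intro mult_left_mono mult_mono[OF _ mult_mono[OF _ mu]])
      show "real k \<le> 2 ^ k" using less_exp[of k] by (simp add: less_imp_le)
      show "C ^ m \<le> max 1 C ^ k" using C0 m1 k by (intro power_le_max_1_power) auto
    qed (use C0 \<mu>0 in \<open>auto simp: N_def\<close>)
    also have "\<dots> = (exp 1 * (2 * (max 1 C * (max 1 (B * lam) * max 1 l)))) ^ k * N"
      by (simp only: power_mult_distrib mult_ac)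
    finally have t2: "exp 1 ^ k * (real k * (C ^ m * (real n * \<mu>))) \<le> (exp 1 * (2 * (max 1 C * (max 1 (B * lam) * max 1 l)))) ^ k * N" .
    have "(\<integral>\<^sup>+a\<in>{..A}. ennreal (a powr ((3 - \<beta>) * real m)) \<partial>weight_measure w0 \<beta>) \<le> ennreal \<mu>"
      using weight_moment_truncated[OF w0 \<beta> A, of "(3 - \<beta>) * real m"] eq e \<delta> unfolding \<mu>_def by simp
    then have "expected_cliques lam w0 \<beta> n d k \<le> real (n choose k) *
        (((A / w0) powr (1 - \<beta>)) ^ k + real k * ((C / real n) ^ m * \<mu>))"
      using expected_cliques_upper[OF w0 \<beta> lam n(1) d A0, of 0 m \<mu>] \<mu>0 by (simp add: k C_def)
    also have "\<dots> \<le> (real n ^ k * exp 1 ^ k / real k ^ k) * (((A / w0) powr (1 - \<beta>)) ^ k + real k * ((C / real n) ^ m * \<mu>))"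
      using k2 C0 \<mu>0 by (intro mult_right_mono binomial_le_exp) auto
    also have "\<dots> = (exp 1 * (real n * (A / w0) powr (1 - \<beta>))) ^ k / real k ^ k
        + exp 1 ^ k * (real k * (C ^ m * (real n * \<mu>))) / real k ^ k"
      using clique_bound_split[of "real n" m "exp 1" "real k ^ k" "(A / w0) powr (1 - \<beta>)" "real k" C \<mu>] n(1)
      unfolding k[symmetric] by (simp add: mult_ac)
    also have "real n * (A / w0) powr (1 - \<beta>) = hub_const * real n powr ((3 - \<beta>) / 2)"
      unfolding A_def using n by (subst hub_count) auto
    also have "(exp 1 * (hub_const * real n powr ((3 - \<beta>) / 2))) ^ k = (exp 1 * hub_const) ^ k * N"
      using n by (simp add: power_mult_distrib powr_power N_def mult_ac)
    finally have "expected_cliques lam w0 \<beta> n d k \<le> (exp 1 * hub_const) ^ k * N / real k ^ k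
        + exp 1 ^ k * (real k * (C ^ m * (real n * \<mu>))) / real k ^ k" .
    also have "\<dots> \<le> (exp 1 * hub_const) ^ k * N / real k ^ k
        + (exp 1 * (2 * (max 1 C * (max 1 (B * lam) * max 1 l)))) ^ k * N / real k ^ k"
      using t2 by (intro add_left_mono divide_right_mono) auto
    finally have "expected_cliques lam w0 \<beta> n d k \<le>
        ((exp 1 * hub_const) ^ k + (exp 1 * (2 * (max 1 C * (max 1 (B * lam) * max 1 l)))) ^ k) * N / real k ^ k"
      by (simp only: add_divide_distrib distrib_right)
    also have "\<dots> \<le> H ^ k * N / real k ^ k"
    proof -
      have "(exp 1 * hub_const) ^ k + (exp 1 * (2 * (max 1 C * (max 1 (B * lam) * max 1 l)))) ^ k \<le> H ^ k"
        unfolding H_def using H1 H2 k2 by (intro power_add_le_power) auto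
      then show ?thesis by (intro divide_right_mono mult_right_mono) (auto simp: N_def)
    qed
    also have "\<dots> = N * (1 / H * real k) powr (- real k)"
      using H0 k2 by (subst powr_neg_self) auto
    finally show ?thesis unfolding N_def .
  qed
  show ?thesis
    by (rule exI[of _ "1 / H"]) (use H0 main in auto)
qed

text \<open>\<open>\<theta>\<close> is the slower of the two decay rates, that of the corner and
  that of the weight tail. For \<open>k \<ge> 3\<close> the \<open>k - 1\<close> vertices besides
  the base form at least \<open>k / 4\<close> pairs, hence the \<open>4\<close> in the
  exponent.\<close>

lemma triangle_factor_le:
  assumes d: "1 \<le> d" and k: "3 \<le> k" and p: "p = (k - 1) div 2"
    and \<theta>: "\<theta> = max (63/64) ((3/2) powr (2 - \<beta>))"
  shows "((63/64) ^ d + 2 * ((3/2) powr (2 - \<beta>)) ^ d) ^ p \<le> 3 ^ k * exp (- (- ln \<theta> / 4) * real d * real k)"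
proof -
  have t0: "0 < \<theta>" by (simp add: \<theta> less_max_iff_disj)
  have "(3/2 :: real) powr (2 - \<beta>) < (3/2) powr 0" using \<beta> by (intro powr_less_mono) auto
  then have t1: "\<theta> < 1" by (simp add: \<theta>)
  have "(63/64) ^ d + 2 * ((3/2) powr (2 - \<beta>)) ^ d \<le> \<theta> ^ d + 2 * \<theta> ^ d"
    by (intro add_mono mult_left_mono power_mono) (auto simp: \<theta>)
  then have "((63/64) ^ d + 2 * ((3/2) powr (2 - \<beta>)) ^ d) ^ p \<le> (3 * \<theta> ^ d) ^ p"
    by (intro power_mono) auto
  also have "\<dots> = 3 ^ p * \<theta> powr (real d * real p)"
    using t0 by (simp add: power_mult_distrib power_mult[symmetric] powr_realpow[symmetric] powr_powr)
  also have "\<dots> \<le> 3 ^ k * \<theta> powr (real d * (real k / 4))"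
  proof (intro mult_mono)
    show "(3::real) ^ p \<le> 3 ^ k" using p by (intro power_increasing) auto
    have "k \<le> 4 * p" using p k by presburger
    then have "real k / 4 \<le> real p" by simp
    then show "\<theta> powr (real d * real p) \<le> \<theta> powr (real d * (real k / 4))"
      using t0 t1 by (intro powr_mono' mult_left_mono) auto
  qed auto
  also have "\<theta> powr (real d * (real k / 4)) = exp (- (- ln \<theta> / 4) * real d * real k)"
    using t0 by (simp add: powr_def mult_ac)
  finally show ?thesis .
qed

text \<open>Below the critical size the moment of the minimal weight converges without a cutoff, so
  the cutoff may be lowered until no ball wraps around. The price is a larger hub term, which the
  last premise keeps below \<open>n\<close>.\<close>

lemma expected_cliques_upper_sparse:
  assumes \<delta>: "\<delta> > 0"
  shows "\<exists>c>0. \<exists>c4>0. \<exists>M>0. \<forall>n d k. 0 < n \<and> 1 \<le> d \<and> 3 \<le> k \<and> (3 - \<beta>) * real k \<le> 2 - \<delta> \<and>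
      real n powr (real k / 2 * (3 - \<beta>)) * exp (M * real d * real k) \<le> real n \<longrightarrow>
    expected_cliques lam w0 \<beta> n d k \<le> real n * (exp (- c4 * real d * real k) * (c * real k) powr (- real k))"
proof -
  define C where "C = nbr_const lam w0 \<beta>"
  define B where "B = (\<beta> - 1) / \<delta>"
  define l where "l = w0 powr (3 - \<beta>)"
  define \<theta> where "\<theta> = max (63/64) ((3/2) powr (2 - \<beta>))"
  define c4 where "c4 = - ln \<theta> / 4"
  \<comment> \<open>The first summand pays for the \<open>3 ^ d\<close> in the cutoff, raised to
    \<open>(\<beta> - 1) / 2\<close> per vertex; the second leaves the factor
    \<open>exp (- c4 * d * k)\<close> on the hub term too.\<close>
  define M where "M = (\<beta> - 1) / 2 * ln 3 + c4"
  define H where "H = exp 1 * hub_const + exp 1 * (2 * (max 1 C * (3 * (max 1 B * max 1 l))))"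
  have t0: "0 < \<theta>" by (simp add: \<theta>_def less_max_iff_disj)
  have "(3/2 :: real) powr (2 - \<beta>) < (3/2) powr 0" using \<beta> by (intro powr_less_mono) auto
  then have t1: "\<theta> < 1" by (simp add: \<theta>_def)
  have c4: "c4 > 0" using t0 t1 by (simp add: c4_def)
  have M: "M > 0" unfolding M_def using \<beta> c4 by (intro add_nonneg_pos) auto
  have C0: "C \<ge> 0" using lam \<beta> by (simp add: C_def nbr_const_def)
  have B0: "B \<ge> 0" using \<beta> \<delta> by (simp add: B_def)
  have H1: "exp 1 * hub_const > 0" using hub_const_pos by simp
  have H2: "exp 1 * (2 * (max 1 C * (3 * (max 1 B * max 1 l)))) > 0" by (simp add: less_max_iff_disj)
  have H0: "H > 0" unfolding H_def using H1 H2 by linarith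
  have main: "expected_cliques lam w0 \<beta> n d k \<le> real n * (exp (- c4 * real d * real k) * (1 / H * real k) powr (- real k))"
    if n: "0 < n" and d: "1 \<le> d" and k3: "3 \<le> k" and gap: "(3 - \<beta>) * real k \<le> 2 - \<delta>"
      and hubs: "real n powr (real k / 2 * (3 - \<beta>)) * exp (M * real d * real k) \<le> real n" for n d k
  proof -
    define A where "A = sqrt (real n / (lam * 3 ^ d))"
    define D where "D = exp (- c4 * real d * real k)"
    define p where "p = (k - 1) div 2"
    define r where "r = (k - 1) mod 2"
    define m where "m = 2 * p + r"
    define \<tau> :: real where "\<tau> = (63/64) ^ d + 2 * ((3/2) powr (2 - \<beta>)) ^ d"
    have k: "k = Suc m" using k3 by (simp add: m_def p_def r_def)
    have m1: "1 \<le> m" using k k3 by simp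
    have A0: "A > 0" using n lam by (simp add: A_def)
    have small: "lam * A * A / real n \<le> (1/3) ^ d"
      using n lam by (simp add: A_def mult.assoc power_one_over inverse_eq_divide)
    define e where "e = 2 - (3 - \<beta>) * real k"
    have e: "e \<ge> \<delta>" using gap by (simp add: e_def)
    define \<mu> where "\<mu> = (\<beta> - 1) / e * l ^ m"
    have \<mu>0: "0 \<le> \<mu>" using \<beta> e \<delta> by (simp add: \<mu>_def l_def)
    have \<tau>0: "0 \<le> \<tau>" by (simp add: \<tau>_def)
    have moment: "(\<integral>\<^sup>+a\<in>{..A}. ennreal (a powr ((3 - \<beta>) * real m)) \<partial>weight_measure w0 \<beta>) \<le> ennreal \<mu>"
    proof -
      have eq: "\<beta> - 1 - (3 - \<beta>) * real m = e" by (simp add: e_def k algebra_simps)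
      have "(\<integral>\<^sup>+a\<in>{..A}. ennreal (a powr ((3 - \<beta>) * real m)) \<partial>weight_measure w0 \<beta>)
          \<le> (\<integral>\<^sup>+a\<in>{w0..}. ennreal (a powr ((3 - \<beta>) * real m)) \<partial>weight_measure w0 \<beta>)"
        by (intro nn_integral_mono_AE, use AE_weight_ge[OF w0 \<beta>] in eventually_elim) (auto simp: indicator_def)
      also have "\<dots> = ennreal ((\<beta> - 1) / e * w0 powr (\<beta> - 1) * w0 powr ((3 - \<beta>) * real m + 1 - \<beta>))"
        using eq e \<delta> by (subst weight_moment_tail[OF w0 \<beta>]) auto
      also have "(\<beta> - 1) / e * w0 powr (\<beta> - 1) * w0 powr ((3 - \<beta>) * real m + 1 - \<beta>)
          = (\<beta> - 1) / e * (w0 powr ((\<beta> - 1) + ((3 - \<beta>) * real m + 1 - \<beta>)))"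
        by (simp only: powr_add mult.assoc)
      also have "(\<beta> - 1) + ((3 - \<beta>) * real m + 1 - \<beta>) = (3 - \<beta>) * real m" by simp
      also have "w0 powr ((3 - \<beta>) * real m) = l ^ m"
        using w0 by (simp add: l_def powr_power mult.commute)
      finally show ?thesis unfolding \<mu>_def .
    qed
    have "exp 1 ^ k * (real k * (C ^ m * (\<tau> ^ p * \<mu>))) \<le> exp 1 ^ k * (2 ^ k * (max 1 C ^ k * ((3 ^ k * D) * (max 1 B ^ k * max 1 l ^ k))))"
    proof (intro mult_left_mono mult_mono)
      show "real k \<le> 2 ^ k" using less_exp[of k] by (simp add: less_imp_le)
      show "C ^ m \<le> max 1 C ^ k" using C0 m1 k by (intro power_le_max_1_power) auto
      show "\<tau> ^ p \<le> 3 ^ k * D"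
        unfolding \<tau>_def D_def c4_def by (rule triangle_factor_le[OF d k3 p_def \<theta>_def])
      have "\<mu> \<le> B * l ^ m"
        unfolding \<mu>_def B_def using \<beta> e \<delta>
        by (intro mult_right_mono divide_left_mono) (auto simp: l_def)
      also have "\<dots> \<le> max 1 B ^ k * max 1 l ^ k"
      proof (intro mult_mono)
        show "B \<le> max 1 B ^ k" using power_le_max_1_power[of B 1 k] B0 k3 by simp
        show "l ^ m \<le> max 1 l ^ k" using m1 k by (intro power_le_max_1_power) (auto simp: l_def)
      qed (auto simp: l_def)
      finally show "\<mu> \<le> max 1 B ^ k * max 1 l ^ k" .
    qed (use C0 \<mu>0 \<tau>0 in \<open>auto simp: D_def\<close>)
    also have "\<dots> = (exp 1 * (2 * (max 1 C * (3 * (max 1 B * max 1 l))))) ^ k * D"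
      by (simp only: power_mult_distrib mult_ac)
    finally have t2: "exp 1 ^ k * (real k * (C ^ m * (\<tau> ^ p * \<mu>))) \<le> (exp 1 * (2 * (max 1 C * (3 * (max 1 B * max 1 l))))) ^ k * D" .
    have "(real n powr ((3 - \<beta>) / 2) * (3 ^ d) powr ((\<beta> - 1) / 2)) ^ k
        = real n powr (real k / 2 * (3 - \<beta>)) * exp (M * real d * real k) * D"
    proof -
      have "(3 ^ d :: real) powr ((\<beta> - 1) / 2) = exp ((\<beta> - 1) / 2 * ln 3 * real d)"
        by (simp add: powr_def ln_realpow)
      then have "((3 ^ d :: real) powr ((\<beta> - 1) / 2)) ^ k = exp (M * real d * real k) * D"
        by (simp add: D_def M_def exp_of_nat_mult[symmetric] exp_add[symmetric] algebra_simps)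
      moreover have "(real n powr ((3 - \<beta>) / 2)) ^ k = real n powr (real k / 2 * (3 - \<beta>))"
        using n by (simp add: powr_power mult.commute)
      ultimately show ?thesis by (simp only: power_mult_distrib mult.assoc)
    qed
    also have "\<dots> \<le> real n * D"
      using hubs by (intro mult_right_mono) (auto simp: D_def)
    finally have t1: "(exp 1 * hub_const) ^ k * (real n powr ((3 - \<beta>) / 2) * (3 ^ d) powr ((\<beta> - 1) / 2)) ^ k
        \<le> (exp 1 * hub_const) ^ k * (real n * D)"
      using H1 by (intro mult_left_mono) auto
    have "expected_cliques lam w0 \<beta> n d k \<le> real (n choose k) *
        (((A / w0) powr (1 - \<beta>)) ^ k + real k * ((C / real n) ^ m * \<tau> ^ p * \<mu>))"
      using expected_cliques_upper[OF w0 \<beta> lam n d A0, of p r \<mu>] \<mu>0 moment small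
      by (simp only: k C_def \<tau>_def m_def simp_thms)
    also have "\<dots> \<le> (real n ^ k * exp 1 ^ k / real k ^ k) * (((A / w0) powr (1 - \<beta>)) ^ k + real k * ((C / real n) ^ m * \<tau> ^ p * \<mu>))"
      using k3 C0 \<mu>0 \<tau>0 by (intro mult_right_mono binomial_le_exp) auto
    also have "\<dots> = (exp 1 * (real n * (A / w0) powr (1 - \<beta>))) ^ k / real k ^ k
        + real n * (exp 1 ^ k * (real k * (C ^ m * (\<tau> ^ p * \<mu>)))) / real k ^ k"
      using clique_bound_split[of "real n" m "exp 1" "real k ^ k" "(A / w0) powr (1 - \<beta>)" "real k" C "\<tau> ^ p * \<mu>"] n
      unfolding k[symmetric] mult.assoc by simp
    also have "real n * (A / w0) powr (1 - \<beta>) = hub_const * real n powr ((3 - \<beta>) / 2) * (3 ^ d) powr ((\<beta> - 1) / 2)"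
      unfolding A_def using n by (intro hub_count) auto
    also have "(exp 1 * (hub_const * real n powr ((3 - \<beta>) / 2) * (3 ^ d) powr ((\<beta> - 1) / 2))) ^ k
        = (exp 1 * hub_const) ^ k * (real n powr ((3 - \<beta>) / 2) * (3 ^ d) powr ((\<beta> - 1) / 2)) ^ k"
      by (simp only: power_mult_distrib mult.assoc)
    finally have "expected_cliques lam w0 \<beta> n d k \<le>
        (exp 1 * hub_const) ^ k * (real n powr ((3 - \<beta>) / 2) * (3 ^ d) powr ((\<beta> - 1) / 2)) ^ k / real k ^ k
        + real n * (exp 1 ^ k * (real k * (C ^ m * (\<tau> ^ p * \<mu>)))) / real k ^ k" .
    also have "\<dots> \<le> (exp 1 * hub_const) ^ k * (real n * D) / real k ^ k
        + real n * ((exp 1 * (2 * (max 1 C * (3 * (max 1 B * max 1 l))))) ^ k * D) / real k ^ k"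
      by (intro add_mono divide_right_mono[OF t1] divide_right_mono[OF mult_left_mono[OF t2]]) auto
    also have "\<dots> = ((exp 1 * hub_const) ^ k + (exp 1 * (2 * (max 1 C * (3 * (max 1 B * max 1 l))))) ^ k) * (real n * D) / real k ^ k"
      by (simp only: add_divide_distrib distrib_right distrib_left mult_ac)
    also have "\<dots> \<le> H ^ k * (real n * D) / real k ^ k"
    proof -
      have "(exp 1 * hub_const) ^ k + (exp 1 * (2 * (max 1 C * (3 * (max 1 B * max 1 l))))) ^ k \<le> H ^ k"
        unfolding H_def using H1 H2 k3 by (intro power_add_le_power) auto
      then show ?thesis by (intro divide_right_mono mult_right_mono) (auto simp: D_def)
    qed
    also have "\<dots> = real n * (D * (1 / H * real k) powr (- real k))"
      using H0 k3 by (subst powr_neg_self) auto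
    finally show ?thesis unfolding D_def .
  qed
  show ?thesis
    by (rule exI[of _ "1 / H"], intro conjI, use H0 in simp, rule exI[of _ c4], intro conjI c4, rule exI[of _ M])
       (use main M in auto)
qed

end

section \<open>Asymptotics\<close>

text \<open>Only the nearest integers on either side of \<open>x = 2 / (3 - \<beta>)\<close> matter.
  \<open>\<lceil>x\<rceil> - 1\<close> and \<open>\<lfloor>x\<rfloor> + 1\<close> differ from
  \<open>x\<close> even if \<open>x\<close> is an integer, so \<delta> is positive. For \<beta>
  \<ge> 3 the product is nonpositive and \<open>1\<close> works.\<close>

lemma exponent_gap:
  fixes \<beta> :: real
  shows "\<exists>\<delta>>0. \<forall>k::nat. (real k < 2 / (3 - \<beta>) \<or> \<beta> \<ge> 3 \<longrightarrow> (3 - \<beta>) * real k \<le> 2 - \<delta>) \<and>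
    (\<beta> < 3 \<and> real k > 2 / (3 - \<beta>) \<longrightarrow> 2 + \<delta> \<le> (3 - \<beta>) * real k)"
proof (cases "\<beta> \<ge> 3")
  case True
  have "(3 - \<beta>) * real k \<le> 2 - 1" for k
    using True mult_nonpos_nonneg[of "3 - \<beta>" "real k"] by auto
  then show ?thesis using True by (intro exI[of _ 1]) auto
next
  case False
  define g where "g = 3 - \<beta>"
  define x where "x = 2 / g"
  have g: "g > 0" using False by (simp add: g_def)
  have gx: "g * x = 2" using g by (simp add: x_def)
  define \<delta> where "\<delta> = min (2 - g * (of_int \<lceil>x\<rceil> - 1)) (g * (of_int \<lfloor>x\<rfloor> + 1) - 2)"
  have "of_int \<lceil>x\<rceil> - 1 < x" "x < of_int \<lfloor>x\<rfloor> + 1" by linarith+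
  then have "g * (of_int \<lceil>x\<rceil> - 1) < g * x" "g * x < g * (of_int \<lfloor>x\<rfloor> + 1)"
    using g by (intro mult_strict_left_mono; simp)+
  then have "\<delta> > 0" unfolding \<delta>_def gx by simp
  moreover have "g * real k \<le> 2 - \<delta>" if "real k < x" for k :: nat
  proof -
    have "int k < \<lceil>x\<rceil>" using that by (simp add: less_ceiling_iff)
    then have "real k \<le> of_int \<lceil>x\<rceil> - 1" by linarith
    then have "g * real k \<le> g * (of_int \<lceil>x\<rceil> - 1)" using g by (intro mult_left_mono) auto
    then show ?thesis unfolding \<delta>_def by linarith
  qed
  moreover have "2 + \<delta> \<le> g * real k" if "real k > x" for k :: nat
  proof -
    have "\<lfloor>x\<rfloor> < int k" using that by (simp add: floor_less_iff)
    then have "of_int \<lfloor>x\<rfloor> + 1 \<le> real k" by linarith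
    then have "g * (of_int \<lfloor>x\<rfloor> + 1) \<le> g * real k" using g by (intro mult_left_mono) auto
    then show ?thesis unfolding \<delta>_def by linarith
  qed
  ultimately show ?thesis
    using False unfolding g_def x_def by (intro exI[of _ \<delta>]) auto
qed

text \<open>For \<beta> > 3 the exponent of \<open>n\<close> is negative and proportional to
  \<open>k\<close>, which beats \<open>M * d * k\<close> for every \<open>k\<close> because
  \<open>d\<close> is \<open>o(ln n)\<close>. For \<beta> = 3 that power is constant, and
  \<open>d * k\<close> itself has to be \<open>o(ln n)\<close>. For \<beta> < 3 the size
  \<open>k\<close> is bounded and \<open>n\<close> is ahead by at least
  \<open>n powr (\<delta> / 2)\<close>.\<close>

lemma eventually_hubs_negligible:
  fixes \<beta> M \<delta> :: real and d k :: "nat \<Rightarrow> nat"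
  assumes M: "M > 0" and \<delta>: "\<delta> > 0"
    and d1: "\<forall>n. d n \<ge> 1" and d: "(\<lambda>n. real (d n)) \<in> o(\<lambda>n. ln (real n))"
    and k: "\<beta> = 3 \<longrightarrow> (\<lambda>n. real (k n)) \<in> o(\<lambda>n. ln (real n) / real (d n))"
    and gap: "\<And>k::nat. real k < 2 / (3 - \<beta>) \<or> \<beta> \<ge> 3 \<Longrightarrow> (3 - \<beta>) * real k \<le> 2 - \<delta>"
  shows "\<forall>\<^sub>F n in sequentially. real (k n) < 2 / (3 - \<beta>) \<or> \<beta> \<ge> 3 \<longrightarrow>
    real n powr (real (k n) / 2 * (3 - \<beta>)) * exp (M * real (d n) * real (k n)) \<le> real n"
proof -
  have key: "real n powr (real (k n) / 2 * (3 - \<beta>)) * exp (M * real (d n) * real (k n)) \<le> real n"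
    if "n \<ge> 1" "real (k n) / 2 * (3 - \<beta>) * ln (real n) + M * real (d n) * real (k n) \<le> ln (real n)" for n
  proof -
    have "real n powr (real (k n) / 2 * (3 - \<beta>)) * exp (M * real (d n) * real (k n))
        = exp (real (k n) / 2 * (3 - \<beta>) * ln (real n) + M * real (d n) * real (k n))"
      using that by (simp add: powr_def exp_add)
    also have "\<dots> \<le> exp (ln (real n))" using that by (simp only: exp_le_cancel_iff)
    finally show ?thesis using that by simp
  qed
  have dlog: "\<forall>\<^sub>F n in sequentially. real (d n) \<le> c * ln (real n)" if "c > 0" for c
    using landau_o.smallD[OF d that] eventually_ge_at_top[of 1]
    by eventually_elim simp
  consider "\<beta> > 3" | "\<beta> = 3" | "\<beta> < 3" by linarith
  then show ?thesis
  proof cases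
    case 1
    define c where "c = (\<beta> - 3) / 2 / M"
    have c: "c > 0" using 1 M by (simp add: c_def)
    show ?thesis
      using dlog[OF c] eventually_ge_at_top[of 1]
    proof eventually_elim
      case (elim n)
      have "M * real (d n) \<le> M * (c * ln (real n))" using M elim by (intro mult_left_mono) auto
      also have "\<dots> = (\<beta> - 3) / 2 * ln (real n)" using M by (simp add: c_def)
      finally have "M * real (d n) * real (k n) \<le> (\<beta> - 3) / 2 * ln (real n) * real (k n)"
        by (intro mult_right_mono) auto
      then have "real (k n) / 2 * (3 - \<beta>) * ln (real n) + M * real (d n) * real (k n) \<le> 0"
        by (simp add: field_simps)
      also have "0 \<le> ln (real n)" using elim by simp
      finally show ?case using elim key by blast
    qed
  next
    case 2
    have "\<forall>\<^sub>F n in sequentially. norm (real (k n)) \<le> 1 / M * norm (ln (real n) / real (d n))"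
      using k 2 M by (intro landau_o.smallD) auto
    then show ?thesis
      using eventually_ge_at_top[of 1]
    proof eventually_elim
      case (elim n)
      have "d n \<ge> 1" using d1 by blast
      then have "real (d n) > 0" by simp
      moreover have "real (k n) \<le> 1 / M * (ln (real n) / real (d n))" using elim by simp
      ultimately have "M * real (d n) * real (k n) \<le> ln (real n)" using M by (simp add: field_simps)
      then have "real (k n) / 2 * (3 - \<beta>) * ln (real n) + M * real (d n) * real (k n) \<le> ln (real n)"
        using 2 by simp
      then show ?case using elim key by blast
    qed
  next
    case 3
    define x where "x = 2 / (3 - \<beta>)"
    have x: "x > 0" using 3 by (simp add: x_def)
    \<comment> \<open>Makes \<open>M * (c * ln n) * x\<close> equal to the available slack
      \<open>\<delta> / 2 * ln n\<close>.\<close>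
    define c where "c = \<delta> / 2 / (M * x)"
    have c: "c > 0" using x M \<delta> by (simp add: c_def)
    show ?thesis
      using dlog[OF c] eventually_ge_at_top[of 1]
    proof eventually_elim
      case (elim n)
      show ?case
      proof
        assume *: "real (k n) < 2 / (3 - \<beta>) \<or> \<beta> \<ge> 3"
        have ln0: "0 \<le> ln (real n)" using elim by simp
        have "M * real (d n) * real (k n) \<le> M * (c * ln (real n)) * x"
          using M elim * 3 c ln0 by (intro mult_mono) (auto simp: x_def)
        also have "\<dots> = \<delta> / 2 * ln (real n)" using M x by (simp add: c_def)
        finally have "M * real (d n) * real (k n) \<le> \<delta> / 2 * ln (real n)" .
        moreover have "real (k n) / 2 * (3 - \<beta>) * ln (real n) \<le> (2 - \<delta>) / 2 * ln (real n)"
          using gap[OF *] ln0 by (intro mult_right_mono) (auto simp: field_simps)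
        ultimately have "real (k n) / 2 * (3 - \<beta>) * ln (real n) + M * real (d n) * real (k n) \<le> ln (real n)"
          by (simp add: field_simps)
        then show "real n powr (real (k n) / 2 * (3 - \<beta>)) * exp (M * real (d n) * real (k n)) \<le> real n"
          using elim key by blast
      qed
    qed
  qed
qed

text \<open>Bounds on the whole product are split into bounds on two separate factors.
  \<open>X = xl\<close> works unless it pushes \<open>Y\<close> beyond \<open>yh\<close>; then
  \<open>Y = yh\<close>, and \<open>X = P / yh\<close> lies above \<open>xl\<close>.\<close>

lemma product_between:
  fixes P :: real
  assumes "0 < xl" "0 < yh" "xl \<le> xh" "yl \<le> yh" "xl * yl \<le> P" "P \<le> xh * yh"
  shows "\<exists>X Y. P = X * Y \<and> xl \<le> X \<and> X \<le> xh \<and> yl \<le> Y \<and> Y \<le> yh"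
proof (cases "P / xl \<le> yh")
  case True
  then show ?thesis
    using assms by (intro exI[of _ xl] exI[of _ "P / xl"]) (auto simp: field_simps)
next
  case False
  then show ?thesis
    using assms by (intro exI[of _ "P / yh"] exI[of _ yh]) (auto simp: field_simps)
qed

lemma powr_neg_self_antimono:
  assumes "0 < c" "c \<le> c'" "1 \<le> k"
  shows "(c' * real k) powr (- real k) \<le> (c * real k) powr (- real k)"
  using assms by (intro powr_mono2') auto

text \<open>The constants are chosen before \<open>d\<close> and \<open>k\<close>, so they serve all
  admissible sequences. In the second case the lower bound is asserted for \<open>k \<le> n\<close>,
  as larger cliques do not exist, and the upper bound leaves out the size at which the
  minimal-weight moment is logarithmic. In the first case \<open>err\<close> takes up
  \<open>k > n\<close>. At \<beta> = 3 the quotient \<open>2 / (3 - \<beta>)\<close> is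
  \<open>0\<close> by convention, and the disjunct \<beta> \<ge> 3 decides.\<close>

theorem theorem13:
  fixes lam w0 \<beta> :: real
  assumes "lam > 0" and "w0 > 0" and "\<beta> > 2"
  shows "\<exists>c1>0. \<exists>c2>0. \<exists>c3>0. \<exists>c4>0. \<forall>(d :: nat \<Rightarrow> nat) (k :: nat \<Rightarrow> nat).
    (\<forall>n. d n \<ge> 1) \<longrightarrow>
    (\<lambda>n. real (d n)) \<in> o(\<lambda>n. ln (real n)) \<longrightarrow>
    (\<forall>n. k n \<ge> 3) \<longrightarrow>
    (\<beta> = 3 \<longrightarrow> (\<lambda>n. real (k n)) \<in> o(\<lambda>n. ln (real n) / real (d n))) \<longrightarrow>
    (\<exists>(X :: nat \<Rightarrow> real) (Y :: nat \<Rightarrow> real) (err :: nat \<Rightarrow> real).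
      err \<longlonglongrightarrow> 0 \<and>
      (\<forall>\<^sub>F n in sequentially.
        if real (k n) < 2 / (3 - \<beta>) \<or> \<beta> \<ge> 3
        then
          expected_cliques lam w0 \<beta> n (d n) (k n) = real n * X n * Y n + err n \<and>
          exp (- c3 * real (d n) * real (k n)) \<le> X n \<and>
          X n \<le> exp (- c4 * real (d n) * real (k n)) \<and>
          (c1 * real (k n)) powr (- real (k n)) \<le> Y n \<and>
          Y n \<le> (c2 * real (k n)) powr (- real (k n))
        else
          expected_cliques lam w0 \<beta> n (d n) (k n)
            = real n powr (real (k n) / 2 * (3 - \<beta>)) * Y n \<and>
          (k n \<le> n \<longrightarrow> (c1 * real (k n)) powr (- real (k n)) \<le> Y n) \<and>
          (real (k n) \<noteq> 2 / (3 - \<beta>) \<longrightarrow> Y n \<le> (c2 * real (k n)) powr (- real (k n)))))"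
proof -
  note a = assms(2,3,1)
  obtain \<delta> where \<delta>: "\<delta> > 0"
    and gapA: "\<And>k::nat. real k < 2 / (3 - \<beta>) \<or> \<beta> \<ge> 3 \<Longrightarrow> (3 - \<beta>) * real k \<le> 2 - \<delta>"
    and gapB: "\<And>k::nat. \<beta> < 3 \<Longrightarrow> real k > 2 / (3 - \<beta>) \<Longrightarrow> 2 + \<delta> \<le> (3 - \<beta>) * real k"
    using exponent_gap[of \<beta>] by blast
  obtain cA c4 M where pos: "cA > 0" "c4 > 0" "M > 0" and upperA: "\<And>n d k. 0 < n \<Longrightarrow> 1 \<le> d \<Longrightarrow> 3 \<le> k \<Longrightarrow>
      (3 - \<beta>) * real k \<le> 2 - \<delta> \<Longrightarrow>
      real n powr (real k / 2 * (3 - \<beta>)) * exp (M * real d * real k) \<le> real n \<Longrightarrow>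
    expected_cliques lam w0 \<beta> n d k \<le> real n * (exp (- c4 * real d * real k) * (cA * real k) powr (- real k))"
    using expected_cliques_upper_sparse[OF a \<delta>] by metis
  obtain cB where cB: "cB > 0" and upperB: "\<And>n d k. 0 < n \<Longrightarrow> lam * w0 * w0 \<le> real n \<Longrightarrow> 1 \<le> d \<Longrightarrow> 2 \<le> k \<Longrightarrow>
      2 + \<delta> \<le> (3 - \<beta>) * real k \<Longrightarrow>
    expected_cliques lam w0 \<beta> n d k \<le> real n powr (real k / 2 * (3 - \<beta>)) * (cB * real k) powr (- real k)"
    using expected_cliques_upper_dense[OF a \<delta>] by metis
  define h where "h = hub_const w0 \<beta> lam"
  have h: "h > 0" unfolding h_def by (rule hub_const_pos[OF a])
  have Lpos: "lam * w0 * w0 > 0" using assms by simp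
  define c2 where "c2 = min cA cB"
  \<comment> \<open>\<open>1\<close> gives \<open>1 / c1 \<le> 1\<close> and
    \<open>yl n \<le> k powr (- k)\<close>, the next two entries serve the ball and the hub lower
    bounds, and \<open>c2\<close> ensures \<open>yl n \<le> yh n\<close>.\<close>
  define c1 where "c1 = Max {1, 1 / (lam * w0 * w0), 1 / h, c2}"
  define c3 where "c3 = max (ln 2) c4"
  have c2: "c2 > 0" "c2 \<le> cA" "c2 \<le> cB" using pos cB by (auto simp: c2_def)
  have "\<forall>c\<in>{1, 1 / (lam * w0 * w0), 1 / h, c2}. c \<le> c1" unfolding c1_def by (intro ballI Max_ge) auto
  then have c1: "1 \<le> c1" "1 / (lam * w0 * w0) \<le> c1" "1 / h \<le> c1" "c2 \<le> c1" by auto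
  have c1L: "1 / c1 \<le> lam * w0 * w0" and c1h: "1 / c1 \<le> h"
    using c1 Lpos h by (simp_all add: field_simps)
  have c3: "c3 > 0" "ln 2 \<le> c3" "c4 \<le> c3" using pos by (auto simp: c3_def less_max_iff_disj)
  show ?thesis
  proof (rule exI[of _ c1], intro conjI, use c1 in simp, rule exI[of _ c2], intro conjI c2(1),
      rule exI[of _ c3], intro conjI c3(1), rule exI[of _ c4], intro conjI pos(2) allI impI)
    fix d k :: "nat \<Rightarrow> nat"
    assume d1: "\<forall>n. d n \<ge> 1" and d: "(\<lambda>n. real (d n)) \<in> o(\<lambda>n. ln (real n))" and k3: "\<forall>n. k n \<ge> 3"
      and k: "\<beta> = 3 \<longrightarrow> (\<lambda>n. real (k n)) \<in> o(\<lambda>n. ln (real n) / real (d n))"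
    define sparse where "sparse n \<longleftrightarrow> real (k n) < 2 / (3 - \<beta>) \<or> \<beta> \<ge> 3" for n
    define E where "E n = expected_cliques lam w0 \<beta> n (d n) (k n)" for n
    define xl where "xl n = exp (- c3 * real (d n) * real (k n))" for n
    define xh where "xh n = exp (- c4 * real (d n) * real (k n))" for n
    define yl where "yl n = (c1 * real (k n)) powr (- real (k n))" for n
    define yh where "yh n = (c2 * real (k n)) powr (- real (k n))" for n
    define L where "L n = real n * (xl n * yl n)" for n
    \<comment> \<open>Nonzero only where the lower bound \<open>L\<close> exceeds \<open>E\<close>;
      for large \<open>n\<close> this requires \<open>k n > n\<close>.\<close>
    define err where "err n = min 0 (E n - L n)" for n
    define N where "N n = real n powr (real (k n) / 2 * (3 - \<beta>))" for n
    have k1: "1 \<le> k n" for n using k3[rule_format, of n] by simp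
    have E0: "0 \<le> E n" for n unfolding E_def expected_cliques_def by simp
    have xs: "0 < xl n" "xl n \<le> xh n" "xl n \<le> 1" for n
      using c3 by (auto simp: xl_def xh_def intro!: mult_right_mono)
    have ys: "0 < yh n" "yl n \<le> yh n" "0 \<le> yl n" for n
      using c2 c1 k1[of n] by (auto simp: yl_def yh_def intro!: powr_neg_self_antimono)
    have large: "\<forall>\<^sub>F n in sequentially. 0 < n \<and> lam * w0 * w0 < real n"
      using eventually_gt_at_top[of 0] eventually_gt_at_top[of "nat \<lceil>lam * w0 * w0\<rceil>"]
      by eventually_elim linarith
    have lowerA: "L n \<le> E n" if "lam * w0 * w0 < real n" "k n \<le> n" for n
    proof -
      have "xl n \<le> exp (- ln 2 * real (d n) * real (k n))"
        unfolding xl_def using c3 by (auto intro!: mult_right_mono)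
      then have "L n \<le> real n * (exp (- ln 2 * real (d n) * real (k n)) * yl n)"
        unfolding L_def using ys by (intro mult_left_mono mult_right_mono) auto
      also have "\<dots> \<le> E n"
        unfolding yl_def E_def using that c1 c1L d1 k1 by (intro expected_cliques_lower_ball a) auto
      finally show ?thesis .
    qed
    have err0: "err \<longlonglongrightarrow> 0"
    proof (rule tendsto_sandwich[OF _ _ _ tendsto_const])
      show "(\<lambda>n. - inverse (real n)) \<longlonglongrightarrow> 0"
        using tendsto_minus[OF lim_inverse_n] by simp
      show "\<forall>\<^sub>F n in sequentially. err n \<le> 0" by (simp add: err_def)
      show "\<forall>\<^sub>F n in sequentially. - inverse (real n) \<le> err n"
        using large
      proof eventually_elim
        case (elim n)
        show ?case
        proof (cases "k n \<le> n")
          case True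
          then show ?thesis using lowerA[of n] elim by (simp add: err_def)
        next
          case False
          \<comment> \<open>From \<open>k n > n\<close> and \<open>k n \<ge> 3\<close> follows
            \<open>k powr (- k) \<le> n powr (- 2)\<close>, so that \<open>L\<close> itself is at
            most \<open>1 / n\<close>.\<close>
          have "yl n \<le> (1 * real (k n)) powr (- real (k n))"
            unfolding yl_def using c1 k1 by (intro powr_neg_self_antimono) auto
          also have "\<dots> \<le> (1 * real (k n)) powr (- 2)"
            using k1[of n] k3[rule_format, of n] by (intro powr_mono) auto
          also have "\<dots> \<le> real n powr (- 2)"
            using False elim by (intro powr_mono2') auto
          finally have "xl n * yl n \<le> 1 * real n powr (- 2)"
            using xs[of n] ys[of n] by (intro mult_mono) auto
          then have "L n \<le> real n * real n powr (- 2)"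
            unfolding L_def by (intro mult_left_mono) auto
          also have "\<dots> = inverse (real n)"
            using elim by (simp add: powr_minus powr_numeral power2_eq_square)
          finally have "L n \<le> inverse (real n)" .
          then show ?thesis using E0[of n] by (simp add: err_def)
        qed
      qed
    qed
    define good where "good n X Y \<longleftrightarrow>
      (if sparse n then E n = real n * X * Y + err n \<and> xl n \<le> X \<and> X \<le> xh n \<and> yl n \<le> Y \<and> Y \<le> yh n
       else E n = N n * Y \<and> (k n \<le> n \<longrightarrow> yl n \<le> Y) \<and> (real (k n) \<noteq> 2 / (3 - \<beta>) \<longrightarrow> Y \<le> yh n))" for n X Y
    have negl: "\<forall>\<^sub>F n in sequentially. sparse n \<longrightarrow>
        real n powr (real (k n) / 2 * (3 - \<beta>)) * exp (M * real (d n) * real (k n)) \<le> real n"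
      unfolding sparse_def by (rule eventually_hubs_negligible[OF pos(3) \<delta> d1 d k]) (rule gapA)
    have ev: "\<forall>\<^sub>F n in sequentially. \<exists>X Y. good n X Y"
      using large negl
    proof eventually_elim
      case (elim n)
      have dn: "1 \<le> d n" "3 \<le> k n" using d1 k3 by auto
      show ?case
      proof (cases "sparse n")
        case True
        have "E n \<le> real n * (xh n * (cA * real (k n)) powr (- real (k n)))"
          unfolding E_def xh_def using True elim dn gapA[of "k n"]
          by (intro upperA) (auto simp: sparse_def)
        also have "\<dots> \<le> real n * (xh n * yh n)"
          unfolding yh_def using c2 k1 xs by (intro mult_left_mono powr_neg_self_antimono) (auto simp: xh_def)
        finally have up: "E n \<le> real n * (xh n * yh n)" .
        have "L n \<le> real n * (xh n * yh n)"
          unfolding L_def using xs[of n] ys[of n] by (intro mult_left_mono mult_mono) auto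
        \<comment> \<open>\<open>E - err\<close> is \<open>max E L\<close>, which satisfies both
          product bounds and is therefore the quantity to be factored.\<close>
        with up have "max (E n) (L n) / real n \<le> xh n * yh n"
          using elim by (simp add: field_simps)
        moreover have "xl n * yl n \<le> max (E n) (L n) / real n"
          using elim by (simp add: L_def field_simps)
        ultimately obtain X Y where XY: "max (E n) (L n) / real n = X * Y" "xl n \<le> X" "X \<le> xh n" "yl n \<le> Y" "Y \<le> yh n"
          using product_between[OF xs(1) ys(1) xs(2) ys(2), of n n] by blast
        have "real n * X * Y + err n = max (E n) (L n) + err n"
          using elim unfolding mult.assoc XY(1)[symmetric] by simp
        also have "\<dots> = E n" by (simp add: err_def)
        finally have "good n X Y" using XY True unfolding good_def by simp
        then show ?thesis by blast
      next
        case False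
        then have b: "\<beta> < 3" "2 / (3 - \<beta>) \<le> real (k n)" by (auto simp: sparse_def)
        have N: "N n > 0" using elim by (simp add: N_def)
        have "yl n \<le> E n / N n" if "k n \<le> n"
        proof -
          have "N n * yl n \<le> E n"
            unfolding N_def yl_def E_def using elim dn k1 that c1 c1h
            by (intro expected_cliques_lower_hubs a) (auto simp: h_def)
          then show ?thesis using N by (simp add: field_simps)
        qed
        moreover have "E n / N n \<le> yh n" if "real (k n) \<noteq> 2 / (3 - \<beta>)"
        proof -
          have "E n \<le> N n * (cB * real (k n)) powr (- real (k n))"
            unfolding E_def N_def using elim dn b that gapB[of "k n"] by (intro upperB) auto
          also have "\<dots> \<le> N n * yh n"
            unfolding yh_def using c2 k1 N by (intro mult_left_mono powr_neg_self_antimono) auto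
          finally show ?thesis using N by (simp add: field_simps)
        qed
        ultimately have "good n 0 (E n / N n)"
          unfolding good_def using False N by auto
        then show ?thesis by blast
      qed
    qed
    \<comment> \<open>\<open>good\<close> is available only for large \<open>n\<close>; elsewhere
      the chosen values are arbitrary.\<close>
    define X where "X n = (SOME X. \<exists>Y. good n X Y)" for n
    define Y where "Y n = (SOME Y. good n (X n) Y)" for n
    have "\<forall>\<^sub>F n in sequentially. good n (X n) (Y n)"
      using ev
    proof eventually_elim
      case (elim n)
      then have "\<exists>Y. good n (X n) Y" unfolding X_def by (rule someI_ex)
      then show ?case unfolding Y_def by (rule someI_ex)
    qed
    then show "\<exists>(X :: nat \<Rightarrow> real) (Y :: nat \<Rightarrow> real) (err :: nat \<Rightarrow> real).
      err \<longlonglongrightarrow> 0 \<and>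
      (\<forall>\<^sub>F n in sequentially.
        if real (k n) < 2 / (3 - \<beta>) \<or> \<beta> \<ge> 3
        then
          expected_cliques lam w0 \<beta> n (d n) (k n) = real n * X n * Y n + err n \<and>
          exp (- c3 * real (d n) * real (k n)) \<le> X n \<and>
          X n \<le> exp (- c4 * real (d n) * real (k n)) \<and>
          (c1 * real (k n)) powr (- real (k n)) \<le> Y n \<and>
          Y n \<le> (c2 * real (k n)) powr (- real (k n))
        else
          expected_cliques lam w0 \<beta> n (d n) (k n)
            = real n powr (real (k n) / 2 * (3 - \<beta>)) * Y n \<and>
          (k n \<le> n \<longrightarrow> (c1 * real (k n)) powr (- real (k n)) \<le> Y n) \<and>
          (real (k n) \<noteq> 2 / (3 - \<beta>) \<longrightarrow> Y n \<le> (c2 * real (k n)) powr (- real (k n))))"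
      using err0 unfolding good_def sparse_def E_def xl_def xh_def yl_def yh_def N_def by blast
  qed
qed

end
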